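(* The weak maximizing property is not stable under duality, even among real reflexive spaces which can be chosen arbitrarily close to $\ell_2$ in Banach--Mazur distance. More precisely, for every $0<c<1$, let $E_c=X_c^*$. Then $E_c$ is a real reflexive Banach space such that the pair $(E_c,E_c)$ has the weak maximizing property, the pair $(E_c^*,E_c^* )$ does not have the weak maximizing property, and $$d_{\mathrm{BM}}(E_c,\ell_2)\le c^{-1}.$$
   Context: All Banach spaces are real; $E^*$ is the dual of $E$ with the dual norm. $\mathcal L(E,F)$ denotes the bounded linear operators from $E$ to $F$; $S_E$ is the unit sphere of $E$. An operator $T\in\mathcal L(E,F)$ attains its norm if $\|Tx\|=\|T\|$ for some $x\in S_E$. A sequence $(x_n)\subset S_E$ is a maximizing sequence for $T$ if $\|Tx_n\|\to\|T\|$. A pair $(E,F)$ has the weak maximizing property (WMP) if every $T\in\mathcal L(E,F)$ which admits a maximizing sequence that is not weakly null attains its norm. The Banach--Mazur distance is $d_{\mathrm{BM}}(E,F)=\inf\{\|U\|\,\|U^{-1}\|: U:E\to F\text{ is an isomorphism}\}$. Definition of $X_c$. A norm $N$ on $\mathbb R^2$ is absolute if $N(s,t)=N(|s|,|t|)$ and normalized if $N(1,0)=N(0,1)=1$. Given a sequence $(N_n)_{n\ge1}$ of absolute normalized norms on $\mathbb R^2$, define norms $M_n$ on $\mathbb R^{n+1}$ by $M_0(x_0)=|x_0|$ and $M_n(x_0,\dots,x_n)=N_n(M_{n-1}(x_0,\dots,x_{n-1}),|x_n|)$ for $n\ge1$. For a finitely supported real sequence $x=(x_j)_{j\ge0}\in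 c_{00}$ put $\|x\|=M_n(x_0,\dots,x_n)$ for any $n$ with $x_j=0$ for all $j>n$ (this is independent of $n$). $A(N_n)$ denotes the completion of $c_{00}$ in this norm, with canonical basis $(e_j)_{j\ge0}$. For $0<c<1$ and $n\ge1$ let $$N_{n,c}(s,t)=\left[(1-c^{2n})|t|^{2n}+(s^2+c^2t^2)^n\right]^{1/(2n)},$$ which is an absolute normalized norm on $\mathbb R^2$, and set $X_c:=A(N_{n,c})$. *)

theory Defs
  imports "HOL-Analysis.Analysis" "HOL-Library.FuncSet"
begin

text \<open>
  The spaces considered here depend on a real parameter, so they cannot be types of class
  \<^class>\<open>banach\<close> (whose norm is fixed by the type).  A real normed space is therefore a record with
  an explicit carrier; outside the carrier the operations are arbitrary.
\<close>

record 'a nspace =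
  vcarrier :: "'a set"
  vzero :: 'a
  vadd :: "'a \<Rightarrow> 'a \<Rightarrow> 'a"
  vscale :: "real \<Rightarrow> 'a \<Rightarrow> 'a"
  vnorm :: "'a \<Rightarrow> real"

locale normed_space =
  fixes V :: "'a nspace"
  assumes zero_closed: "vzero V \<in> vcarrier V"
    and add_closed: "\<lbrakk>x \<in> vcarrier V; y \<in> vcarrier V\<rbrakk> \<Longrightarrow> vadd V x y \<in> vcarrier V"
    and scale_closed: "x \<in> vcarrier V \<Longrightarrow> vscale V a x \<in> vcarrier V"
    and add_assoc: "\<lbrakk>x \<in> vcarrier V; y \<in> vcarrier V; z \<in> vcarrier V\<rbrakk>
          \<Longrightarrow> vadd V (vadd V x y) z = vadd V x (vadd V y z)"
    and add_commute: "\<lbrakk>x \<in> vcarrier V; y \<in> vcarrier V\<rbrakk> \<Longrightarrow> vadd V x y = vadd V y x"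
    and add_zero: "x \<in> vcarrier V \<Longrightarrow> vadd V x (vzero V) = x"
    and add_inverse: "x \<in> vcarrier V \<Longrightarrow> vadd V x (vscale V (- 1) x) = vzero V"
    and scale_add_right: "\<lbrakk>x \<in> vcarrier V; y \<in> vcarrier V\<rbrakk>
          \<Longrightarrow> vscale V a (vadd V x y) = vadd V (vscale V a x) (vscale V a y)"
    and scale_add_left: "x \<in> vcarrier V
          \<Longrightarrow> vscale V (a + b) x = vadd V (vscale V a x) (vscale V b x)"
    and scale_scale: "x \<in> vcarrier V \<Longrightarrow> vscale V a (vscale V b x) = vscale V (a * b) x"
    and scale_one: "x \<in> vcarrier V \<Longrightarrow> vscale V 1 x = x"
    and norm_nonneg: "x \<in> vcarrier V \<Longrightarrow> 0 \<le> vnorm V x"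
    and norm_eq_zero: "x \<in> vcarrier V \<Longrightarrow> vnorm V x = 0 \<longleftrightarrow> x = vzero V"
    and norm_scale: "x \<in> vcarrier V \<Longrightarrow> vnorm V (vscale V a x) = \<bar>a\<bar> * vnorm V x"
    and norm_triangle: "\<lbrakk>x \<in> vcarrier V; y \<in> vcarrier V\<rbrakk>
          \<Longrightarrow> vnorm V (vadd V x y) \<le> vnorm V x + vnorm V y"

text \<open>
  The locale \<^locale>\<open>Metric_space\<close> demands symmetry and nonnegativity on the whole type, hence the
  value 0 outside the carrier.
\<close>

definition vdist :: "'a nspace \<Rightarrow> 'a \<Rightarrow> 'a \<Rightarrow> real" where
  "vdist V x y = (if x \<in> vcarrier V \<and> y \<in> vcarrier V
                  then vnorm V (vadd V x (vscale V (- 1) y)) else 0)"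

locale banach_space = normed_space +
  assumes complete: "Metric_space.mcomplete (vcarrier V) (vdist V)"

definition unit_sphere :: "'a nspace \<Rightarrow> 'a set" where
  "unit_sphere V = {x \<in> vcarrier V. vnorm V x = 1}"


subsection \<open>Operators and duals\<close>

text \<open>Values of an operator outside the carrier of its domain are irrelevant.\<close>

definition bounded_operator :: "'a nspace \<Rightarrow> 'b nspace \<Rightarrow> ('a \<Rightarrow> 'b) \<Rightarrow> bool" where
  "bounded_operator V W T \<longleftrightarrow>
     T \<in> vcarrier V \<rightarrow> vcarrier W \<and>
     (\<forall>x\<in>vcarrier V. \<forall>y\<in>vcarrier V. T (vadd V x y) = vadd W (T x) (T y)) \<and>
     (\<forall>a. \<forall>x\<in>vcarrier V. T (vscale V a x) = vscale W a (T x)) \<and>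
     (\<exists>K. \<forall>x\<in>vcarrier V. vnorm W (T x) \<le> K * vnorm V x)"

definition op_norm :: "'a nspace \<Rightarrow> 'b nspace \<Rightarrow> ('a \<Rightarrow> 'b) \<Rightarrow> real" where
  "op_norm V W T = (SUP x\<in>{x \<in> vcarrier V. vnorm V x \<le> 1}. vnorm W (T x))"

definition real_line :: "real nspace" where
  "real_line = \<lparr>vcarrier = UNIV, vzero = 0, vadd = (+), vscale = (*), vnorm = abs\<rparr>"

text \<open>
  Functionals are made extensional so that functions agreeing on the carrier are equal.
\<close>

definition dual :: "'a nspace \<Rightarrow> ('a \<Rightarrow> real) nspace" where
  "dual V = \<lparr>
     vcarrier = {f \<in> extensional (vcarrier V). bounded_operator V real_line f},
     vzero = (\<lambda>x\<in>vcarrier V. 0),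
     vadd = (\<lambda>f g. \<lambda>x\<in>vcarrier V. f x + g x),
     vscale = (\<lambda>a f. \<lambda>x\<in>vcarrier V. a * f x),
     vnorm = op_norm V real_line\<rparr>"

definition canonical_embedding :: "'a nspace \<Rightarrow> 'a \<Rightarrow> ('a \<Rightarrow> real) \<Rightarrow> real" where
  "canonical_embedding V x = (\<lambda>f\<in>vcarrier (dual V). f x)"

definition reflexive_space :: "'a nspace \<Rightarrow> bool" where
  "reflexive_space V \<longleftrightarrow> canonical_embedding V ` vcarrier V = vcarrier (dual (dual V))"


subsection \<open>The weak maximizing property\<close>

definition attains_norm :: "'a nspace \<Rightarrow> 'b nspace \<Rightarrow> ('a \<Rightarrow> 'b) \<Rightarrow> bool" where
  "attains_norm V W T \<longleftrightarrow> (\<exists>x\<in>unit_sphere V. vnorm W (T x) = op_norm V W T)"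

definition maximizing_sequence ::
    "'a nspace \<Rightarrow> 'b nspace \<Rightarrow> ('a \<Rightarrow> 'b) \<Rightarrow> (nat \<Rightarrow> 'a) \<Rightarrow> bool" where
  "maximizing_sequence V W T x \<longleftrightarrow>
     range x \<subseteq> unit_sphere V \<and> (\<lambda>n. vnorm W (T (x n))) \<longlonglongrightarrow> op_norm V W T"

definition weakly_null :: "'a nspace \<Rightarrow> (nat \<Rightarrow> 'a) \<Rightarrow> bool" where
  "weakly_null V x \<longleftrightarrow> (\<forall>f\<in>vcarrier (dual V). (\<lambda>n. f (x n)) \<longlonglongrightarrow> 0)"

definition weak_maximizing_property :: "'a nspace \<Rightarrow> 'b nspace \<Rightarrow> bool" where
  "weak_maximizing_property V W \<longleftrightarrow>
     (\<forall>T. bounded_operator V W T \<and>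
          (\<exists>x. maximizing_sequence V W T x \<and> \<not> weakly_null V x)
        \<longrightarrow> attains_norm V W T)"


subsection \<open>Banach--Mazur distance\<close>

definition isomorphisms :: "'a nspace \<Rightarrow> 'b nspace \<Rightarrow> ('a \<Rightarrow> 'b) set" where
  "isomorphisms V W =
     {U. bounded_operator V W U \<and> bij_betw U (vcarrier V) (vcarrier W) \<and>
         bounded_operator W V (inv_into (vcarrier V) U)}"

text \<open>Extended real valued, so that the distance of non-isomorphic spaces is \<open>\<infinity>\<close>.\<close>

definition banach_mazur_distance :: "'a nspace \<Rightarrow> 'b nspace \<Rightarrow> ereal" where
  "banach_mazur_distance V W =
     (INF U\<in>isomorphisms V W.
        ereal (op_norm V W U * op_norm W V (inv_into (vcarrier V) U)))"

definition ell2 :: "(nat \<Rightarrow> real) nspace" where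
  "ell2 = \<lparr>
     vcarrier = {x. summable (\<lambda>j. (x j)\<^sup>2)},
     vzero = (\<lambda>j. 0),
     vadd = (\<lambda>x y j. x j + y j),
     vscale = (\<lambda>a x j. a * x j),
     vnorm = (\<lambda>x. sqrt (\<Sum>j. (x j)\<^sup>2))\<rparr>"


subsection \<open>Completion\<close>

definition cauchy_seqs :: "'a nspace \<Rightarrow> (nat \<Rightarrow> 'a) set" where
  "cauchy_seqs V = {\<sigma>. Metric_space.MCauchy (vcarrier V) (vdist V) \<sigma>}"

definition cauchy_rel :: "'a nspace \<Rightarrow> ((nat \<Rightarrow> 'a) \<times> (nat \<Rightarrow> 'a)) set" where
  "cauchy_rel V = {(\<sigma>, \<tau>). \<sigma> \<in> cauchy_seqs V \<and> \<tau> \<in> cauchy_seqs V \<and>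
                            (\<lambda>n. vdist V (\<sigma> n) (\<tau> n)) \<longlonglongrightarrow> 0}"

definition completion :: "'a nspace \<Rightarrow> (nat \<Rightarrow> 'a) set nspace" where
  "completion V = \<lparr>
     vcarrier = cauchy_seqs V // cauchy_rel V,
     vzero = cauchy_rel V `` {\<lambda>n. vzero V},
     vadd = (\<lambda>A B. \<Union>\<sigma>\<in>A. \<Union>\<tau>\<in>B. cauchy_rel V `` {\<lambda>n. vadd V (\<sigma> n) (\<tau> n)}),
     vscale = (\<lambda>a A. \<Union>\<sigma>\<in>A. cauchy_rel V `` {\<lambda>n. vscale V a (\<sigma> n)}),
     vnorm = (\<lambda>A. THE r. \<forall>\<sigma>\<in>A. (\<lambda>n. vnorm V (\<sigma> n)) \<longlonglongrightarrow> r)\<rparr>"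


subsection \<open>The spaces \<open>A(N\<^sub>n)\<close> and \<open>X\<^sub>c\<close>\<close>

text \<open>
  Only the values \<open>N n\<close> for \<open>n \<ge> 1\<close> matter.  The argument \<open>x\<close> is an infinite sequence of
  which \<open>iterated_norm N n\<close> reads the entries \<open>0, \<dots>, n\<close>.
\<close>

primrec iterated_norm ::
    "(nat \<Rightarrow> real \<Rightarrow> real \<Rightarrow> real) \<Rightarrow> nat \<Rightarrow> (nat \<Rightarrow> real) \<Rightarrow> real" where
  "iterated_norm N 0 x = \<bar>x 0\<bar>"
| "iterated_norm N (Suc n) x = N (Suc n) (iterated_norm N n x) \<bar>x (Suc n)\<bar>"

definition c00_space :: "(nat \<Rightarrow> real \<Rightarrow> real \<Rightarrow> real) \<Rightarrow> (nat \<Rightarrow> real) nspace" where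
  "c00_space N = \<lparr>
     vcarrier = {x. finite {j. x j \<noteq> 0}},
     vzero = (\<lambda>j. 0),
     vadd = (\<lambda>x y j. x j + y j),
     vscale = (\<lambda>a x j. a * x j),
     vnorm = (\<lambda>x. iterated_norm N (LEAST n. \<forall>j>n. x j = 0) x)\<rparr>"

definition A_space ::
    "(nat \<Rightarrow> real \<Rightarrow> real \<Rightarrow> real) \<Rightarrow> (nat \<Rightarrow> nat \<Rightarrow> real) set nspace" where
  "A_space N = completion (c00_space N)"

definition Nc :: "real \<Rightarrow> nat \<Rightarrow> real \<Rightarrow> real \<Rightarrow> real" where
  "Nc c n s t =
     root (2 * n) ((1 - c ^ (2 * n)) * \<bar>t\<bar> ^ (2 * n) + (s\<^sup>2 + c\<^sup>2 * t\<^sup>2) ^ n)"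

definition X_space :: "real \<Rightarrow> (nat \<Rightarrow> nat \<Rightarrow> real) set nspace" where
  "X_space c = A_space (Nc c)"

text \<open>
  The choice of \<open>n\<close> in the norm of \<^const>\<open>c00_space\<close> is immaterial when each \<open>N n\<close> is absolute
  and normalized, as then \<open>N n s 0 = s\<close> for \<open>s \<ge> 0\<close>.
\<close>

lemma iterated_norm_eq:
  assumes N: "\<And>n s. n \<ge> 1 \<Longrightarrow> s \<ge> 0 \<Longrightarrow> N n s 0 = s"
    and nonneg: "\<And>n s t. n \<ge> 1 \<Longrightarrow> N n s t \<ge> 0"
    and "\<forall>j>m. x j = 0"
  shows "iterated_norm N (m + k) x = iterated_norm N m x"
proof -
  have nn: "iterated_norm N n x \<ge> 0" for n
    by (cases n) (simp_all add: nonneg)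
  show ?thesis
  proof (induction k)
    case (Suc k)
    have "x (Suc (m + k)) = 0"
      using assms(3) by simp
    then show ?case
      using Suc N[OF _ nn, of "Suc (m + k)"] by simp
  qed simp
qed

lemma c00_space_norm_eq:
  assumes "\<And>n s. n \<ge> 1 \<Longrightarrow> s \<ge> 0 \<Longrightarrow> N n s 0 = s"
    and "\<And>n s t. n \<ge> 1 \<Longrightarrow> N n s t \<ge> 0"
    and n: "\<forall>j>n. x j = 0"
  shows "vnorm (c00_space N) x = iterated_norm N n x"
proof -
  let ?m = "LEAST n. \<forall>j>n. x j = 0"
  have m: "\<forall>j>?m. x j = 0" and le: "?m \<le> n"
    by (rule LeastI[of "\<lambda>n. \<forall>j>n. x j = 0", OF n], rule Least_le[of "\<lambda>n. \<forall>j>n. x j = 0", OF n])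
  show ?thesis
    using iterated_norm_eq[of N ?m x "n - ?m", OF assms(1,2) m]
    unfolding c00_space_def le_add_diff_inverse[OF le] by simp
qed

lemma Nc_zero_right:
  assumes "n \<ge> 1" "s \<ge> 0"
  shows "Nc c n s 0 = s"
proof -
  have "Nc c n s 0 = root (2 * n) (s ^ (2 * n))"
    using assms(1) by (simp add: Nc_def power_mult)
  then show ?thesis
    using assms by (simp only: real_root_power_cancel)
qed

lemma Nc_nonneg:
  assumes "0 < c" "c < 1"
  shows "Nc c n s t \<ge> 0"
proof -
  have "c ^ (2 * n) \<le> 1"
    using assms by (simp add: power_le_one)
  then show ?thesis
    unfolding Nc_def by (intro real_root_ge_zero add_nonneg_nonneg mult_nonneg_nonneg) auto
qed

end

theory Submission
  imports Defs
begin

text \<open>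
  Every norm \<open>N\<^sub>n\<close> satisfies \<open>s\<^sup>2 + c\<^sup>2 t\<^sup>2 \<le> N\<^sub>n(s, t)\<^sup>2 \<le> s\<^sup>2 + t\<^sup>2\<close>, so \<open>X\<^sub>c\<close> is the space of square
  summable sequences with an equivalent norm lying between \<open>c\<close> times the Hilbert norm and the Hilbert
  norm.  Hence \<open>X\<^sub>c\<close> and its dual \<open>E\<^sub>c\<close> are reflexive, \<open>E\<^sub>c\<close> is the same sequence space with the dual norm
  taken with respect to the inner product, and the identity bounds the distance to \<open>\<ell>\<^sub>2\<close> by \<open>1 / c\<close>.

  Why \<open>E\<^sub>c\<close> has the weak maximizing property.  Two facts about vectors \<open>u\<close>, \<open>v\<close> with successive supports
  carry the proof.  In \<open>X\<^sub>c\<close>, the norm of \<open>u + v\<close> depends on \<open>u\<close> only through the norm of \<open>u\<close>,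
  monotonically, because the norm is built by iteration; and \<open>\<parallel>u + v\<parallel>\<^sup>2 \<le> \<parallel>u\<parallel>\<^sup>2 + \<parallel>v\<parallel>\<^sup>2\<close>, because
  \<open>N\<^sub>n(s, t)\<^sup>2 - s\<^sup>2\<close> does not increase with \<open>s\<close>.  By duality \<open>E\<^sub>c\<close> inherits the first fact, and the second one turns
  into the lower estimate \<open>\<parallel>u\<parallel>\<^sup>2 + \<parallel>v\<parallel>\<^sup>2 \<le> \<parallel>u + v\<parallel>\<^sup>2\<close>.  Let \<open>T\<close> have norm 1 on \<open>E\<^sub>c\<close>, let \<open>z\<^sub>n\<close> be a maximizing
  sequence with weak limit \<open>x \<noteq> 0\<close>, and put \<open>w\<^sub>n = z\<^sub>n - x\<close>.  If \<open>\<parallel>T x\<parallel> < \<parallel>x\<parallel>\<close>, there are \<open>u\<close> and \<open>\<mu> < 1\<close>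
  with \<open>\<parallel>T x\<parallel> < \<parallel>T u\<parallel>\<close> and \<open>\<parallel>u\<parallel> < \<mu> \<parallel>x\<parallel>\<close>.  As \<open>w\<^sub>n\<close> and \<open>T w\<^sub>n\<close> are weakly null, the first fact gives, up to
  small errors,
  \<open>\<parallel>T z\<^sub>n\<parallel> \<le> \<parallel>T u + T w\<^sub>n\<parallel> \<le> \<parallel>u + w\<^sub>n\<parallel> \<le> \<parallel>\<mu> x + w\<^sub>n\<parallel> \<le> \<mu> \<parallel>z\<^sub>n\<parallel> + (1 - \<mu>) \<parallel>w\<^sub>n\<parallel>\<close>.
  The lower estimate keeps \<open>\<parallel>w\<^sub>n\<parallel>\<close> away from 1, so \<open>\<parallel>T z\<^sub>n\<parallel>\<close> cannot tend to 1.  So \<open>T\<close> attains its norm at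
  \<open>x / \<parallel>x\<parallel>\<close>.  This is lemma \<open>weak_limit_attains\<close>.

  Why \<open>E\<^sub>c\<^sup>*\<close>, which is \<open>X\<^sub>c\<close>, fails it.  For \<open>a = sqrt (1 - c\<^sup>2)\<close> the norm of \<open>a e\<^sub>0 + e\<^sub>n\<close> is \<open>N\<^sub>n(a, 1)\<close>,
  which tends to 1: in the limit the unit ball has a flat piece at \<open>e\<^sub>n\<close>.  The diagonal operator with
  entries \<open>j / (j + 1)\<close> kills \<open>e\<^sub>0\<close>, has norm 1, and is maximized along \<open>a e\<^sub>0 + e\<^sub>n\<close>, whose zeroth
  coordinate does not tend to 0.  It does not attain its norm, since it strictly decreases the norm
  of every nonzero vector.

  The bidual norm is identified with the original one through explicit norming functionals: those of
  the \<open>N\<^sub>n\<close> are gradients, and they compose along the iteration.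
\<close>

section \<open>Isometric isomorphisms\<close>

definition isometric_iso :: "'a nspace \<Rightarrow> 'b nspace \<Rightarrow> ('a \<Rightarrow> 'b) \<Rightarrow> bool" where
  "isometric_iso V W J \<longleftrightarrow>
     bij_betw J (vcarrier V) (vcarrier W) \<and>
     J (vzero V) = vzero W \<and>
     (\<forall>x\<in>vcarrier V. \<forall>y\<in>vcarrier V. J (vadd V x y) = vadd W (J x) (J y)) \<and>
     (\<forall>a. \<forall>x\<in>vcarrier V. J (vscale V a x) = vscale W a (J x)) \<and>
     (\<forall>x\<in>vcarrier V. vnorm W (J x) = vnorm V x)"

lemma normed_space_via_embedding:
  assumes W: "normed_space W"
    and inj: "inj_on J (vcarrier V)" and into: "J ` vcarrier V \<subseteq> vcarrier W"
    and zero: "vzero V \<in> vcarrier V" "J (vzero V) = vzero W"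
    and add: "\<And>x y. x \<in> vcarrier V \<Longrightarrow> y \<in> vcarrier V \<Longrightarrow>
                vadd V x y \<in> vcarrier V \<and> J (vadd V x y) = vadd W (J x) (J y)"
    and scale: "\<And>a x. x \<in> vcarrier V \<Longrightarrow>
                vscale V a x \<in> vcarrier V \<and> J (vscale V a x) = vscale W a (J x)"
    and norm: "\<And>x. x \<in> vcarrier V \<Longrightarrow> vnorm W (J x) = vnorm V x"
  shows "normed_space V"
proof -
  interpret W: normed_space W by fact
  have mem: "J x \<in> vcarrier W" if "x \<in> vcarrier V" for x
    using into that by blast
  note eqI = inj_onD[OF inj]
  show ?thesis
  proof (unfold_locales, goal_cases)
    case (4 x y z) then show ?case
      by (intro eqI) (simp_all add: add mem W.add_assoc)
  next
    case (5 x y) then show ?case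
      by (intro eqI) (simp_all add: add mem W.add_commute)
  next
    case (6 x) then show ?case
      by (intro eqI) (simp_all add: add zero mem W.add_zero)
  next
    case (7 x) then show ?case
      by (intro eqI) (simp_all add: add scale zero mem W.add_inverse)
  next
    case (8 x y a) then show ?case
      by (intro eqI) (simp_all add: add scale mem W.scale_add_right)
  next
    case (9 x a b) then show ?case
      by (intro eqI) (simp_all add: add scale mem W.scale_add_left)
  next
    case (10 x a b) then show ?case
      by (intro eqI) (simp_all add: scale mem W.scale_scale)
  next
    case (11 x) then show ?case
      by (intro eqI) (simp_all add: scale mem W.scale_one)
  next
    case (12 x) then show ?case
      by (metis norm mem W.norm_nonneg)
  next
    case (13 x) then show ?case
      by (metis norm mem W.norm_eq_zero zero inj inj_onD)
  next
    case (14 x a) then show ?case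
      by (metis norm mem W.norm_scale scale)
  next
    case (15 x y) then show ?case
      by (metis norm mem W.norm_triangle add)
  qed (simp_all add: zero add scale)
qed

lemma isometric_isoD:
  assumes "isometric_iso V W J"
  shows "bij_betw J (vcarrier V) (vcarrier W)" "inj_on J (vcarrier V)"
    and "J ` vcarrier V = vcarrier W" "J (vzero V) = vzero W"
    and "x \<in> vcarrier V \<Longrightarrow> J x \<in> vcarrier W"
    and "x \<in> vcarrier V \<Longrightarrow> y \<in> vcarrier V \<Longrightarrow> J (vadd V x y) = vadd W (J x) (J y)"
    and "x \<in> vcarrier V \<Longrightarrow> J (vscale V a x) = vscale W a (J x)"
    and "x \<in> vcarrier V \<Longrightarrow> vnorm W (J x) = vnorm V x"
  using assms by (auto simp: isometric_iso_def bij_betw_def)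

lemma isometric_iso_inv:
  assumes V: "normed_space V" and J: "isometric_iso V W J"
  shows "isometric_iso W V (inv_into (vcarrier V) J)"
proof -
  interpret V: normed_space V by fact
  let ?K = "inv_into (vcarrier V) J"
  note J = isometric_isoD[OF J]
  have K: "?K y \<in> vcarrier V" "J (?K y) = y" if "y \<in> vcarrier W" for y
    using that J(3) by (auto intro: inv_into_into f_inv_into_f)
  have KJ: "?K (J x) = x" if "x \<in> vcarrier V" for x
    using that J(2) by simp
  show ?thesis
    unfolding isometric_iso_def
  proof (intro conjI ballI allI)
    show "bij_betw ?K (vcarrier W) (vcarrier V)"
      using J(1) by (rule bij_betw_inv_into)
    show "?K (vzero W) = vzero V"
      using KJ[OF V.zero_closed] J(4) by simp
    fix x assume x: "x \<in> vcarrier W"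
    show "vnorm V (?K x) = vnorm W x"
      using J(8)[OF K(1)[OF x]] K(2)[OF x] by simp
    show "?K (vscale W a x) = vscale V a (?K x)" for a
      using KJ[OF V.scale_closed[OF K(1)[OF x]]] J(7)[OF K(1)[OF x]] K(2)[OF x] by metis
    fix y assume y: "y \<in> vcarrier W"
    show "?K (vadd W x y) = vadd V (?K x) (?K y)"
      using KJ[OF V.add_closed[OF K(1)[OF x] K(1)[OF y]]] J(6)[OF K(1)[OF x] K(1)[OF y]]
        K(2)[OF x] K(2)[OF y] by metis
  qed
qed

lemma isometric_iso_trans:
  assumes "isometric_iso U V J" "isometric_iso V W K"
  shows "isometric_iso U W (K \<circ> J)"
  unfolding isometric_iso_def
  using isometric_isoD[OF assms(1)] isometric_isoD[OF assms(2)]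
  by (auto intro: bij_betw_trans)

lemma isometric_iso_normed_space:
  assumes V: "normed_space V" and J: "isometric_iso V W J"
  shows "normed_space W"
proof -
  interpret V: normed_space V by fact
  note K = isometric_isoD[OF isometric_iso_inv[OF V J]] and J' = isometric_isoD[OF J]
  have W: "\<exists>x\<in>vcarrier V. y = J x" if "y \<in> vcarrier W" for y
    using that J'(3) by blast
  have zeroW: "vzero W \<in> vcarrier W"
    using J'(5)[OF V.zero_closed] J'(4) by simp
  have addW: "vadd W x y \<in> vcarrier W" if xy: "x \<in> vcarrier W" "y \<in> vcarrier W" for x y
  proof -
    obtain a b where ab: "a \<in> vcarrier V" "x = J a" "b \<in> vcarrier V" "y = J b"
      using W[OF xy(1)] W[OF xy(2)] by blast
    have "J (vadd V a b) \<in> vcarrier W"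
      using ab by (intro J'(5) V.add_closed)
    then show ?thesis using ab J'(6) by simp
  qed
  have scaleW: "vscale W a x \<in> vcarrier W" if x: "x \<in> vcarrier W" for a x
  proof -
    obtain b where b: "b \<in> vcarrier V" "x = J b" using W[OF x] by blast
    have "J (vscale V a b) \<in> vcarrier W"
      using b by (intro J'(5) V.scale_closed)
    then show ?thesis using b J'(7) by simp
  qed
  show ?thesis
    by (rule normed_space_via_embedding[OF V K(2)])
      (simp_all add: K zeroW addW scaleW)
qed

lemma (in normed_space) Metric_space_vdist: "Metric_space (vcarrier V) (vdist V)"
proof -
  let ?d = "\<lambda>x y. vadd V x (vscale V (- 1) y)"
  have d: "?d x y \<in> vcarrier V" if "x \<in> vcarrier V" "y \<in> vcarrier V" for x y
    using that by (simp add: add_closed scale_closed)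
  have swap: "?d y x = vscale V (- 1) (?d x y)" if "x \<in> vcarrier V" "y \<in> vcarrier V" for x y
    using that by (simp add: scale_add_right scale_closed scale_scale scale_one add_commute)
  have split: "?d x z = vadd V (?d x y) (?d y z)"
    if x: "x \<in> vcarrier V" and y: "y \<in> vcarrier V" and z: "z \<in> vcarrier V" for x y z
  proof -
    have "vadd V (?d x y) (?d y z) = vadd V x (vadd V (vadd V (vscale V (- 1) y) y) (vscale V (- 1) z))"
      using x y z by (simp add: add_assoc add_closed scale_closed)
    also have "vadd V (vscale V (- 1) y) y = vzero V"
      using y add_inverse[OF y] add_commute[OF y scale_closed[OF y]] by simp
    also have "vadd V (vzero V) (vscale V (- 1) z) = vscale V (- 1) z"
      using z by (simp add: add_commute[OF zero_closed] scale_closed add_zero)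
    finally show ?thesis by simp
  qed
  show ?thesis
  proof
    show "0 \<le> vdist V x y" for x y
      by (simp add: vdist_def d norm_nonneg)
    show "vdist V x y = vdist V y x" for x y
      using swap[of x y] d[of x y] by (simp add: vdist_def norm_scale)
    show "(vdist V x y = 0) \<longleftrightarrow> (x = y)" if x: "x \<in> vcarrier V" and y: "y \<in> vcarrier V" for x y
    proof
      assume "vdist V x y = 0"
      then have z: "?d x y = vzero V"
        using x y d by (simp add: vdist_def norm_eq_zero)
      have "x = vadd V (?d x y) y"
        using split[OF x y zero_closed] x y z add_inverse[OF y]
        by (metis add_assoc add_commute add_zero scale_closed)
      then show "x = y"
        using z y by (metis add_commute add_zero zero_closed)
    qed (use x y in \<open>simp add: vdist_def add_inverse norm_eq_zero zero_closed\<close>)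
    show "vdist V x z \<le> vdist V x y + vdist V y z"
      if "x \<in> vcarrier V" "y \<in> vcarrier V" "z \<in> vcarrier V" for x y z
      using that norm_triangle[OF d d, of x y y z] split[of x y z] by (simp add: vdist_def)
  qed
qed

lemma isometric_iso_banach:
  assumes V: "banach_space V" and J: "isometric_iso V W J"
  shows "banach_space W"
proof -
  interpret V: banach_space V by fact
  have nV: "normed_space V" by unfold_locales
  have nW: "normed_space W"
    using isometric_iso_normed_space[OF nV J] .
  interpret W: normed_space W by fact
  interpret MV: Metric_space "vcarrier V" "vdist V" by (rule V.Metric_space_vdist)
  interpret MW: Metric_space "vcarrier W" "vdist W" by (rule W.Metric_space_vdist)
  let ?K = "inv_into (vcarrier V) J"
  note J' = isometric_isoD[OF J] and K = isometric_isoD[OF isometric_iso_inv[OF nV J]]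
  have dJ: "vdist W (J x) (J y) = vdist V x y" if x: "x \<in> vcarrier V" and y: "y \<in> vcarrier V" for x y
    using J'(8)[OF V.add_closed[OF x V.scale_closed[OF y]], of "- 1"]
    by (simp add: vdist_def x y J' V.scale_closed)
  have JK: "J (?K y) = y" if "y \<in> vcarrier W" for y
    using that J'(3) by (auto intro: f_inv_into_f)
  have "MW.mcomplete"
    unfolding MW.mcomplete_def
  proof (intro allI impI)
    fix \<sigma> assume C: "MW.MCauchy \<sigma>"
    then have \<sigma>: "\<sigma> n \<in> vcarrier W" for n by (auto simp: MW.MCauchy_def)
    have d: "vdist V (?K (\<sigma> m)) (?K (\<sigma> n)) = vdist W (\<sigma> m) (\<sigma> n)" for m n
      using dJ[OF K(5)[OF \<sigma>[of m]] K(5)[OF \<sigma>[of n]]] JK[OF \<sigma>] by simp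
    have "MV.MCauchy (?K \<circ> \<sigma>)"
      using C K(5)[OF \<sigma>] by (auto simp: MV.MCauchy_def MW.MCauchy_def d)
    then obtain x where x: "limitin MV.mtopology (?K \<circ> \<sigma>) x sequentially"
      using V.complete unfolding MV.mcomplete_def by blast
    then have xV: "x \<in> vcarrier V" by (simp add: MV.limit_metric_sequentially)
    have d2: "vdist V (?K (\<sigma> n)) x = vdist W (\<sigma> n) (J x)" for n
      using dJ[OF K(5)[OF \<sigma>[of n]] xV] JK[OF \<sigma>] by simp
    have "limitin MW.mtopology \<sigma> (J x) sequentially"
      using x J'(5)[OF xV] \<sigma>
      by (fastforce simp: MV.limit_metric_sequentially MW.limit_metric_sequentially d2)
    then show "\<exists>x. limitin MW.mtopology \<sigma> x sequentially" by blast
  qed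
  then show ?thesis
    by unfold_locales
qed

lemma isometric_iso_op_norm:
  assumes J: "isometric_iso V W J" and ST: "\<And>x. x \<in> vcarrier V \<Longrightarrow> vnorm Y (S x) = vnorm Z (T (J x))"
  shows "op_norm V Y S = op_norm W Z T"
proof -
  note J' = isometric_isoD[OF J]
  have "{y \<in> vcarrier W. vnorm W y \<le> 1} = J ` {x \<in> vcarrier V. vnorm V x \<le> 1}"
    unfolding J'(3)[symmetric] using J'(8) by auto
  then show ?thesis
    unfolding op_norm_def by (simp add: image_image ST)
qed

lemma dual_simps:
  "vcarrier (dual V) = {f \<in> extensional (vcarrier V). bounded_operator V real_line f}"
  "vzero (dual V) = (\<lambda>x\<in>vcarrier V. 0)"
  "vadd (dual V) f g = (\<lambda>x\<in>vcarrier V. f x + g x)"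
  "vscale (dual V) a f = (\<lambda>x\<in>vcarrier V. a * f x)"
  "vnorm (dual V) = op_norm V real_line"
  by (simp_all add: dual_def)

lemma real_line_simps:
  "vcarrier real_line = UNIV" "vzero real_line = 0" "vadd real_line = (+)"
  "vscale real_line = (*)" "vnorm real_line = abs"
  by (simp_all add: real_line_def)

lemma bounded_operator_comp:
  assumes "bounded_operator U V S" "bounded_operator V W T" "normed_space V"
  shows "bounded_operator U W (T \<circ> S)"
proof -
  interpret V: normed_space V by fact
  obtain K where K: "\<And>x. x \<in> vcarrier U \<Longrightarrow> vnorm V (S x) \<le> K * vnorm U x"
    using assms(1) unfolding bounded_operator_def by blast
  obtain L where L: "\<And>x. x \<in> vcarrier V \<Longrightarrow> vnorm W (T x) \<le> L * vnorm V x"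
    using assms(2) unfolding bounded_operator_def by blast
  have S: "\<And>x. x \<in> vcarrier U \<Longrightarrow> S x \<in> vcarrier V"
    using assms(1) by (auto simp: bounded_operator_def)
  have "vnorm W (T (S x)) \<le> (\<bar>L\<bar> * K) * vnorm U x" if x: "x \<in> vcarrier U" for x
  proof -
    have "vnorm W (T (S x)) \<le> L * vnorm V (S x)" using L S x by blast
    also have "\<dots> \<le> \<bar>L\<bar> * vnorm V (S x)"
      by (rule mult_right_mono) (auto simp: V.norm_nonneg S x)
    also have "\<dots> \<le> \<bar>L\<bar> * (K * vnorm U x)"
      by (rule mult_left_mono) (auto simp: K x)
    finally show ?thesis by (simp add: mult.assoc)
  qed
  then show ?thesis
    using assms(1,2) unfolding bounded_operator_def by (auto simp: Pi_iff)
qed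

lemma isometric_iso_bounded_operator:
  "isometric_iso V W J \<Longrightarrow> bounded_operator V W J"
  unfolding bounded_operator_def
  by (auto simp: isometric_isoD Pi_iff intro!: exI[of _ 1])

lemma bounded_operator_cong:
  assumes "normed_space V" "\<And>x. x \<in> vcarrier V \<Longrightarrow> S x = T x"
  shows "bounded_operator V W S \<longleftrightarrow> bounded_operator V W T"
proof -
  interpret V: normed_space V by fact
  show ?thesis
    unfolding bounded_operator_def using assms(2)
    by (auto simp: Pi_iff V.add_closed V.scale_closed)
qed

text \<open>
  The adjoint of an isometric isomorphism.  It has to be restricted to the carrier, since elements of
  a dual are extensional.
\<close>
lemma isometric_iso_dual:
  assumes V: "normed_space V" and J: "isometric_iso V W J"
  shows "isometric_iso (dual W) (dual V) (\<lambda>g. \<lambda>x\<in>vcarrier V. g (J x))"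
    (is "isometric_iso _ _ ?A")
proof -
  interpret V: normed_space V by fact
  have W: "normed_space W" using isometric_iso_normed_space[OF V J] .
  interpret W: normed_space W by fact
  let ?K = "inv_into (vcarrier V) J"
  note J' = isometric_isoD[OF J] and KI = isometric_iso_inv[OF V J]
  note K = isometric_isoD[OF KI]
  have JK: "J (?K y) = y" if "y \<in> vcarrier W" for y
    using that J'(3) by (auto intro: f_inv_into_f)
  have KJ: "?K (J x) = x" if "x \<in> vcarrier V" for x
    using that J'(2) by simp
  let ?B = "\<lambda>f. \<lambda>y\<in>vcarrier W. f (?K y)"
  have bounded: "bounded_operator V real_line (?A g)" if "bounded_operator W real_line g" for g
    using bounded_operator_comp[OF isometric_iso_bounded_operator[OF J] that W]
    by (subst bounded_operator_cong[OF V, of _ "g \<circ> J"]) auto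
  have bounded': "bounded_operator W real_line (?B f)" if "bounded_operator V real_line f" for f
    using bounded_operator_comp[OF isometric_iso_bounded_operator[OF KI] that V]
    by (subst bounded_operator_cong[OF W, of _ "f \<circ> ?K"]) auto
  have BA: "?B (?A g) = g" if "g \<in> vcarrier (dual W)" for g
    using that by (auto simp: dual_simps fun_eq_iff K JK extensional_def)
  have AB: "?A (?B f) = f" if "f \<in> vcarrier (dual V)" for f
    using that by (auto simp: dual_simps fun_eq_iff J' KJ extensional_def)
  have "bij_betw ?A (vcarrier (dual W)) (vcarrier (dual V))"
  proof (rule bij_betw_byWitness[of _ ?B])
    show "\<forall>g\<in>vcarrier (dual W). ?B (?A g) = g" using BA by blast
    show "\<forall>f\<in>vcarrier (dual V). ?A (?B f) = f" using AB by blast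
    show "?A ` vcarrier (dual W) \<subseteq> vcarrier (dual V)"
      using bounded by (auto simp: dual_simps)
    show "?B ` vcarrier (dual V) \<subseteq> vcarrier (dual W)"
      using bounded' by (auto simp: dual_simps)
  qed
  moreover have "op_norm V real_line (?A g) = op_norm W real_line g" for g
    by (rule isometric_iso_op_norm[OF J]) simp
  ultimately show ?thesis
    unfolding isometric_iso_def by (auto simp: dual_simps J' fun_eq_iff)
qed

lemma isometric_iso_attains_norm:
  assumes J: "isometric_iso V W J"
    and ST: "\<And>x. x \<in> vcarrier V \<Longrightarrow> vnorm Y (S x) = vnorm Z (T (J x))"
  shows "attains_norm V Y S \<longleftrightarrow> attains_norm W Z T"
proof -
  note J' = isometric_isoD[OF J]
  have "unit_sphere W = J ` unit_sphere V"
    unfolding unit_sphere_def J'(3)[symmetric] using J'(8) by auto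
  then show ?thesis
    using isometric_iso_op_norm[where S=S and T=T and Y=Y and Z=Z, OF J ST]
    by (auto simp: attains_norm_def ST unit_sphere_def)
qed

text \<open>
  Conjugating an operator by an isometric isomorphism preserves its norm and its norming vectors; the
  adjoint carries functionals over, so a sequence is weakly null exactly when its image is.
\<close>
theorem isometric_iso_wmp:
  assumes V: "normed_space V" and J: "isometric_iso V W J"
    and wmp: "weak_maximizing_property V V"
  shows "weak_maximizing_property W W"
  unfolding weak_maximizing_property_def
proof (intro allI impI, elim conjE exE)
  fix T y
  assume T: "bounded_operator W W T" and y: "maximizing_sequence W W T y" "\<not> weakly_null W y"
  interpret V: normed_space V by fact
  have W: "normed_space W" using isometric_iso_normed_space[OF V J] .
  let ?K = "inv_into (vcarrier V) J"
  note J' = isometric_isoD[OF J] and KI = isometric_iso_inv[OF V J]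
  note K = isometric_isoD[OF KI]
  have JK: "J (?K y) = y" if "y \<in> vcarrier W" for y
    using that J'(3) by (auto intro: f_inv_into_f)
  define S where "S = ?K \<circ> (T \<circ> J)"
  have TJ: "T (J x) \<in> vcarrier W" if "x \<in> vcarrier V" for x
    using T J'(5)[OF that] by (auto simp: bounded_operator_def)
  have S: "bounded_operator V V S"
    unfolding S_def
    by (intro bounded_operator_comp[OF _ isometric_iso_bounded_operator[OF KI] W]
        bounded_operator_comp[OF isometric_iso_bounded_operator[OF J] T W])
  have ST: "vnorm V (S x) = vnorm W (T (J x))" if "x \<in> vcarrier V" for x
    by (simp add: S_def K(8) TJ that)
  have opeq: "op_norm V V S = op_norm W W T"
    using isometric_iso_op_norm[where S=S and T=T and Y=V and Z=W, OF J ST] .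
  let ?x = "?K \<circ> y"
  have yW: "y n \<in> vcarrier W" "vnorm W (y n) = 1" for n
    using y(1) by (auto simp: maximizing_sequence_def unit_sphere_def)
  have "maximizing_sequence V V S ?x"
    using y(1) by (auto simp: maximizing_sequence_def unit_sphere_def K yW ST JK opeq)
  moreover have "\<not> weakly_null V ?x"
  proof
    assume null: "weakly_null V ?x"
    have "weakly_null W y"
      unfolding weakly_null_def
    proof
      fix g assume g: "g \<in> vcarrier (dual W)"
      have "(\<lambda>x\<in>vcarrier V. g (J x)) \<in> vcarrier (dual V)"
        by (rule isometric_isoD(5)[OF isometric_iso_dual[OF V J] g])
      then have "(\<lambda>n. (\<lambda>x\<in>vcarrier V. g (J x)) (?x n)) \<longlonglongrightarrow> 0"
        using null by (auto simp: weakly_null_def)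
      then show "(\<lambda>n. g (y n)) \<longlonglongrightarrow> 0"
        by (simp add: K yW JK)
    qed
    then show False using y(2) by blast
  qed
  ultimately have "attains_norm V V S"
    using wmp S by (auto simp: weak_maximizing_property_def)
  then show "attains_norm W W T"
    using isometric_iso_attains_norm[where S=S and T=T and Y=V and Z=W, OF J ST] by simp
qed

lemma bounded_operator_bound:
  assumes "bounded_operator V W T" "normed_space V" "normed_space W"
  shows "\<exists>K\<ge>0. \<forall>x\<in>vcarrier V. vnorm W (T x) \<le> K * vnorm V x"
proof -
  interpret V: normed_space V by fact
  obtain K where K: "\<And>x. x \<in> vcarrier V \<Longrightarrow> vnorm W (T x) \<le> K * vnorm V x"
    using assms(1) unfolding bounded_operator_def by blast
  have "vnorm W (T x) \<le> \<bar>K\<bar> * vnorm V x" if "x \<in> vcarrier V" for x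
    using K[OF that] mult_right_mono[OF abs_ge_self[of K] V.norm_nonneg[OF that]] by linarith
  then show ?thesis by (intro exI[of _ "\<bar>K\<bar>"]) auto
qed

lemma bounded_operator_zero:
  assumes "bounded_operator V W T" "normed_space V" "normed_space W"
  shows "T (vzero V) = vzero W"
proof -
  interpret V: normed_space V by fact
  interpret W: normed_space W by fact
  have z: "vzero V \<in> vcarrier V" "T (vzero V) \<in> vcarrier W"
    using assms(1) V.zero_closed by (auto simp: bounded_operator_def)
  have "vscale V 0 (vzero V) = vzero V"
    using V.norm_scale[OF z(1), of 0] V.norm_eq_zero[OF V.scale_closed[OF z(1)]] by simp
  then have "vscale W 0 (T (vzero V)) = T (vzero V)"
    using assms(1) z(1) unfolding bounded_operator_def by metis
  then show ?thesis
    using W.norm_scale[OF z(2), of 0] W.norm_eq_zero[OF z(2)] by simp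
qed

lemma op_norm_le:
  assumes V: "normed_space V" and K: "0 \<le> K"
    and le: "\<And>x. x \<in> vcarrier V \<Longrightarrow> vnorm W (T x) \<le> K * vnorm V x"
  shows "op_norm V W T \<le> K"
proof -
  interpret V: normed_space V by fact
  have "vzero V \<in> {x \<in> vcarrier V. vnorm V x \<le> 1}"
    using V.zero_closed V.norm_eq_zero[OF V.zero_closed] by simp
  moreover have "vnorm W (T x) \<le> K" if "x \<in> {x \<in> vcarrier V. vnorm V x \<le> 1}" for x
    using that le[of x] mult_left_mono[of "vnorm V x" 1 K] K by auto
  ultimately show ?thesis
    unfolding op_norm_def by (intro cSUP_least) auto
qed

lemma le_op_norm:
  assumes T: "bounded_operator V W T" and V: "normed_space V" and W: "normed_space W"
    and x: "x \<in> vcarrier V" "vnorm V x \<le> 1"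
  shows "vnorm W (T x) \<le> op_norm V W T"
proof -
  obtain K where K: "0 \<le> K" "\<And>x. x \<in> vcarrier V \<Longrightarrow> vnorm W (T x) \<le> K * vnorm V x"
    using bounded_operator_bound[OF assms(1-3)] by blast
  have "bdd_above ((\<lambda>x. vnorm W (T x)) ` {x \<in> vcarrier V. vnorm V x \<le> 1})"
  proof (rule bdd_aboveI2)
    fix y assume "y \<in> {x \<in> vcarrier V. vnorm V x \<le> 1}"
    then show "vnorm W (T y) \<le> K"
      using K(2)[of y] mult_left_mono[of "vnorm V y" 1 K] K(1) by auto
  qed
  then show ?thesis
    unfolding op_norm_def using x by (intro cSUP_upper) auto
qed

lemma op_norm_nonneg:
  assumes T: "bounded_operator V W T" and V: "normed_space V" and W: "normed_space W"
  shows "0 \<le> op_norm V W T"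
proof -
  interpret V: normed_space V by fact
  interpret W: normed_space W by fact
  have "vnorm W (T (vzero V)) \<le> op_norm V W T"
    using le_op_norm[OF assms V.zero_closed] V.norm_eq_zero[OF V.zero_closed] by simp
  then show ?thesis
    using bounded_operator_zero[OF assms] W.norm_eq_zero[OF W.zero_closed] by simp
qed

lemma banach_mazur_distance_le:
  assumes V: "normed_space V" and W: "normed_space W"
    and bij: "bij_betw U (vcarrier V) (vcarrier W)"
    and add: "\<And>x y. x \<in> vcarrier V \<Longrightarrow> y \<in> vcarrier V \<Longrightarrow> U (vadd V x y) = vadd W (U x) (U y)"
    and scale: "\<And>a x. x \<in> vcarrier V \<Longrightarrow> U (vscale V a x) = vscale W a (U x)"
    and upper: "\<And>x. x \<in> vcarrier V \<Longrightarrow> vnorm W (U x) \<le> a * vnorm V x"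
    and lower: "\<And>x. x \<in> vcarrier V \<Longrightarrow> vnorm V x \<le> b * vnorm W (U x)"
    and ab: "0 \<le> a" "0 \<le> b"
  shows "banach_mazur_distance V W \<le> ereal (a * b)"
proof -
  interpret V: normed_space V by fact
  interpret W: normed_space W by fact
  let ?K = "inv_into (vcarrier V) U"
  have K: "?K y \<in> vcarrier V" "U (?K y) = y" if "y \<in> vcarrier W" for y
    using that bij by (auto simp: bij_betw_def intro: inv_into_into f_inv_into_f)
  have KU: "?K (U x) = x" if "x \<in> vcarrier V" for x
    using that bij by (simp add: bij_betw_def)
  have mem: "U x \<in> vcarrier W" if "x \<in> vcarrier V" for x
    using that bij by (auto simp: bij_betw_def)
  have bU: "bounded_operator V W U"
    unfolding bounded_operator_def using mem add scale upper by (auto intro!: exI[of _ a])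
  have Kadd: "?K (vadd W x y) = vadd V (?K x) (?K y)" if "x \<in> vcarrier W" "y \<in> vcarrier W" for x y
    using KU[OF V.add_closed[OF K(1) K(1)], OF that] add[OF K(1) K(1), OF that] K(2) that by simp
  have Kscale: "?K (vscale W l x) = vscale V l (?K x)" if "x \<in> vcarrier W" for x l
    using KU[OF V.scale_closed[OF K(1)], OF that] scale[OF K(1), OF that] K(2) that by simp
  have Kb: "vnorm V (?K y) \<le> b * vnorm W y" if "y \<in> vcarrier W" for y
    using lower[OF K(1)[OF that]] K(2)[OF that] by simp
  have bK: "bounded_operator W V ?K"
    unfolding bounded_operator_def using K Kadd Kscale Kb by blast
  have "op_norm V W U * op_norm W V ?K \<le> a * b"
    by (intro mult_mono op_norm_le[OF V] op_norm_le[OF W] op_norm_nonneg[OF bK W V] upper Kb ab)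
  moreover have "U \<in> isomorphisms V W"
    using bU bK bij by (simp add: isomorphisms_def)
  ultimately show ?thesis
    unfolding banach_mazur_distance_def by (intro INF_lower2[of U]) auto
qed

text \<open>
  The second adjoint intertwines the two canonical embeddings, and it is onto.
\<close>
theorem isometric_iso_reflexive:
  assumes V: "normed_space V" and J: "isometric_iso V W J" and dW: "normed_space (dual W)"
    and refl: "reflexive_space V"
  shows "reflexive_space W"
proof -
  note J' = isometric_isoD[OF J]
  let ?A = "\<lambda>g. \<lambda>x\<in>vcarrier V. g (J x)"
  let ?B = "\<lambda>F. \<lambda>g\<in>vcarrier (dual W). F (?A g)"
  have A: "isometric_iso (dual W) (dual V) ?A"
    by (rule isometric_iso_dual[OF V J])
  have B: "isometric_iso (dual (dual V)) (dual (dual W)) ?B"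
    by (rule isometric_iso_dual[OF dW A])
  have BJ: "?B (canonical_embedding V x) = canonical_embedding W (J x)" if "x \<in> vcarrier V" for x
    using that isometric_isoD(5)[OF A]
    by (auto simp: canonical_embedding_def fun_eq_iff)
  have "canonical_embedding W ` vcarrier W = (\<lambda>x. canonical_embedding W (J x)) ` vcarrier V"
    using J'(3) by (metis image_image)
  also have "\<dots> = (\<lambda>x. ?B (canonical_embedding V x)) ` vcarrier V"
    using BJ by (intro image_cong) auto
  also have "\<dots> = ?B ` (canonical_embedding V ` vcarrier V)"
    by (simp only: image_image)
  also have "\<dots> = vcarrier (dual (dual W))"
    using refl isometric_isoD(3)[OF B] by (simp only: reflexive_space_def)
  finally show ?thesis by (simp only: reflexive_space_def)
qed

section \<open>The Hilbert space of square summable sequences\<close>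

text \<open>
  A type of square summable sequences, used as a common model: \<open>X\<^sub>c\<close> and its dual both become this
  vector space with a different norm.  Having it as a type makes the inner product, continuity
  and bounded linear maps of the type classes available.
\<close>
lemma summable_mult_of_squares:
  fixes x y :: "nat \<Rightarrow> real"
  assumes "summable (\<lambda>j. (x j)\<^sup>2)" "summable (\<lambda>j. (y j)\<^sup>2)"
  shows "summable (\<lambda>j. x j * y j)"
proof (rule summable_comparison_test')
  show "summable (\<lambda>j. (x j)\<^sup>2 + (y j)\<^sup>2)"
    using assms by (rule summable_add)
  fix n
  have "2 * (\<bar>x n\<bar> * \<bar>y n\<bar>) \<le> (x n)\<^sup>2 + (y n)\<^sup>2"
    using sum_squares_bound[of "\<bar>x n\<bar>" "\<bar>y n\<bar>"] by (simp add: mult.assoc)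
  moreover have "0 \<le> \<bar>x n\<bar> * \<bar>y n\<bar>" by simp
  ultimately show "norm (x n * y n) \<le> (x n)\<^sup>2 + (y n)\<^sup>2"
    unfolding real_norm_def abs_mult by linarith
qed

typedef ltwo = "{x :: nat \<Rightarrow> real. summable (\<lambda>j. (x j)\<^sup>2)}"
  morphisms coord Abs_ltwo
  by (rule exI[of _ "\<lambda>_. 0"]) simp

setup_lifting type_definition_ltwo

lemma ltwo_eqI: "(\<And>j. coord x j = coord y j) \<Longrightarrow> x = y"
  by (simp add: coord_inject[symmetric] fun_eq_iff)

lemma summable_coord_square [simp]: "summable (\<lambda>j. (coord x j)\<^sup>2)"
  using coord[of x] by simp

lemma summable_coord_mult [simp]: "summable (\<lambda>j. coord x j * coord y j)"
  by (rule summable_mult_of_squares) simp_all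

instantiation ltwo :: real_vector
begin

lift_definition zero_ltwo :: ltwo is "\<lambda>_. 0" by simp

lift_definition plus_ltwo :: "ltwo \<Rightarrow> ltwo \<Rightarrow> ltwo" is "\<lambda>x y j. x j + y j"
  by (simp add: power2_sum mult.assoc summable_add summable_mult summable_mult_of_squares)

lift_definition uminus_ltwo :: "ltwo \<Rightarrow> ltwo" is "\<lambda>x j. - x j" by simp

lift_definition scaleR_ltwo :: "real \<Rightarrow> ltwo \<Rightarrow> ltwo" is "\<lambda>a x j. a * x j"
  by (simp add: power_mult_distrib summable_mult)

definition minus_ltwo :: "ltwo \<Rightarrow> ltwo \<Rightarrow> ltwo" where "minus_ltwo x y = x + - y"

instance
proof
  fix x y z :: ltwo and a b :: real
  show "x + y + z = x + (y + z)" "x + y = y + x" "0 + x = x" "- x + x = 0"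
    "a *\<^sub>R (x + y) = a *\<^sub>R x + a *\<^sub>R y" "(a + b) *\<^sub>R x = a *\<^sub>R x + b *\<^sub>R x"
    "a *\<^sub>R b *\<^sub>R x = (a * b) *\<^sub>R x" "1 *\<^sub>R x = x"
    by (transfer; simp add: algebra_simps)+
qed (simp add: minus_ltwo_def)

end

instantiation ltwo :: real_inner
begin

definition inner_ltwo :: "ltwo \<Rightarrow> ltwo \<Rightarrow> real" where
  "inner_ltwo x y = (\<Sum>j. coord x j * coord y j)"

definition norm_ltwo :: "ltwo \<Rightarrow> real" where "norm_ltwo x = sqrt (inner x x)"
definition dist_ltwo :: "ltwo \<Rightarrow> ltwo \<Rightarrow> real" where "dist_ltwo x y = norm (x - y)"
definition sgn_ltwo :: "ltwo \<Rightarrow> ltwo" where "sgn_ltwo x = x /\<^sub>R norm x"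
definition uniformity_ltwo :: "(ltwo \<times> ltwo) filter" where
  "uniformity_ltwo = (INF e\<in>{0<..}. principal {(x, y). dist x y < e})"
definition open_ltwo :: "ltwo set \<Rightarrow> bool" where
  "open_ltwo U \<longleftrightarrow> (\<forall>x\<in>U. \<forall>\<^sub>F (x', y) in uniformity. x' = x \<longrightarrow> y \<in> U)"

instance
proof
  fix x y z :: ltwo and a :: real
  show "inner x y = inner y x"
    by (simp add: inner_ltwo_def mult.commute)
  show "inner (x + y) z = inner x z + inner y z"
    by (simp add: inner_ltwo_def plus_ltwo.rep_eq distrib_right suminf_add)
  show "inner (a *\<^sub>R x) y = a * inner x y"
    by (simp add: inner_ltwo_def scaleR_ltwo.rep_eq mult.assoc suminf_mult)
  show "0 \<le> inner x x"
    by (simp add: inner_ltwo_def suminf_nonneg)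
  have "(inner x x = 0) \<longleftrightarrow> (\<forall>j. coord x j = 0)"
    by (simp add: inner_ltwo_def suminf_eq_zero_iff)
  also have "\<dots> \<longleftrightarrow> x = 0"
  proof
    assume "\<forall>j. coord x j = 0"
    then show "x = 0" by (intro ltwo_eqI) (simp add: zero_ltwo.rep_eq)
  qed (simp add: zero_ltwo.rep_eq)
  finally show "(inner x x = 0) \<longleftrightarrow> (x = 0)" .
  show "norm x = sqrt (inner x x)" by (rule norm_ltwo_def)
  show "dist x y = norm (x - y)" by (rule dist_ltwo_def)
  show "sgn x = x /\<^sub>R norm x" by (rule sgn_ltwo_def)
  show "(uniformity :: (ltwo \<times> ltwo) filter) = (INF e\<in>{0<..}. principal {(x, y). dist x y < e})"
    by (rule uniformity_ltwo_def)
  show "open U \<longleftrightarrow> (\<forall>x\<in>U. \<forall>\<^sub>F (x', y) in uniformity. x' = x \<longrightarrow> y \<in> U)" for U :: "ltwo set"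
    by (rule open_ltwo_def)
qed

end

lemma coord_simps [simp]:
  "coord 0 j = 0" "coord (x + y) j = coord x j + coord y j" "coord (- x) j = - coord x j"
  "coord (x - y) j = coord x j - coord y j" "coord (a *\<^sub>R x) j = a * coord x j"
  by (simp_all only: minus_ltwo_def zero_ltwo.rep_eq plus_ltwo.rep_eq uminus_ltwo.rep_eq
      scaleR_ltwo.rep_eq diff_conv_add_uminus)

lemma norm_ltwo_eq: "norm x = sqrt (\<Sum>j. (coord x j)\<^sup>2)"
  by (simp add: norm_ltwo_def inner_ltwo_def power2_eq_square)

lemma norm_ltwo_power2: "(norm x)\<^sup>2 = (\<Sum>j. (coord x j)\<^sup>2)"
  by (simp add: norm_ltwo_eq suminf_nonneg)

lemma sum_coord_square_le: "(\<Sum>j\<le>n. (coord x j)\<^sup>2) \<le> (norm x)\<^sup>2"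
  by (simp add: norm_ltwo_power2 sum_le_suminf)

lemma abs_coord_le_norm: "\<bar>coord x j\<bar> \<le> norm x"
proof -
  have "(coord x j)\<^sup>2 \<le> (\<Sum>i\<le>j. (coord x i)\<^sup>2)"
    by (rule member_le_sum) auto
  then have "(coord x j)\<^sup>2 \<le> (norm x)\<^sup>2"
    using sum_coord_square_le[of x j] by linarith
  then show ?thesis
    by (simp add: abs_le_square_iff[symmetric])
qed

lemma square_summable_of_bounded_sums:
  assumes "\<And>n. (\<Sum>j\<le>n. (f j)\<^sup>2) \<le> (B::real)"
  shows "summable (\<lambda>j. (f j)\<^sup>2)"
proof (rule bounded_imp_summable)
  show "(\<Sum>k\<le>n. (f k)\<^sup>2) \<le> B" for n by (rule assms)
qed simp

lemma norm_ltwo_le: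
  assumes "\<And>n. (\<Sum>j\<le>n. (coord x j)\<^sup>2) \<le> B\<^sup>2" "0 \<le> B"
  shows "norm x \<le> B"
proof -
  have "(\<Sum>j<n. (coord x j)\<^sup>2) \<le> B\<^sup>2" for n
    by (rule order_trans[OF sum_mono2 assms(1)[of n]]) auto
  then have "(\<Sum>j. (coord x j)\<^sup>2) \<le> B\<^sup>2"
    by (intro suminf_le_const) auto
  then show ?thesis
    using assms(2) by (simp add: norm_ltwo_eq real_le_lsqrt suminf_nonneg)
qed

text \<open>
  The Fatou property of the norm.  It yields the completeness of the space and shows that the
  coordinatewise cluster points of bounded sequences stay in the space.
\<close>
lemma coordinatewise_limit:
  assumes lim: "\<And>j. (\<lambda>n. coord (x n) j) \<longlonglongrightarrow> l j" and bdd: "\<And>n. norm (x n) \<le> B"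
  obtains y where "coord y = l" "norm y \<le> B"
proof -
  have B: "0 \<le> B" using norm_ge_zero order_trans bdd by blast
  have sq: "(\<Sum>j\<le>m. (l j)\<^sup>2) \<le> B\<^sup>2" for m
  proof (rule LIMSEQ_le_const2)
    show "(\<lambda>n. \<Sum>j\<le>m. (coord (x n) j)\<^sup>2) \<longlonglongrightarrow> (\<Sum>j\<le>m. (l j)\<^sup>2)"
      by (intro tendsto_sum tendsto_power lim)
    have "(\<Sum>j\<le>m. (coord (x n) j)\<^sup>2) \<le> B\<^sup>2" for n
      by (rule order_trans[OF sum_coord_square_le power_mono[OF bdd norm_ge_zero]])
    then show "\<exists>N. \<forall>n\<ge>N. (\<Sum>j\<le>m. (coord (x n) j)\<^sup>2) \<le> B\<^sup>2"
      by blast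
  qed
  have "coord (Abs_ltwo l) = l"
    using square_summable_of_bounded_sums[OF sq] by (simp add: Abs_ltwo_inverse)
  then show ?thesis
    using that[of "Abs_ltwo l"] norm_ltwo_le[of "Abs_ltwo l" B] sq B by simp
qed

instance ltwo :: complete_space
proof
  fix x :: "nat \<Rightarrow> ltwo"
  assume C: "Cauchy x"
  have "convergent (\<lambda>n. coord (x n) j)" for j
  proof (rule Cauchy_convergent, rule metric_CauchyI)
    fix e :: real assume "0 < e"
    then obtain N where "\<forall>m\<ge>N. \<forall>n\<ge>N. dist (x m) (x n) < e"
      using C metric_CauchyD by blast
    moreover have "dist (coord (x m) j) (coord (x n) j) \<le> dist (x m) (x n)" for m n
      using abs_coord_le_norm[of "x m - x n" j] by (simp add: dist_norm)
    ultimately show "\<exists>M. \<forall>m\<ge>M. \<forall>n\<ge>M. dist (coord (x m) j) (coord (x n) j) < e"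
      using le_less_trans by meson
  qed
  then obtain l where l: "\<And>j. (\<lambda>n. coord (x n) j) \<longlonglongrightarrow> l j"
    unfolding convergent_def by metis
  obtain B where B: "\<And>n. norm (x n) \<le> B"
    using cauchy_imp_bounded[OF C] by (auto simp: bounded_iff)
  obtain y where y: "coord y = l"
    by (rule coordinatewise_limit[OF l B])
  have "x \<longlonglongrightarrow> y"
  proof (rule metric_LIMSEQ_I)
    fix e :: real assume e: "0 < e"
    then obtain N where N: "\<And>m n. m \<ge> N \<Longrightarrow> n \<ge> N \<Longrightarrow> dist (x m) (x n) < e / 2"
      using C metric_CauchyD[of x "e / 2"] by auto
    have "dist (x n) y < e" if n: "n \<ge> N" for n
    proof -
      have lim: "(\<lambda>k. coord (x n - x (k + N)) j) \<longlonglongrightarrow> coord (x n) j - l j" for j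
        unfolding coord_simps by (intro tendsto_intros LIMSEQ_ignore_initial_segment l)
      have bdd: "norm (x n - x (k + N)) \<le> e / 2" for k
        using N[OF n, of "k + N"] by (simp add: dist_norm)
      obtain z where z: "coord z = (\<lambda>j. coord (x n) j - l j)" "norm z \<le> e / 2"
        by (rule coordinatewise_limit[OF lim bdd])
      have "z = x n - y"
        by (rule ltwo_eqI) (simp add: z y)
      then show ?thesis
        using z(2) e by (simp add: dist_norm)
    qed
    then show "\<exists>N. \<forall>n\<ge>N. dist (x n) y < e" by blast
  qed
  then show "convergent x" by (auto simp: convergent_def)
qed

lift_definition head :: "nat \<Rightarrow> ltwo \<Rightarrow> ltwo" is "\<lambda>m x j. if j \<le> m then x j else 0"
proof -
  fix m :: nat and x :: "nat \<Rightarrow> real"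
  assume "summable (\<lambda>j. (x j)\<^sup>2)"
  then show "summable (\<lambda>j. (if j \<le> m then x j else 0)\<^sup>2)"
    by (rule summable_comparison_test') auto
qed

definition tail :: "nat \<Rightarrow> ltwo \<Rightarrow> ltwo" where "tail m x = x - head m x"

lemma coord_head [simp]: "coord (head m x) j = (if j \<le> m then coord x j else 0)"
  by (simp add: head.rep_eq)

lemma coord_tail [simp]: "coord (tail m x) j = (if j \<le> m then 0 else coord x j)"
  by (simp add: tail_def)

lemma head_plus_tail: "head m x + tail m x = x"
  by (simp add: tail_def)

lemma tail_tail [simp]: "tail m (tail m x) = tail m x"
  and head_head [simp]: "head m (head m x) = head m x"
  and head_scaleR: "head m (a *\<^sub>R x) = a *\<^sub>R head m x"
  and tail_scaleR: "tail m (a *\<^sub>R x) = a *\<^sub>R tail m x"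
  by (rule ltwo_eqI; simp)+

lemma inner_ltwo_finite:
  assumes "\<And>j. j > m \<Longrightarrow> coord x j * coord y j = 0"
  shows "inner x y = (\<Sum>j\<le>m. coord x j * coord y j)"
  unfolding inner_ltwo_def by (rule suminf_finite) (auto simp: assms not_le)

lemma inner_head: "inner (head m x) y = (\<Sum>j\<le>m. coord x j * coord y j)"
  by (subst inner_ltwo_finite[of m]) auto

lemma inner_head_tail [simp]: "inner (head m x) (tail m y) = 0" "inner (tail m y) (head m x) = 0"
  by (simp_all add: inner_head inner_commute[of "tail m y"])

lemma inner_head_swap: "inner (head m x) y = inner x (head m y)"
  by (simp add: inner_head inner_commute[of x] mult.commute)

lemma inner_tail_swap: "inner (tail m x) y = inner x (tail m y)"
  by (simp add: tail_def inner_diff_left inner_diff_right inner_head_swap)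

lemma norm_mono_coord:
  assumes "\<And>j. \<bar>coord x j\<bar> \<le> \<bar>coord y j\<bar>"
  shows "norm x \<le> norm y"
  unfolding norm_ltwo_eq by (rule real_sqrt_le_mono, rule suminf_le) (auto simp: assms abs_le_square_iff[symmetric])

lemma tail_tendsto_zero: "(\<lambda>m. tail m x) \<longlonglongrightarrow> 0"
proof -
  have eq: "(norm (tail m x))\<^sup>2 = (norm x)\<^sup>2 - (\<Sum>j\<le>m. (coord x j)\<^sup>2)" for m
  proof -
    have "(norm (tail m x))\<^sup>2 = inner (tail m x) x"
      by (simp add: power2_norm_eq_inner inner_tail_swap[of m x "tail m x"] inner_commute)
    also have "\<dots> = (norm x)\<^sup>2 - (\<Sum>j\<le>m. (coord x j)\<^sup>2)"
      by (simp add: tail_def inner_diff_left inner_head flip: power2_norm_eq_inner power2_eq_square)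
    finally show ?thesis .
  qed
  have "(\<lambda>m. \<Sum>j\<le>m. (coord x j)\<^sup>2) \<longlonglongrightarrow> (norm x)\<^sup>2"
    unfolding norm_ltwo_power2 by (rule summable_LIMSEQ') simp
  then have "(\<lambda>m. (norm (tail m x))\<^sup>2) \<longlonglongrightarrow> (norm x)\<^sup>2 - (norm x)\<^sup>2"
    unfolding eq by (intro tendsto_intros)
  then have "(\<lambda>m. sqrt ((norm (tail m x))\<^sup>2)) \<longlonglongrightarrow> sqrt 0"
    by (intro tendsto_real_sqrt) simp
  then show ?thesis
    by (simp add: tendsto_norm_zero_iff)
qed

lemma head_tendsto: "(\<lambda>m. head m x) \<longlonglongrightarrow> x"
proof -
  have "(\<lambda>m. x - tail m x) \<longlonglongrightarrow> x - 0"
    by (intro tendsto_intros tail_tendsto_zero)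
  then show ?thesis by (simp add: tail_def)
qed

lift_definition unit_vector :: "nat \<Rightarrow> ltwo" is "\<lambda>n j. if j = n then 1 else 0"
proof -
  fix n :: nat
  show "summable (\<lambda>j. (if j = n then 1 else 0 :: real)\<^sup>2)"
    by (rule summable_finite[of "{n}"]) auto
qed

lemma coord_unit_vector [simp]: "coord (unit_vector n) j = (if j = n then 1 else 0)"
  by (simp add: unit_vector.rep_eq)

lemma coord_sum [simp]: "coord (sum f A) j = (\<Sum>i\<in>A. coord (f i) j)"
  by (induction A rule: infinite_finite_induct) auto

lemma coord_sum_unit_vectors:
  "coord (\<Sum>i\<le>m. f i *\<^sub>R unit_vector i) j = (if j \<le> m then f j else 0)"
proof -
  have "coord (\<Sum>i\<le>m. f i *\<^sub>R unit_vector i) j = (\<Sum>i\<le>m. if i = j then f i else 0)"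
    unfolding coord_sum coord_simps coord_unit_vector by (rule sum.cong) auto
  then show ?thesis by simp
qed

lemma head_eq_sum: "head m x = (\<Sum>j\<le>m. coord x j *\<^sub>R unit_vector j)"
  by (rule ltwo_eqI) (simp only: coord_sum_unit_vectors coord_head)

lemma inner_unit_vector [simp]: "inner x (unit_vector n) = coord x n"
proof -
  have "inner x (unit_vector n) = (\<Sum>j\<le>n. coord x j * coord (unit_vector n) j)"
    by (rule inner_ltwo_finite) simp
  also have "\<dots> = (\<Sum>j\<le>n. if j = n then coord x j else 0)"
    by (rule sum.cong) auto
  finally show ?thesis by simp
qed

text \<open>
  The representing vector has the coordinates \<open>f (unit_vector j)\<close>.  Evaluating \<open>f\<close> at the
  truncations of that vector bounds their norms by the norm of \<open>f\<close>, so it is square summable.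
\<close>
theorem riesz_ltwo:
  assumes "bounded_linear f"
  shows "\<exists>y::ltwo. f = (\<lambda>x. inner x y)"
proof -
  interpret f: bounded_linear f by fact
  obtain K where K: "\<And>x. norm (f x) \<le> norm x * K" "K \<ge> 0"
    using f.nonneg_bounded by blast
  let ?g = "\<lambda>j. f (unit_vector j)"
  have fhead: "f (head m x) = (\<Sum>j\<le>m. coord x j * ?g j)" for m x
    by (simp add: head_eq_sum f.sum f.scaleR)
  have bound: "(\<Sum>j\<le>m. (?g j)\<^sup>2) \<le> K\<^sup>2" for m
  proof -
    let ?s = "\<Sum>j\<le>m. ?g j *\<^sub>R unit_vector j"
    have c: "coord ?s j = (if j \<le> m then ?g j else 0)" for j
      by (rule coord_sum_unit_vectors)
    have s: "head m ?s = ?s"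
      by (rule ltwo_eqI) (simp only: c coord_head split: if_split, simp)
    let ?S = "\<Sum>j\<le>m. (?g j)\<^sup>2"
    have "f ?s = ?S"
      using fhead[of m ?s] unfolding s c by (simp add: power2_eq_square)
    moreover have "(norm ?s)\<^sup>2 = ?S"
      unfolding power2_norm_eq_inner by (subst (1) s[symmetric]) (simp only: inner_head c, simp add: power2_eq_square)
    moreover have "f ?s \<le> norm ?s * K" using K(1)[of ?s] by simp
    ultimately have *: "(norm ?s)\<^sup>2 \<le> norm ?s * K" by simp
    have "norm ?s \<le> K"
    proof (cases "norm ?s = 0")
      case False
      then show ?thesis using * by (simp add: power2_eq_square)
    qed (use K(2) in simp)
    then show ?thesis
      using \<open>(norm ?s)\<^sup>2 = ?S\<close> power_mono[of "norm ?s" K 2] by simp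
  qed
  have cy: "coord (Abs_ltwo ?g) = ?g"
    using square_summable_of_bounded_sums[OF bound] by (simp add: Abs_ltwo_inverse)
  have "f x = inner x (Abs_ltwo ?g)" for x
  proof -
    have 1: "(\<lambda>m. f (head m x)) \<longlonglongrightarrow> f x"
      by (intro f.tendsto head_tendsto)
    have "(\<lambda>m. inner (head m x) (Abs_ltwo ?g)) \<longlonglongrightarrow> inner x (Abs_ltwo ?g)"
      by (intro tendsto_intros head_tendsto)
    then have 2: "(\<lambda>m. f (head m x)) \<longlonglongrightarrow> inner x (Abs_ltwo ?g)"
      by (simp add: fhead inner_head cy)
    show ?thesis
      using LIMSEQ_unique[OF 1 2] .
  qed
  then show ?thesis by blast
qed

lemma coordinatewise_null_head:
  assumes "\<And>j. (\<lambda>n. coord (w n) j) \<longlonglongrightarrow> 0"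
  shows "(\<lambda>n. head m (w n)) \<longlonglongrightarrow> 0"
proof -
  have "(\<lambda>n. \<Sum>j\<le>m. coord (w n) j *\<^sub>R unit_vector j) \<longlonglongrightarrow> (\<Sum>j\<le>m. 0 *\<^sub>R unit_vector j)"
    by (intro tendsto_intros assms)
  then show ?thesis by (simp add: head_eq_sum)
qed

text \<open>
  For bounded sequences coordinatewise convergence to 0 is weak convergence: the head of \<open>z\<close> sees only
  finitely many coordinates, and its tail is small in norm.
\<close>
lemma coordinatewise_null_inner:
  assumes w: "\<And>j. (\<lambda>n. coord (w n) j) \<longlonglongrightarrow> 0" and bdd: "\<And>n. norm (w n) \<le> B"
  shows "(\<lambda>n. inner (w n) z) \<longlonglongrightarrow> 0"
proof (rule LIMSEQ_I)
  fix e :: real assume e: "0 < e"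
  have B: "0 \<le> B" using norm_ge_zero order_trans bdd by blast
  have "(\<lambda>m. B * norm (tail m z)) \<longlonglongrightarrow> B * norm (0::ltwo)"
    by (intro tendsto_intros tail_tendsto_zero)
  then obtain m where m: "B * norm (tail m z) < e / 2"
    using e order_tendstoD(2)[of _ "B * norm (0::ltwo)" sequentially "e/2"]
    by (auto simp: eventually_sequentially)
  have "(\<lambda>n. inner (head m (w n)) z) \<longlonglongrightarrow> inner 0 z"
    by (intro tendsto_intros coordinatewise_null_head w)
  then obtain N where N: "\<And>n. n \<ge> N \<Longrightarrow> \<bar>inner (head m (w n)) z\<bar> < e / 2"
    using e LIMSEQ_D[of "\<lambda>n. inner (head m (w n)) z" 0 "e/2"] by auto
  have "\<bar>inner (w n) z\<bar> < e" if "n \<ge> N" for n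
  proof -
    have "inner (w n) z = inner (head m (w n)) z + inner (w n) (tail m z)"
      by (metis head_plus_tail inner_add_left inner_tail_swap)
    moreover have "\<bar>inner (w n) (tail m z)\<bar> \<le> B * norm (tail m z)"
      using Cauchy_Schwarz_ineq2[of "w n" "tail m z"] mult_right_mono[OF bdd[of n] norm_ge_zero]
      by (rule order_trans)
    ultimately show ?thesis using m N[OF that] by linarith
  qed
  then show "\<exists>N. \<forall>n\<ge>N. norm (inner (w n) z - 0) < e" by auto
qed

text \<open>
  Sequential weak compactness of balls, from the compactness of a countable product of intervals.
\<close>
theorem bounded_coordinatewise_convergent_subseq:
  fixes x :: "nat \<Rightarrow> ltwo"
  assumes bdd: "\<And>n. norm (x n) \<le> B"
  obtains y and s :: "nat \<Rightarrow> nat"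
  where "strict_mono s" "\<And>j. (\<lambda>n. coord (x (s n)) j) \<longlonglongrightarrow> coord y j"
proof -
  let ?S = "Pi\<^sub>E (UNIV :: nat set) (\<lambda>_. {- B..B})"
  have "compactin (product_topology (\<lambda>_. euclidean) UNIV) ?S"
    by (subst compactin_PiE) auto
  then have "compact ?S"
    by (simp add: euclidean_product_topology)
  then have sc: "seq_compact ?S"
    by (rule compact_imp_seq_compact)
  have "coord (x n) \<in> ?S" for n
    using order_trans[OF abs_coord_le_norm bdd] by (auto simp: abs_le_iff minus_le_iff)
  then obtain l s where s: "strict_mono s" and l: "((\<lambda>n. coord (x n)) \<circ> s) \<longlonglongrightarrow> l"
    using sc unfolding seq_compact_def by metis
  have lim: "(\<lambda>n. coord (x (s n)) j) \<longlonglongrightarrow> l j" for j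
    using continuous_on_tendsto_compose[OF continuous_on_product_coordinates l, of j]
    by (simp add: o_def)
  obtain y where y: "coord y = l"
    by (rule coordinatewise_limit[OF lim bdd])
  have "(\<lambda>n. coord (x (s n)) j) \<longlonglongrightarrow> coord y j" for j
    unfolding y by (rule lim)
  then show ?thesis
    by (rule that[OF s])
qed

section \<open>Equivalent norms and their duals\<close>
lemma restrict_UNIV_eq [simp]: "restrict f UNIV = f"
  by (simp add: fun_eq_iff)

definition renormed :: "('a::real_normed_vector \<Rightarrow> real) \<Rightarrow> 'a nspace" where
  "renormed r = \<lparr>vcarrier = UNIV, vzero = 0, vadd = (+), vscale = scaleR, vnorm = r\<rparr>"

lemma renormed_simps [simp]:
  "vcarrier (renormed r) = UNIV" "vzero (renormed r) = 0" "vadd (renormed r) = (+)"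
  "vscale (renormed r) = scaleR" "vnorm (renormed r) = r"
  by (simp_all add: renormed_def)

locale equivalent_norm =
  fixes r :: "ltwo \<Rightarrow> real" and A B :: real
  assumes A_pos: "0 < A" and B_pos: "0 < B"
    and lower: "A * norm x \<le> r x" and upper: "r x \<le> B * norm x"
    and triangle: "r (x + y) \<le> r x + r y"
    and scale: "r (a *\<^sub>R x) = \<bar>a\<bar> * r x"
begin

lemma nonneg: "0 \<le> r x"
  using lower[of x] A_pos by (meson mult_nonneg_nonneg norm_ge_zero less_imp_le order_trans)

lemma zero [simp]: "r 0 = 0"
  using scale[of 0 0] by simp

lemma eq_zero_iff [simp]: "r x = 0 \<longleftrightarrow> x = 0"
proof
  assume "r x = 0"
  then have "A * norm x \<le> 0" using lower[of x] by simp
  then show "x = 0" using A_pos by (simp add: mult_le_0_iff)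
qed simp

lemma minus: "r (- x) = r x"
  using scale[of "- 1" x] by simp

lemma minus_commute: "r (x - y) = r (y - x)"
  using minus[of "x - y"] by simp

lemma reverse_triangle: "\<bar>r x - r y\<bar> \<le> r (x - y)"
  using triangle[of "x - y" y] triangle[of "y - x" x] minus_commute[of x y] by simp

lemma norm_le: "norm x \<le> r x / A"
  using lower[of x] A_pos by (simp add: field_simps)

lemma tendsto:
  assumes "(f \<longlongrightarrow> l) F"
  shows "((\<lambda>x. r (f x)) \<longlongrightarrow> r l) F"
proof (rule Lim_transform_bound[of "\<lambda>x. r (f x) - r l" "\<lambda>x. B * norm (f x - l)" F, THEN LIM_zero_cancel])
  show "\<forall>\<^sub>F x in F. norm (r (f x) - r l) \<le> norm (B * norm (f x - l))"
    using reverse_triangle upper B_pos by (intro always_eventually) (auto simp: abs_mult intro: order_trans)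
  have "((\<lambda>x. B * norm (f x - l)) \<longlongrightarrow> B * norm (l - l)) F"
    by (intro tendsto_intros assms)
  then show "((\<lambda>x. B * norm (f x - l)) \<longlongrightarrow> 0) F" by simp
qed

lemma normed_space: "normed_space (renormed r)"
  by unfold_locales (simp_all add: algebra_simps nonneg triangle scale)

lemma vdist_renormed: "vdist (renormed r) x y = r (x - y)"
  by (simp add: vdist_def)

lemma banach_space: "banach_space (renormed r)"
proof -
  interpret N: normed_space "renormed r" by (rule normed_space)
  interpret N: Metric_space UNIV "vdist (renormed r)"
    using N.Metric_space_vdist by simp
  have "N.mcomplete"
    unfolding N.mcomplete_def
  proof (intro allI impI)
    fix \<sigma> assume C: "N.MCauchy \<sigma>"
    have "Cauchy \<sigma>"
    proof (rule metric_CauchyI)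
      fix e :: real assume e: "0 < e"
      then have "0 < A * e" using A_pos by simp
      then obtain N where N: "\<And>n m. N \<le> n \<Longrightarrow> N \<le> m \<Longrightarrow> r (\<sigma> n - \<sigma> m) < A * e"
        using C unfolding N.MCauchy_def vdist_renormed by blast
      have "dist (\<sigma> n) (\<sigma> m) < e" if "N \<le> n" "N \<le> m" for n m
      proof -
        have "A * norm (\<sigma> n - \<sigma> m) < A * e"
          using N[OF that] lower[of "\<sigma> n - \<sigma> m"] by linarith
        then show ?thesis using A_pos by (simp add: dist_norm)
      qed
      then show "\<exists>M. \<forall>m\<ge>M. \<forall>n\<ge>M. dist (\<sigma> m) (\<sigma> n) < e" by blast
    qed
    then obtain l where l: "\<sigma> \<longlonglongrightarrow> l"
      using Cauchy_convergent convergent_def by blast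
    have "(\<lambda>n. r (\<sigma> n - l)) \<longlonglongrightarrow> r (l - l)"
      by (intro tendsto tendsto_intros l)
    then have "(\<lambda>n. r (\<sigma> n - l)) \<longlonglongrightarrow> 0" by simp
    then have "\<exists>N. \<forall>n\<ge>N. r (\<sigma> n - l) < e" if "0 < e" for e
      using order_tendstoD(2)[of "\<lambda>n. r (\<sigma> n - l)" 0 sequentially e] that
      by (simp add: eventually_sequentially)
    then show "\<exists>x. limitin N.mtopology \<sigma> x sequentially"
      by (intro exI[of _ l]) (simp add: N.limit_metric_sequentially vdist_renormed)
  qed
  then show ?thesis
    by unfold_locales simp
qed

lemma bounded_functional_iff:
  "bounded_operator (renormed r) real_line f \<longleftrightarrow> bounded_linear f"
proof
  assume f: "bounded_operator (renormed r) real_line f"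
  then obtain K where K: "\<And>x. \<bar>f x\<bar> \<le> K * r x"
    by (auto simp: bounded_operator_def real_line_simps)
  show "bounded_linear f"
  proof (rule bounded_linear_intro)
    show "f (x + y) = f x + f y" "f (a *\<^sub>R x) = a *\<^sub>R f x" for x y a
      using f by (simp_all add: bounded_operator_def real_line_simps)
    fix x
    have "norm (f x) \<le> \<bar>K\<bar> * r x"
      using K[of x] mult_right_mono[OF abs_ge_self[of K] nonneg[of x]] by simp
    also have "\<dots> \<le> \<bar>K\<bar> * (B * norm x)"
      using upper by (intro mult_left_mono) auto
    finally show "norm (f x) \<le> norm x * (\<bar>K\<bar> * B)"
      by (simp add: mult_ac)
  qed
next
  assume "bounded_linear f"
  then interpret f: bounded_linear f .
  obtain K where K: "\<And>x. norm (f x) \<le> norm x * K" "0 \<le> K"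
    using f.nonneg_bounded by blast
  have "\<bar>f x\<bar> \<le> (K / A) * r x" for x
    using K(1)[of x] mult_right_mono[OF norm_le[of x] K(2)] by (simp add: field_simps)
  then show "bounded_operator (renormed r) real_line f"
    by (auto simp: bounded_operator_def real_line_simps f.add f.scaleR intro!: exI[of _ "K / A"])
qed

lemma bounded_operator_iff:
  "bounded_operator (renormed r) (renormed r) T \<longleftrightarrow> bounded_linear T"
proof
  assume T: "bounded_operator (renormed r) (renormed r) T"
  then obtain K where K: "\<And>x. r (T x) \<le> K * r x"
    by (auto simp: bounded_operator_def)
  show "bounded_linear T"
  proof (rule bounded_linear_intro)
    show "T (x + y) = T x + T y" "T (a *\<^sub>R x) = a *\<^sub>R T x" for x y a
      using T by (simp_all add: bounded_operator_def)
    fix x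
    have "A * norm (T x) \<le> \<bar>K\<bar> * r x"
      using lower[of "T x"] K[of x] mult_right_mono[OF abs_ge_self[of K] nonneg[of x]] by linarith
    also have "\<dots> \<le> \<bar>K\<bar> * (B * norm x)"
      using upper by (intro mult_left_mono) auto
    finally show "norm (T x) \<le> norm x * (\<bar>K\<bar> * B / A)"
      using A_pos by (simp add: field_simps)
  qed
next
  assume "bounded_linear T"
  then interpret T: bounded_linear T .
  obtain K where K: "\<And>x. norm (T x) \<le> norm x * K" "0 \<le> K"
    using T.nonneg_bounded by blast
  have "r (T x) \<le> (B * K / A) * r x" for x
  proof -
    have "r (T x) \<le> B * (norm x * K)"
      using upper[of "T x"] mult_left_mono[OF K(1)[of x], of B] B_pos by linarith
    also have "\<dots> \<le> B * (r x / A * K)"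
      using norm_le K(2) B_pos by (intro mult_left_mono mult_right_mono) auto
    finally show ?thesis by (simp add: field_simps)
  qed
  then show "bounded_operator (renormed r) (renormed r) T"
    by (auto simp: bounded_operator_def T.add T.scaleR intro!: exI[of _ "B * K / A"])
qed

end

text \<open>
  For an equivalent norm on a real Hilbert space this is the norm of the functional represented by \<open>y\<close>.
\<close>
definition dual_norm :: "('a::real_inner \<Rightarrow> real) \<Rightarrow> 'a \<Rightarrow> real" where
  "dual_norm r y = (SUP x\<in>{x. r x \<le> 1}. inner x y)"

context equivalent_norm
begin

lemma inner_le_of_unit:
  assumes "r x \<le> 1"
  shows "inner x y \<le> norm y / A"
proof -
  have "norm x \<le> 1 / A"
    using norm_le[of x] assms A_pos by (meson divide_right_mono less_imp_le order_trans)
  then have "norm x * norm y \<le> 1 / A * norm y"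
    by (intro mult_right_mono) auto
  then show ?thesis using norm_cauchy_schwarz[of x y] by simp
qed

lemma inner_le_dual_norm: "r x \<le> 1 \<Longrightarrow> inner x y \<le> dual_norm r y"
  unfolding dual_norm_def using inner_le_of_unit
  by (intro cSUP_upper bdd_aboveI2[where M="norm y / A"]) auto

lemma dual_norm_le: "(\<And>x. r x \<le> 1 \<Longrightarrow> inner x y \<le> K) \<Longrightarrow> dual_norm r y \<le> K"
  unfolding dual_norm_def by (rule cSUP_least) (auto intro: exI[of _ 0])

lemma dual_norm_nonneg: "0 \<le> dual_norm r y"
  using inner_le_dual_norm[of 0 y] by simp

lemma dual_norm_approx:
  assumes "K < dual_norm r y"
  obtains x where "r x \<le> 1" "K < inner x y"
  using dual_norm_le[of y K] assms that by (meson not_le)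

lemma inner_le: "inner x y \<le> r x * dual_norm r y"
proof (cases "x = 0")
  case False
  then have r: "0 < r x" using nonneg[of x] eq_zero_iff[of x] by linarith
  have "inner ((1 / r x) *\<^sub>R x) y \<le> dual_norm r y"
    using r by (intro inner_le_dual_norm) (simp add: scale)
  then show ?thesis using r by (simp add: field_simps)
qed simp

lemma equivalent_norm_dual: "equivalent_norm (dual_norm r) (1 / B) (1 / A)"
proof
  show "0 < 1 / B" "0 < 1 / A" using A_pos B_pos by auto
  fix x y :: ltwo and a :: real
  show "1 / B * norm x \<le> dual_norm r x"
  proof (cases "x = 0")
    case False
    have "norm x * norm x \<le> r x * dual_norm r x"
      using inner_le[of x x] by (simp add: power2_norm_eq_inner flip: power2_eq_square)
    also have "\<dots> \<le> B * norm x * dual_norm r x"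
      by (intro mult_right_mono upper dual_norm_nonneg)
    finally show ?thesis using False B_pos by (simp add: field_simps)
  qed (simp add: dual_norm_nonneg)
  show "dual_norm r x \<le> 1 / A * norm x"
    using inner_le_of_unit by (intro dual_norm_le) simp
  show "dual_norm r (x + y) \<le> dual_norm r x + dual_norm r y"
    by (intro dual_norm_le) (auto simp: inner_add_right intro: add_mono inner_le_dual_norm)
  have le: "dual_norm r (a *\<^sub>R x) \<le> \<bar>a\<bar> * dual_norm r x" for a x
  proof (rule dual_norm_le)
    fix z assume "r z \<le> 1"
    then have "r (sgn a *\<^sub>R z) \<le> 1"
      by (simp add: scale sgn_if)
    then have "\<bar>a\<bar> * inner (sgn a *\<^sub>R z) x \<le> \<bar>a\<bar> * dual_norm r x"
      by (intro mult_left_mono inner_le_dual_norm) auto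
    moreover have "\<bar>a\<bar> * inner (sgn a *\<^sub>R z) x = inner z (a *\<^sub>R x)"
      by (simp add: sgn_if)
    ultimately show "inner z (a *\<^sub>R x) \<le> \<bar>a\<bar> * dual_norm r x" by linarith
  qed
  show "dual_norm r (a *\<^sub>R x) = \<bar>a\<bar> * dual_norm r x"
  proof (cases "a = 0")
    case True
    then show ?thesis using le[of 0 x] dual_norm_nonneg[of 0] by simp
  next
    case False
    have "\<bar>a\<bar> * dual_norm r ((1 / a) *\<^sub>R a *\<^sub>R x) \<le> \<bar>a\<bar> * (\<bar>1 / a\<bar> * dual_norm r (a *\<^sub>R x))"
      by (intro mult_left_mono le) auto
    then have "\<bar>a\<bar> * dual_norm r x \<le> dual_norm r (a *\<^sub>R x)" using False by simp
    then show ?thesis using le[of a x] by linarith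
  qed
qed

lemma op_norm_inner: "op_norm (renormed r) real_line (\<lambda>x. inner x y) = dual_norm r y"
proof (rule antisym)
  have "\<bar>inner x y\<bar> \<le> dual_norm r y" if "r x \<le> 1" for x
    using inner_le_dual_norm[OF that, of y] inner_le_dual_norm[of "- x" y] that
    by (simp add: minus)
  then show "op_norm (renormed r) real_line (\<lambda>x. inner x y) \<le> dual_norm r y"
    unfolding op_norm_def by (intro cSUP_least) (auto simp: real_line_simps intro: exI[of _ 0])
  have "\<bar>inner x y\<bar> \<le> norm y / A" if "r x \<le> 1" for x
    using inner_le_of_unit[OF that, of y] inner_le_of_unit[of "- x" y] that
    by (simp add: minus)
  then have "\<bar>inner x y\<bar> \<le> op_norm (renormed r) real_line (\<lambda>x. inner x y)" if "r x \<le> 1" for x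
    unfolding op_norm_def using that
    by (intro cSUP_upper2[where x=x] bdd_aboveI2[where M="norm y / A"]) (auto simp: real_line_simps)
  then show "dual_norm r y \<le> op_norm (renormed r) real_line (\<lambda>x. inner x y)"
    by (intro dual_norm_le) (meson abs_ge_self order_trans)
qed

text \<open>
  An equivalent norm has the same bounded functionals as the Hilbert norm, so the Riesz
  representation describes the dual of the renormed space.
\<close>
theorem isometric_iso_dual_norm:
  "isometric_iso (renormed (dual_norm r)) (dual (renormed r)) (\<lambda>y x. inner x y)"
proof -
  have carrier: "vcarrier (dual (renormed r)) = {f. bounded_linear f}"
    by (simp add: dual_simps bounded_functional_iff)
  have "bij_betw (\<lambda>y x. inner x y) (UNIV :: ltwo set) {f. bounded_linear f}"
    unfolding bij_betw_def
  proof
    show "inj (\<lambda>y x :: ltwo. inner x y)"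
    proof (rule injI)
      fix y z :: ltwo
      assume "(\<lambda>x. inner x y) = (\<lambda>x. inner x z)"
      then have "inner x (y - z) = 0" for x
        by (simp add: inner_diff_right fun_eq_iff)
      from this[of "y - z"] show "y = z" by simp
    qed
    show "range (\<lambda>y x :: ltwo. inner x y) = {f. bounded_linear f}"
    proof (intro equalityI subsetI)
      fix f :: "ltwo \<Rightarrow> real" assume "f \<in> {f. bounded_linear f}"
      then obtain y where "f = (\<lambda>x. inner x y)"
        using riesz_ltwo by blast
      then show "f \<in> range (\<lambda>y x. inner x y)"
        by (rule range_eqI)
    qed (auto intro: bounded_linear_inner_left)
  qed
  then show ?thesis
    unfolding isometric_iso_def carrier
    by (simp add: dual_simps op_norm_inner inner_add_right)
qed

lemma normed_space_dual: "normed_space (dual (renormed r))"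
  by (rule isometric_iso_normed_space[OF equivalent_norm.normed_space[OF equivalent_norm_dual]
        isometric_iso_dual_norm])

text \<open>
  Representing the dual by inner products twice identifies the bidual with the space itself, and under
  this identification the canonical embedding is the identity by the symmetry of the inner product.
\<close>
theorem reflexive: "reflexive_space (renormed r)"
proof -
  interpret D: equivalent_norm "dual_norm r" "1 / B" "1 / A" by (rule equivalent_norm_dual)
  let ?J = "\<lambda>y x :: ltwo. inner x y" and ?X = "renormed r"
  let ?R = "\<lambda>G y. G (?J y)"
  have R: "isometric_iso (dual (dual ?X)) (dual (renormed (dual_norm r))) ?R"
    using isometric_iso_dual[OF D.normed_space isometric_iso_dual_norm] by simp
  have can: "G = canonical_embedding ?X x"
    if G: "G \<in> vcarrier (dual (dual ?X))" and eq: "?R G = ?J x" for G x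
  proof
    fix f
    show "G f = canonical_embedding ?X x f"
    proof (cases "f \<in> vcarrier (dual ?X)")
      case True
      then obtain y where y: "f = ?J y"
        using isometric_isoD(3)[OF isometric_iso_dual_norm] by auto
      then show ?thesis
        using fun_cong[OF eq, of y] True by (simp add: canonical_embedding_def inner_commute)
    next
      case False
      then show ?thesis
        using G by (simp add: canonical_embedding_def dual_simps(1)[of "dual ?X"] extensional_def)
    qed
  qed
  note JD = isometric_isoD[OF D.isometric_iso_dual_norm] and R' = isometric_isoD[OF R]
  show ?thesis
    unfolding reflexive_space_def
  proof (intro equalityI subsetI)
    fix G assume "G \<in> canonical_embedding ?X ` vcarrier ?X"
    then obtain x where x: "G = canonical_embedding ?X x" by auto
    have "?J x \<in> vcarrier (dual (renormed (dual_norm r)))"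
      using JD(5)[of x] by simp
    then obtain G' where "G' \<in> vcarrier (dual (dual ?X))" "?R G' = ?J x"
      using R'(3) by (metis (no_types, lifting) imageE)
    then show "G \<in> vcarrier (dual (dual ?X))"
      using can x by metis
  next
    fix G assume G: "G \<in> vcarrier (dual (dual ?X))"
    then have "?R G \<in> vcarrier (dual (renormed (dual_norm r)))" using R'(5) by simp
    then obtain x where "?R G = ?J x"
      using JD(3) by auto
    then show "G \<in> canonical_embedding ?X ` vcarrier ?X"
      using can[OF G] by auto
  qed
qed

end

lemma ell2_simps:
  "vcarrier ell2 = {x. summable (\<lambda>j. (x j)\<^sup>2)}" "vzero ell2 = (\<lambda>j. 0)"
  "vadd ell2 x y = (\<lambda>j. x j + y j)" "vscale ell2 a x = (\<lambda>j. a * x j)"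
  "vnorm ell2 x = sqrt (\<Sum>j. (x j)\<^sup>2)"
  by (simp_all add: ell2_def)

lemma isometric_iso_ell2: "isometric_iso (renormed norm) ell2 coord"
proof -
  have "bij_betw coord UNIV {x. summable (\<lambda>j. (x j)\<^sup>2)}"
    unfolding bij_betw_def
    using coord_inject Abs_ltwo_inverse by (auto simp: inj_on_def image_iff) (metis mem_Collect_eq)
  then show ?thesis
    by (auto simp: isometric_iso_def ell2_simps norm_ltwo_eq)
qed

lemma equivalent_norm_norm: "equivalent_norm norm 1 1"
  by unfold_locales (auto simp: norm_triangle_ineq)

text \<open>
  The identity map of the underlying sequence space realises the distance bound.
\<close>
theorem (in equivalent_norm) banach_mazur_distance_ell2_le:
  assumes J: "isometric_iso (renormed r) E J"
  shows "banach_mazur_distance E ell2 \<le> ereal (B / A)"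
proof -
  have nE: "normed_space E" by (rule isometric_iso_normed_space[OF normed_space J])
  have n2: "normed_space ell2"
    by (rule isometric_iso_normed_space[OF equivalent_norm.normed_space[OF equivalent_norm_norm]
          isometric_iso_ell2])
  let ?K = "inv_into UNIV J"
  note K = isometric_isoD[OF isometric_iso_inv[OF normed_space J], simplified]
    and C = isometric_isoD[OF isometric_iso_ell2, simplified]
  have "banach_mazur_distance E ell2 \<le> ereal (1 / A * B)"
  proof (rule banach_mazur_distance_le[OF nE n2, where U="coord \<circ> ?K"])
    show "bij_betw (coord \<circ> ?K) (vcarrier E) (vcarrier ell2)"
      by (rule bij_betw_trans[OF K(1) C(1)])
    fix x a assume x: "x \<in> vcarrier E"
    show "(coord \<circ> ?K) (vscale E a x) = vscale ell2 a ((coord \<circ> ?K) x)"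
      by (simp add: K(7) x ell2_simps fun_eq_iff)
    show "vnorm ell2 ((coord \<circ> ?K) x) \<le> 1 / A * vnorm E x"
      using norm_le[of "?K x"] by (simp add: K(8) x C(8))
    show "vnorm E x \<le> B * vnorm ell2 ((coord \<circ> ?K) x)"
      using upper[of "?K x"] by (simp add: K(8) x C(8))
  qed (use A_pos B_pos in \<open>auto simp: K(6) ell2_simps fun_eq_iff\<close>)
  then show ?thesis by simp
qed

section \<open>The weak maximizing property from successive lower estimates\<close>

text \<open>
  The two properties of \<open>E\<^sub>c\<close> that force the weak maximizing property.  The first is a quantitative form of
  Kalton's property \<open>(M)\<close>: the head of a vector may be replaced by any head of no smaller norm without
  decreasing the norm of the whole.
\<close>
locale successive_lower_estimate = equivalent_norm r A B for r A B +
  assumes replace_head: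
      "r (head m u) \<le> r (head m u') \<Longrightarrow> r (head m u + tail m v) \<le> r (head m u' + tail m v)"
    and lower_2_estimate:
      "(r (head m u))\<^sup>2 + (r (tail m v))\<^sup>2 \<le> (r (head m u + tail m v))\<^sup>2"
begin

text \<open>
  For fixed \<open>y\<close> and weakly null \<open>w\<close>, the error on the right is small once \<open>m\<close> and then the index of \<open>w\<close>
  are large; so \<open>y + w\<close> may be treated as a sum of vectors with successive supports.
\<close>
lemma head_tail_perturbation:
  "\<bar>r (y + w) - r (head m y + tail m w)\<bar> \<le> B * norm (tail m y) + B * norm (head m w)"
proof -
  have "y + w - (head m y + tail m w) = tail m y + head m w"
    by (simp add: tail_def)
  then have "\<bar>r (y + w) - r (head m y + tail m w)\<bar> \<le> r (tail m y + head m w)"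
    using reverse_triangle[of "y + w" "head m y + tail m w"] by simp
  also have "\<dots> \<le> B * norm (tail m y) + B * norm (head m w)"
    using triangle[of "tail m y" "head m w"] upper[of "tail m y"] upper[of "head m w"] by linarith
  finally show ?thesis .
qed

lemma eventually_norm_head_less:
  assumes "\<And>j. (\<lambda>n. coord (w n) j) \<longlonglongrightarrow> 0" "0 < e"
  shows "\<forall>\<^sub>F n in sequentially. B * norm (head m (w n)) < e"
proof -
  have "(\<lambda>n. B * norm (head m (w n))) \<longlonglongrightarrow> B * norm (0::ltwo)"
    by (intro tendsto_intros coordinatewise_null_head assms(1))
  then show ?thesis
    using order_tendstoD(2) assms(2) by fastforce
qed

lemma eventually_norm_tail_less:
  assumes "0 < e"
  shows "\<forall>\<^sub>F m in sequentially. B * norm (tail m y) < e"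
proof -
  have "(\<lambda>m. B * norm (tail m y)) \<longlonglongrightarrow> B * norm (0::ltwo)"
    by (intro tendsto_intros tail_tendsto_zero)
  then show ?thesis
    using order_tendstoD(2) assms by fastforce
qed

text \<open>
  The asymptotic version of \<open>replace_head\<close>.  The strict inequality between the norms of \<open>y\<close> and \<open>y'\<close>
  survives truncation, which a weak one need not do.
\<close>
lemma asymptotic_monotone:
  assumes less: "r y < r y'" and w: "\<And>j. (\<lambda>n. coord (w n) j) \<longlonglongrightarrow> 0" and e: "0 < e"
  shows "\<forall>\<^sub>F n in sequentially. r (y + w n) \<le> r (y' + w n) + e"
proof -
  have "(\<lambda>m. r (head m y') - r (head m y)) \<longlonglongrightarrow> r y' - r y"
    by (intro tendsto_diff tendsto head_tendsto)
  then have "\<forall>\<^sub>F m in sequentially. 0 < r (head m y') - r (head m y)"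
    using less by (intro order_tendstoD(1)) auto
  moreover have "\<forall>\<^sub>F m in sequentially. B * norm (tail m y) < e / 4"
    "\<forall>\<^sub>F m in sequentially. B * norm (tail m y') < e / 4"
    using e by (intro eventually_norm_tail_less; simp)+
  ultimately have "\<forall>\<^sub>F m in sequentially. 0 < r (head m y') - r (head m y) \<and>
      B * norm (tail m y) < e / 4 \<and> B * norm (tail m y') < e / 4"
    by eventually_elim simp
  then obtain m where m: "r (head m y) < r (head m y')"
      "B * norm (tail m y) < e / 4" "B * norm (tail m y') < e / 4"
    by (auto simp: eventually_sequentially)
  have "\<forall>\<^sub>F n in sequentially. B * norm (head m (w n)) < e / 4"
    using w e by (intro eventually_norm_head_less) auto
  then show ?thesis
  proof eventually_elim
    case (elim n)
    have "r (head m y + tail m (w n)) \<le> r (head m y' + tail m (w n))"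
      using m(1) by (intro replace_head) simp
    then show ?case
      using head_tail_perturbation[of y "w n" m] head_tail_perturbation[of y' "w n" m] m elim
      unfolding abs_le_iff by linarith
  qed
qed

text \<open>
  By the lower 2-estimate a nonzero weak limit costs the weakly null part a definite amount of norm.
  Asymptotically \<open>r (w n)\<close> is at most \<open>sqrt (1 - (r x)\<^sup>2)\<close>; the proof uses half of \<open>r x\<close> and a margin \<open>\<eta>\<close>
  for the truncation errors.
\<close>
lemma weakly_null_part_smaller:
  assumes w: "\<And>j. (\<lambda>n. coord (w n) j) \<longlonglongrightarrow> 0" and x: "x \<noteq> 0"
    and unit: "\<And>n. r (x + w n) = 1"
  obtains \<theta> where "\<theta> < 1" "\<forall>\<^sub>F n in sequentially. r (w n) \<le> \<theta>"
proof -
  define a where "a = r x / 2"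
  have a: "0 < a" using x nonneg[of x] eq_zero_iff[of x] unfolding a_def by linarith
  have "((\<lambda>\<eta>. sqrt ((1 + 2 * \<eta>)\<^sup>2 - a\<^sup>2) + \<eta>) \<longlongrightarrow> sqrt ((1 + 2 * 0)\<^sup>2 - a\<^sup>2) + 0) (at_right 0)"
    by (intro tendsto_intros)
  moreover have "sqrt ((1 + 2 * 0)\<^sup>2 - a\<^sup>2) + 0 < 1"
    using a real_sqrt_less_mono[of "1 - a\<^sup>2" 1] by simp
  ultimately have "\<forall>\<^sub>F \<eta> in at_right 0. sqrt ((1 + 2 * \<eta>)\<^sup>2 - a\<^sup>2) + \<eta> < 1"
    by (rule order_tendstoD(2))
  then obtain \<eta> where \<eta>: "0 < \<eta>" "sqrt ((1 + 2 * \<eta>)\<^sup>2 - a\<^sup>2) + \<eta> < 1"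
    unfolding eventually_at_right_field using dense by blast
  have "(\<lambda>m. r (head m x)) \<longlonglongrightarrow> r x"
    by (intro tendsto head_tendsto)
  then have "\<forall>\<^sub>F m in sequentially. a < r (head m x)"
    using a by (intro order_tendstoD(1)) (auto simp: a_def)
  moreover have "\<forall>\<^sub>F m in sequentially. B * norm (tail m x) < \<eta>"
    using \<eta> by (intro eventually_norm_tail_less)
  ultimately have "\<forall>\<^sub>F m in sequentially. a < r (head m x) \<and> B * norm (tail m x) < \<eta>"
    by eventually_elim simp
  then obtain m where m: "a < r (head m x)" "B * norm (tail m x) < \<eta>"
    by (auto simp: eventually_sequentially)
  have "\<forall>\<^sub>F n in sequentially. B * norm (head m (w n)) < \<eta>"
    using w \<eta> by (intro eventually_norm_head_less) auto
  then have "\<forall>\<^sub>F n in sequentially. r (w n) \<le> sqrt ((1 + 2 * \<eta>)\<^sup>2 - a\<^sup>2) + \<eta>"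
  proof eventually_elim
    case (elim n)
    have "r (head m x + tail m (w n)) \<le> 1 + 2 * \<eta>"
      using head_tail_perturbation[of x "w n" m] m elim unit[of n]
      unfolding abs_le_iff by linarith
    then have "(r (head m x + tail m (w n)))\<^sup>2 \<le> (1 + 2 * \<eta>)\<^sup>2"
      using nonneg by (intro power_mono)
    moreover have "a\<^sup>2 \<le> (r (head m x))\<^sup>2"
      using a m by (intro power_mono) auto
    ultimately have "(r (tail m (w n)))\<^sup>2 \<le> (1 + 2 * \<eta>)\<^sup>2 - a\<^sup>2"
      using lower_2_estimate[of m x "w n"] by linarith
    then have "r (tail m (w n)) \<le> sqrt ((1 + 2 * \<eta>)\<^sup>2 - a\<^sup>2)"
      by (rule real_le_rsqrt)
    moreover have "r (w n) \<le> r (head m (w n)) + r (tail m (w n))"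
      using triangle[of "head m (w n)" "tail m (w n)"] by (simp add: head_plus_tail)
    moreover have "r (head m (w n)) < \<eta>"
      using upper[of "head m (w n)"] elim by linarith
    ultimately show ?case by linarith
  qed
  then show ?thesis using that \<eta>(2) by blast
qed

text \<open>
  If \<open>T\<close> is strictly contracted at the weak limit \<open>x\<close>, a shorter vector \<open>u\<close> has an image longer than \<open>T x\<close>.
  Exchanging \<open>T x\<close> for \<open>T u\<close> in the range and \<open>u\<close> for \<open>\<mu> x\<close> in the domain costs nothing in the limit by
  \<open>asymptotic_monotone\<close>, and \<open>\<mu> x + w n\<close> is a convex combination of the unit vector \<open>z n\<close> and of the
  shorter vector \<open>w n\<close>.
\<close>
lemma weak_limit_attains:
  assumes T: "bounded_linear T"
    and \<tau>: "0 \<le> \<tau>" "\<And>x. r (T x) \<le> \<tau> * r x" "\<And>K. K < \<tau> \<Longrightarrow> \<exists>u. r u = 1 \<and> K < r (T u)"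
    and unit: "\<And>n. r (z n) = 1" and max: "(\<lambda>n. r (T (z n))) \<longlonglongrightarrow> \<tau>"
    and weak: "\<And>j. (\<lambda>n. coord (z n) j) \<longlonglongrightarrow> coord x j" and x: "x \<noteq> 0"
  shows "r (T x) = \<tau> * r x"
proof (rule ccontr)
  assume "r (T x) \<noteq> \<tau> * r x"
  then have less: "r (T x) < \<tau> * r x" using \<tau>(2)[of x] by linarith
  interpret T: bounded_linear T by fact
  have a: "0 < r x" using x nonneg[of x] eq_zero_iff[of x] by linarith
  then have \<tau>_pos: "0 < \<tau>"
    using le_less_trans[OF nonneg less] by (simp add: zero_less_mult_iff)
  have "r (T x) / r x < \<tau>"
    using less a by (simp add: field_simps)
  then obtain u0 where u0: "r u0 = 1" "r (T x) / r x < r (T u0)"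
    using \<tau>(3) by blast
  then have Tx: "r (T x) < r x * r (T u0)" using a by (simp add: field_simps)
  then have Tu0: "0 < r (T u0)"
    using le_less_trans[OF nonneg Tx] a by (simp add: zero_less_mult_iff)
  \<comment> \<open>A factor \<open>l\<close> between the following quotient and 1 keeps the image of \<open>(l * r x) *\<^sub>R u0\<close> longer than \<open>T x\<close>, and \<open>l < \<mu>\<close>
    keeps the vector itself strictly shorter than \<open>\<mu> *\<^sub>R x\<close>.\<close>
  have "r (T x) / (r x * r (T u0)) < 1"
    using Tx a Tu0 by simp
  then obtain l where l: "r (T x) / (r x * r (T u0)) < l" "l < 1"
    using dense by blast
  moreover obtain \<mu> where "l < \<mu>" "\<mu> < 1"
    using dense[OF l(2)] by blast
  moreover have "0 \<le> r (T x) / (r x * r (T u0))"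
    using nonneg a Tu0 by simp
  ultimately have lm: "r (T x) / (r x * r (T u0)) < l" "0 < l" "l < \<mu>" "\<mu> < 1"
    by auto
  define u where "u = (l * r x) *\<^sub>R u0"
  have Tu: "r (T x) < r (T u)"
    using lm a Tu0 by (simp add: u_def T.scaleR scale field_simps)
  have u: "r u < r (\<mu> *\<^sub>R x)"
    using lm a by (simp add: u_def scale u0)
  define w where "w = (\<lambda>n. z n - x)"
  have w: "(\<lambda>n. coord (w n) j) \<longlonglongrightarrow> 0" for j
    unfolding w_def coord_simps by (rule LIM_zero[OF weak])
  have wbdd: "norm (w n) \<le> 1 / A + norm x" for n
    using norm_triangle_ineq4[of "z n" x] norm_le[of "z n"] unit[of n] by (simp add: w_def)
  have Tw: "(\<lambda>n. coord (T (w n)) j) \<longlonglongrightarrow> 0" for j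
  proof -
    have "bounded_linear (\<lambda>v. inner (T v) (unit_vector j))"
      by (intro bounded_linear_compose[OF bounded_linear_inner_left T])
    then obtain y where "(\<lambda>v. inner (T v) (unit_vector j)) = (\<lambda>v. inner v y)"
      using riesz_ltwo by blast
    then have "coord (T v) j = inner v y" for v
      by (simp add: fun_eq_iff)
    then show ?thesis
      using coordinatewise_null_inner[OF w wbdd, of y] by simp
  qed
  obtain \<theta> where \<theta>: "\<theta> < 1" "\<forall>\<^sub>F n in sequentially. r (w n) \<le> \<theta>"
  proof (rule weakly_null_part_smaller[OF w x])
    show "r (x + w n) = 1" for n by (simp add: w_def unit)
  qed
  \<comment> \<open>\<open>\<delta>\<close> is the gap between 1 and the bound \<open>\<mu> + (1 - \<mu>) * \<theta>\<close>; each of the three limiting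
    steps may use up a quarter of it.\<close>
  define \<delta> where "\<delta> = (1 - \<mu>) * (1 - \<theta>)"
  have \<delta>: "0 < \<delta>" using lm \<theta> by (simp add: \<delta>_def)
  have e1: "\<forall>\<^sub>F n in sequentially. r (T x + T (w n)) \<le> r (T u + T (w n)) + \<tau> * \<delta> / 4"
    by (rule asymptotic_monotone[OF Tu Tw]) (use \<tau>_pos \<delta> in simp)
  have e2: "\<forall>\<^sub>F n in sequentially. r (u + w n) \<le> r (\<mu> *\<^sub>R x + w n) + \<delta> / 4"
    by (rule asymptotic_monotone[OF u w]) (use \<delta> in simp)
  have e3: "\<forall>\<^sub>F n in sequentially. \<tau> * (1 - \<delta> / 4) < r (T (z n))"
    using \<tau>_pos \<delta> by (intro order_tendstoD(1)[OF max]) simp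
  have "\<forall>\<^sub>F n in sequentially. False"
    using e1 e2 e3 \<theta>(2)
  proof eventually_elim
    case (elim n)
    have "\<mu> *\<^sub>R x + w n = \<mu> *\<^sub>R z n + (1 - \<mu>) *\<^sub>R w n"
      by (simp add: w_def algebra_simps)
    then have "r (\<mu> *\<^sub>R x + w n) \<le> \<mu> * r (z n) + (1 - \<mu>) * r (w n)"
      using triangle[of "\<mu> *\<^sub>R z n" "(1 - \<mu>) *\<^sub>R w n"] lm by (simp add: scale)
    also have "\<dots> \<le> \<mu> + (1 - \<mu>) * \<theta>"
      using lm elim unit by (intro add_mono mult_left_mono) auto
    also have "\<dots> = 1 - \<delta>" by (simp add: \<delta>_def algebra_simps)
    finally have 1: "r (u + w n) \<le> 1 - \<delta> + \<delta> / 4" using elim by linarith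
    have "r (T (u + w n)) \<le> \<tau> * (1 - \<delta> + \<delta> / 4)"
      using \<tau>(2)[of "u + w n"] mult_left_mono[OF 1 \<tau>(1)] by linarith
    moreover have "T (z n) = T x + T (w n)" by (simp add: w_def T.diff)
    ultimately have "\<tau> * (1 - \<delta> / 4) < \<tau> * (1 - \<delta> + \<delta> / 4) + \<tau> * \<delta> / 4"
      using elim by (simp add: T.add)
    then have "\<tau> * (1 - \<delta> / 4) < \<tau> * (1 - \<delta> + \<delta> / 4 + \<delta> / 4)"
      by (simp add: algebra_simps)
    then have "1 - \<delta> / 4 < 1 - \<delta> + \<delta> / 4 + \<delta> / 4"
      using \<tau>_pos by simp
    then show False using \<delta> by simp
  qed
  then show False by simp
qed

text \<open>
  A maximizing sequence that is not weakly null has a subsequence on which some functional stays away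
  from 0, and a further subsequence with a weak limit; this limit is nonzero and norming.
\<close>
theorem weak_maximizing_property_renormed:
  "weak_maximizing_property (renormed r) (renormed r)"
  unfolding weak_maximizing_property_def
proof (intro allI impI, elim conjE exE)
  fix T z
  assume T': "bounded_operator (renormed r) (renormed r) T"
    and z: "maximizing_sequence (renormed r) (renormed r) T z" and nn: "\<not> weakly_null (renormed r) z"
  have T: "bounded_linear T" using T' by (simp add: bounded_operator_iff)
  interpret T: bounded_linear T by fact
  define \<tau> where "\<tau> = op_norm (renormed r) (renormed r) T"
  have \<tau>0: "0 \<le> \<tau>" unfolding \<tau>_def by (rule op_norm_nonneg[OF T' normed_space normed_space])
  have \<tau>1: "r (T x) \<le> \<tau>" if "r x \<le> 1" for x
    using le_op_norm[OF T' normed_space normed_space, of x] that by (simp add: \<tau>_def)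
  have unitize: "r ((1 / r x) *\<^sub>R x) = 1" if "x \<noteq> 0" for x
    using that nonneg[of x] by (simp add: scale)
  have \<tau>2: "r (T x) \<le> \<tau> * r x" for x
  proof (cases "x = 0")
    case False
    then have "0 < r x" using nonneg[of x] eq_zero_iff[of x] by linarith
    then show ?thesis
      using \<tau>1[of "(1 / r x) *\<^sub>R x"] unitize[OF False] by (simp add: T.scaleR scale field_simps)
  qed (simp add: T.zero)
  have unit: "r (z n) = 1" for n
    using z by (auto simp: maximizing_sequence_def unit_sphere_def)
  have max: "(\<lambda>n. r (T (z n))) \<longlonglongrightarrow> \<tau>"
    using z by (simp add: maximizing_sequence_def \<tau>_def)
  have \<tau>3: "\<exists>u. r u = 1 \<and> K < r (T u)" if "K < \<tau>" for K
  proof -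
    have "\<forall>\<^sub>F n in sequentially. K < r (T (z n))"
      by (rule order_tendstoD(1)[OF max that])
    then obtain n where "K < r (T (z n))"
      by (auto simp: eventually_sequentially)
    then show ?thesis using unit by (intro exI[of _ "z n"]) simp
  qed
  obtain f where f: "f \<in> vcarrier (dual (renormed r))" "\<not> (\<lambda>n. f (z n)) \<longlonglongrightarrow> 0"
    using nn by (auto simp: weakly_null_def)
  then have "bounded_linear f" by (simp add: dual_simps bounded_functional_iff)
  then obtain y where y: "f = (\<lambda>x. inner x y)" using riesz_ltwo by blast
  have "\<not> (\<lambda>n. inner (z n) y) \<longlonglongrightarrow> 0"
    using f(2) unfolding y .
  then have "\<exists>e>0. \<forall>N. \<exists>n\<ge>N. e \<le> \<bar>inner (z n) y\<bar>"
    unfolding LIMSEQ_iff by (simp add: not_less)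
  then obtain e where e: "0 < e" "\<forall>N. \<exists>n\<ge>N. e \<le> \<bar>inner (z n) y\<bar>"
    by blast
  have "\<forall>N. \<exists>n. N < n \<and> e \<le> \<bar>inner (z n) y\<bar>"
    using e(2) Suc_le_eq by blast
  from choice[OF this] obtain k where k: "\<forall>N. N < k N \<and> e \<le> \<bar>inner (z (k N)) y\<bar>"
    by blast
  define z' where "z' = (\<lambda>n. z (k n))"
  have "filterlim k at_top sequentially"
  proof (rule filterlim_at_top_mono[OF filterlim_ident], rule always_eventually, rule allI)
    show "N \<le> k N" for N using k by (simp add: less_imp_le)
  qed
  then have max': "(\<lambda>n. r (T (z' n))) \<longlonglongrightarrow> \<tau>"
    using filterlim_compose[OF max] by (simp add: z'_def)
  have bdd: "norm (z' n) \<le> 1 / A" for n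
    using norm_le[of "z' n"] unit by (simp add: z'_def)
  obtain x s where s: "strict_mono s" and x: "\<And>j. (\<lambda>n. coord (z' (s n)) j) \<longlonglongrightarrow> coord x j"
    using bounded_coordinatewise_convergent_subseq[of z' "1 / A", OF bdd] by blast
  have "x \<noteq> 0"
  proof
    assume "x = 0"
    then have "(\<lambda>n. inner (z' (s n)) y) \<longlonglongrightarrow> 0"
      using x bdd by (intro coordinatewise_null_inner[where B="1 / A"]) auto
    then have "\<forall>\<^sub>F n in sequentially. \<bar>inner (z' (s n)) y\<bar> < e"
      using e(1) by (auto simp: tendsto_iff dist_real_def)
    then obtain n where "\<bar>inner (z' (s n)) y\<bar> < e"
      by (auto simp: eventually_sequentially)
    then show False
      using k[rule_format, of "s n"] by (simp add: z'_def)
  qed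
  have "r (T x) = \<tau> * r x"
  proof (rule weak_limit_attains[OF T \<tau>0 \<tau>2 \<tau>3 _ _ x \<open>x \<noteq> 0\<close>])
    show "r (z' (s n)) = 1" for n by (simp add: z'_def unit)
    show "(\<lambda>n. r (T (z' (s n)))) \<longlonglongrightarrow> \<tau>"
      using LIMSEQ_subseq_LIMSEQ[OF max' s] by (simp add: o_def)
  qed
  then have "r (T ((1 / r x) *\<^sub>R x)) = \<tau>"
    using \<open>x \<noteq> 0\<close> nonneg[of x] by (simp add: T.scaleR scale)
  then show "attains_norm (renormed r) (renormed r) T"
    unfolding attains_norm_def unit_sphere_def \<tau>_def[symmetric]
    using unitize[OF \<open>x \<noteq> 0\<close>] by (intro bexI[of _ "(1 / r x) *\<^sub>R x"]) auto
qed

end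

section \<open>Dualizing successive upper estimates\<close>

text \<open>
  The properties of \<open>X\<^sub>c\<close> whose dual versions are the assumptions of \<open>successive_lower_estimate\<close>.
  That truncations are contractive lets the vectors that almost norm a head or a tail be taken with
  the same support.
\<close>
locale successive_upper_estimate = equivalent_norm r A B for r A B +
  assumes replace_head:
      "r (head m u) \<le> r (head m u') \<Longrightarrow> r (head m u + tail m v) \<le> r (head m u' + tail m v)"
    and upper_2_estimate:
      "(r (head m u + tail m v))\<^sup>2 \<le> (r (head m u))\<^sup>2 + (r (tail m v))\<^sup>2"
    and head_le: "r (head m x) \<le> r x"
    and tail_le: "r (tail m x) \<le> r x"
begin

lemma inner_head_plus_tail:
  "inner (head m x + tail m y) (head m u + tail m v) = inner (head m x) (head m u) + inner (tail m y) (tail m v)"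
  by (simp add: inner_add_left inner_add_right)

lemma inner_head_head: "inner (head m x) (head m y) = inner x (head m y)"
  and inner_tail_tail: "inner (tail m x) (tail m y) = inner x (tail m y)"
  by (simp_all add: inner_head_swap inner_tail_swap)

text \<open>
  Let \<open>z\<close> be in the unit ball.  Trade the head of \<open>z\<close> for a vector of no larger norm that almost norms
  \<open>head m u'\<close>: by \<open>replace_head\<close> the result is still in the unit ball, and it pairs with
  \<open>head m u' + tail m v\<close> to almost as much as \<open>z\<close> does with \<open>head m u + tail m v\<close>.
\<close>
lemma dual_replace_head:
  assumes le: "dual_norm r (head m u) \<le> dual_norm r (head m u')"
  shows "dual_norm r (head m u + tail m v) \<le> dual_norm r (head m u' + tail m v)"
proof (rule dual_norm_le, rule field_le_epsilon)
  fix z and \<eta> :: real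
  assume z: "r z \<le> 1" and \<eta>: "0 < \<eta>"
  let ?s = "r (head m z)"
  have s: "0 \<le> ?s" "?s \<le> 1" using nonneg head_le[of m z] z by auto
  have "dual_norm r (head m u') - \<eta> < dual_norm r (head m u')" using \<eta> by simp
  then obtain h where h: "r h \<le> 1" "dual_norm r (head m u') - \<eta> < inner h (head m u')"
    by (rule dual_norm_approx)
  have "r (head m (?s *\<^sub>R h)) \<le> r (head m z)"
    using head_le[of m h] h(1) s mult_left_mono[of "r (head m h)" 1 ?s]
    by (simp add: head_scaleR scale)
  then have "r (head m (?s *\<^sub>R h) + tail m z) \<le> 1"
    using replace_head[of m "?s *\<^sub>R h" z z] z by (simp add: head_plus_tail)
  then have "inner (head m (?s *\<^sub>R h) + tail m z) (head m u' + tail m v)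
      \<le> dual_norm r (head m u' + tail m v)"
    by (rule inner_le_dual_norm)
  then have 1: "?s * inner h (head m u') + inner z (tail m v) \<le> dual_norm r (head m u' + tail m v)"
    by (simp add: inner_head_plus_tail inner_head_head inner_tail_tail)
  have "inner (head m z) (head m u) \<le> ?s * dual_norm r (head m u)"
    by (rule inner_le)
  also have "\<dots> \<le> ?s * (inner h (head m u') + \<eta>)"
    using le h(2) s by (intro mult_left_mono) auto
  also have "\<dots> \<le> ?s * inner h (head m u') + \<eta>"
    using s \<eta> mult_right_mono[of ?s 1 \<eta>] by (simp add: algebra_simps)
  finally have 2: "inner z (head m u) \<le> ?s * inner h (head m u') + \<eta>"
    by (simp add: inner_head_head)
  show "inner z (head m u + tail m v) \<le> dual_norm r (head m u' + tail m v) + \<eta>"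
    using 1 2 by (simp add: inner_add_right)
qed

text \<open>
  With \<open>a\<close>, \<open>b\<close> the dual norms of the two blocks and \<open>h\<close>, \<open>k\<close> almost norming them, the vector
  \<open>a h + b k\<close>, cut to the two blocks, has norm at most \<open>sqrt (a\<^sup>2 + b\<^sup>2)\<close> and pairs to almost \<open>a\<^sup>2 + b\<^sup>2\<close>.
\<close>
lemma dual_lower_2_estimate:
  "(dual_norm r (head m u))\<^sup>2 + (dual_norm r (tail m v))\<^sup>2 \<le> (dual_norm r (head m u + tail m v))\<^sup>2"
proof -
  let ?a = "dual_norm r (head m u)" and ?b = "dual_norm r (tail m v)"
  let ?Q = "dual_norm r (head m u + tail m v)"
  define S where "S = ?a\<^sup>2 + ?b\<^sup>2"
  have a: "0 \<le> ?a" and b: "0 \<le> ?b" using dual_norm_nonneg by auto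
  have S: "0 \<le> S" by (simp add: S_def)
  have "S \<le> sqrt S * ?Q"
  proof (rule field_le_epsilon)
    fix e :: real assume e: "0 < e"
    define \<eta> where "\<eta> = e / (?a + ?b + 1)"
    have \<eta>: "0 < \<eta>" using e a b by (simp add: \<eta>_def)
    have "(?a + ?b + 1) * \<eta> = e" using a b by (simp add: \<eta>_def)
    then have \<eta>e: "(?a + ?b) * \<eta> \<le> e" using \<eta> by (simp add: algebra_simps)
    have "?a - \<eta> < ?a" using \<eta> by simp
    then obtain h where h: "r h \<le> 1" "?a - \<eta> < inner h (head m u)"
      by (rule dual_norm_approx)
    have "?b - \<eta> < ?b" using \<eta> by simp
    then obtain k where k: "r k \<le> 1" "?b - \<eta> < inner k (tail m v)"
      by (rule dual_norm_approx)
    let ?z = "head m (?a *\<^sub>R h) + tail m (?b *\<^sub>R k)"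
    have "r (head m (?a *\<^sub>R h)) \<le> ?a"
      using head_le[of m h] h(1) a mult_left_mono[of "r (head m h)" 1 ?a]
      by (simp add: head_scaleR scale)
    then have "(r (head m (?a *\<^sub>R h)))\<^sup>2 \<le> ?a\<^sup>2" using nonneg by (intro power_mono)
    moreover have "r (tail m (?b *\<^sub>R k)) \<le> ?b"
      using tail_le[of m k] k(1) b mult_left_mono[of "r (tail m k)" 1 ?b]
      by (simp add: tail_scaleR scale)
    then have "(r (tail m (?b *\<^sub>R k)))\<^sup>2 \<le> ?b\<^sup>2" using nonneg by (intro power_mono)
    ultimately have "(r ?z)\<^sup>2 \<le> S"
      using upper_2_estimate[of m "?a *\<^sub>R h" "?b *\<^sub>R k"] by (simp add: S_def)
    then have z: "r ?z \<le> sqrt S" by (rule real_le_rsqrt)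
    have "S = ?a * (?a - \<eta>) + ?b * (?b - \<eta>) + (?a + ?b) * \<eta>"
      by (simp add: S_def power2_eq_square algebra_simps)
    also have "\<dots> \<le> ?a * inner h (head m u) + ?b * inner k (tail m v) + e"
      using h k a b \<eta>e by (intro add_mono mult_left_mono) auto
    also have "?a * inner h (head m u) + ?b * inner k (tail m v) = inner ?z (head m u + tail m v)"
      by (simp add: inner_head_plus_tail inner_head_head inner_tail_tail)
    also have "\<dots> \<le> r ?z * ?Q" by (rule inner_le)
    also have "\<dots> \<le> sqrt S * ?Q" by (intro mult_right_mono z dual_norm_nonneg)
    finally show "S \<le> sqrt S * ?Q + e" by simp
  qed
  then have le: "sqrt S * sqrt S \<le> sqrt S * ?Q" using S by simp
  have "sqrt S \<le> ?Q"
  proof (cases "S = 0")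
    case False
    then have "0 < sqrt S" using S by simp
    then show ?thesis using le by (rule mult_left_le_imp_le[rotated])
  qed (simp add: dual_norm_nonneg)
  then have "(sqrt S)\<^sup>2 \<le> ?Q\<^sup>2" using S by (intro power_mono) auto
  then show ?thesis using S by (simp add: S_def)
qed

theorem successive_lower_estimate_dual: "successive_lower_estimate (dual_norm r) (1 / B) (1 / A)"
  by (intro successive_lower_estimate.intro equivalent_norm_dual successive_lower_estimate_axioms.intro
      dual_replace_head dual_lower_2_estimate)

end

section \<open>Completion of a dense subspace\<close>

text \<open>
  The map \<open>\<iota>\<close> embeds a normed space isometrically and densely into the renormed Hilbert space, which is
  complete.  A class of Cauchy sequences then consists of all sequences whose images have a
  given limit.
\<close>
locale dense_embedding = equivalent_norm r A B for r A B +
  fixes V :: "'a nspace" and \<iota> :: "'a \<Rightarrow> ltwo"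
  assumes V: "normed_space V"
    and \<iota>_zero: "\<iota> (vzero V) = 0"
    and \<iota>_add: "x \<in> vcarrier V \<Longrightarrow> y \<in> vcarrier V \<Longrightarrow> \<iota> (vadd V x y) = \<iota> x + \<iota> y"
    and \<iota>_scale: "x \<in> vcarrier V \<Longrightarrow> \<iota> (vscale V a x) = a *\<^sub>R \<iota> x"
    and \<iota>_norm: "x \<in> vcarrier V \<Longrightarrow> r (\<iota> x) = vnorm V x"
    and dense: "\<exists>\<sigma>. range \<sigma> \<subseteq> vcarrier V \<and> (\<lambda>n. \<iota> (\<sigma> n)) \<longlonglongrightarrow> w"
begin

definition represents :: "ltwo \<Rightarrow> (nat \<Rightarrow> 'a) set" where
  "represents w = {\<sigma>. range \<sigma> \<subseteq> vcarrier V \<and> (\<lambda>n. \<iota> (\<sigma> n)) \<longlonglongrightarrow> w}"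

lemma representsD:
  assumes "\<sigma> \<in> represents w"
  shows "\<sigma> n \<in> vcarrier V" "(\<lambda>n. \<iota> (\<sigma> n)) \<longlonglongrightarrow> w"
  using assms by (auto simp: represents_def)

lemma representsI:
  "(\<And>n. \<sigma> n \<in> vcarrier V) \<Longrightarrow> (\<lambda>n. \<iota> (\<sigma> n)) \<longlonglongrightarrow> w \<Longrightarrow> \<sigma> \<in> represents w"
  by (auto simp: represents_def)

lemma represents_nonempty: "represents w \<noteq> {}"
  using dense[of w] by (auto simp: represents_def)

lemma represents_unique: "\<sigma> \<in> represents v \<Longrightarrow> \<sigma> \<in> represents w \<Longrightarrow> v = w"
  using LIMSEQ_unique representsD(2) by blast

lemma vdist_eq:
  assumes "x \<in> vcarrier V" "y \<in> vcarrier V"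
  shows "vdist V x y = r (\<iota> x - \<iota> y)"
proof -
  interpret V: normed_space V by (rule V)
  have "vnorm V (vadd V x (vscale V (- 1) y)) = r (\<iota> (vadd V x (vscale V (- 1) y)))"
    using assms by (intro \<iota>_norm[symmetric] V.add_closed V.scale_closed)
  then show ?thesis
    using assms by (simp add: vdist_def \<iota>_add \<iota>_scale V.scale_closed)
qed

lemma tendsto_zero_iff: "(\<lambda>n. r (f n)) \<longlonglongrightarrow> 0 \<longleftrightarrow> f \<longlonglongrightarrow> 0"
proof
  assume "(\<lambda>n. r (f n)) \<longlonglongrightarrow> 0"
  then have "(\<lambda>n. r (f n) / A) \<longlonglongrightarrow> 0 / A"
    by (intro tendsto_intros) (use A_pos in auto)
  then show "f \<longlonglongrightarrow> 0"
    by (intro Lim_null_comparison[of f "\<lambda>n. r (f n) / A"]) (auto simp: norm_le)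
next
  assume "f \<longlonglongrightarrow> 0"
  from tendsto[OF this] show "(\<lambda>n. r (f n)) \<longlonglongrightarrow> 0" by simp
qed

lemma cauchy_seqs_eq: "cauchy_seqs V = (\<Union>w. represents w)"
proof -
  interpret N: normed_space V by (rule V)
  interpret MV: Metric_space "vcarrier V" "vdist V" by (rule N.Metric_space_vdist)
  have "MV.MCauchy \<sigma> \<longleftrightarrow> (\<exists>w. \<sigma> \<in> represents w)" for \<sigma>
  proof
    assume C: "MV.MCauchy \<sigma>"
    then have \<sigma>: "\<sigma> n \<in> vcarrier V" for n by (auto simp: MV.MCauchy_def)
    have "Cauchy (\<lambda>n. \<iota> (\<sigma> n))"
    proof (rule metric_CauchyI)
      fix e :: real assume "0 < e"
      then have "0 < A * e" using A_pos by simp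
      then obtain N where N: "\<forall>m n. N \<le> m \<longrightarrow> N \<le> n \<longrightarrow> vdist V (\<sigma> m) (\<sigma> n) < A * e"
        using C unfolding MV.MCauchy_def by blast
      have "dist (\<iota> (\<sigma> m)) (\<iota> (\<sigma> n)) < e" if "N \<le> m" "N \<le> n" for m n
      proof -
        have "A * norm (\<iota> (\<sigma> m) - \<iota> (\<sigma> n)) < A * e"
          using N that lower[of "\<iota> (\<sigma> m) - \<iota> (\<sigma> n)"] vdist_eq[OF \<sigma> \<sigma>, of m n]
          by (metis le_less_trans)
        then show ?thesis using A_pos by (simp add: dist_norm)
      qed
      then show "\<exists>N. \<forall>m\<ge>N. \<forall>n\<ge>N. dist (\<iota> (\<sigma> m)) (\<iota> (\<sigma> n)) < e" by blast
    qed
    then obtain w where "(\<lambda>n. \<iota> (\<sigma> n)) \<longlonglongrightarrow> w"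
      using Cauchy_convergent convergent_def by blast
    then show "\<exists>w. \<sigma> \<in> represents w" using \<sigma> representsI by blast
  next
    assume "\<exists>w. \<sigma> \<in> represents w"
    then obtain w where \<sigma>: "\<And>n. \<sigma> n \<in> vcarrier V" and lim: "(\<lambda>n. \<iota> (\<sigma> n)) \<longlonglongrightarrow> w"
      using representsD by blast
    have "Cauchy (\<lambda>n. \<iota> (\<sigma> n))"
      using lim convergent_Cauchy convergent_def by blast
    show "MV.MCauchy \<sigma>"
      unfolding MV.MCauchy_def
    proof (intro conjI allI impI)
      show "range \<sigma> \<subseteq> vcarrier V" using \<sigma> by auto
      fix e :: real assume "0 < e"
      then have "0 < e / B" using B_pos by simp
      then obtain N where N: "\<forall>m\<ge>N. \<forall>n\<ge>N. dist (\<iota> (\<sigma> m)) (\<iota> (\<sigma> n)) < e / B"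
        using metric_CauchyD[OF \<open>Cauchy _\<close>] by blast
      have "vdist V (\<sigma> m) (\<sigma> n) < e" if "N \<le> m" "N \<le> n" for m n
      proof -
        have "B * norm (\<iota> (\<sigma> m) - \<iota> (\<sigma> n)) < e"
          using N that B_pos by (simp add: dist_norm field_simps)
        then show ?thesis
          using upper[of "\<iota> (\<sigma> m) - \<iota> (\<sigma> n)"] by (simp add: vdist_eq \<sigma>)
      qed
      then show "\<exists>N. \<forall>m n. N \<le> m \<longrightarrow> N \<le> n \<longrightarrow> vdist V (\<sigma> m) (\<sigma> n) < e" by blast
    qed
  qed
  then show ?thesis by (auto simp: cauchy_seqs_def)
qed

lemma cauchy_class:
  assumes \<sigma>: "\<sigma> \<in> represents w"
  shows "cauchy_rel V `` {\<sigma>} = represents w"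
proof (intro equalityI subsetI)
  fix \<tau> assume "\<tau> \<in> cauchy_rel V `` {\<sigma>}"
  then have "\<tau> \<in> cauchy_seqs V" and d: "(\<lambda>n. vdist V (\<sigma> n) (\<tau> n)) \<longlonglongrightarrow> 0"
    by (auto simp: cauchy_rel_def)
  then obtain v where \<tau>: "\<tau> \<in> represents v" by (auto simp: cauchy_seqs_eq)
  have "(\<lambda>n. \<iota> (\<sigma> n) - \<iota> (\<tau> n)) \<longlonglongrightarrow> 0"
    using d by (simp add: vdist_eq representsD(1)[OF \<sigma>] representsD(1)[OF \<tau>] tendsto_zero_iff)
  moreover have "(\<lambda>n. \<iota> (\<sigma> n) - \<iota> (\<tau> n)) \<longlonglongrightarrow> w - v"
    by (intro tendsto_diff representsD(2) \<sigma> \<tau>)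
  ultimately have "w - v = 0" using LIMSEQ_unique by blast
  then show "\<tau> \<in> represents w" using \<tau> by simp
next
  fix \<tau> assume \<tau>: "\<tau> \<in> represents w"
  have "(\<lambda>n. \<iota> (\<sigma> n) - \<iota> (\<tau> n)) \<longlonglongrightarrow> w - w"
    by (intro tendsto_diff representsD(2) \<sigma> \<tau>)
  then have "(\<lambda>n. vdist V (\<sigma> n) (\<tau> n)) \<longlonglongrightarrow> 0"
    by (simp add: vdist_eq representsD(1)[OF \<sigma>] representsD(1)[OF \<tau>] tendsto_zero_iff)
  moreover have "\<sigma> \<in> cauchy_seqs V" "\<tau> \<in> cauchy_seqs V"
    using \<sigma> \<tau> by (auto simp: cauchy_seqs_eq)
  ultimately show "\<tau> \<in> cauchy_rel V `` {\<sigma>}" by (simp add: cauchy_rel_def)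
qed

text \<open>
  The operations of the completion are unions over all representatives; since each member of such a
  union is the same class, the union is that class.
\<close>
lemma completion_simps:
  "vcarrier (completion V) = range represents"
  "vzero (completion V) = represents 0"
  "vadd (completion V) (represents v) (represents w) = represents (v + w)"
  "vscale (completion V) a (represents w) = represents (a *\<^sub>R w)"
  "vnorm (completion V) (represents w) = r w"
proof -
  interpret N: normed_space V by (rule V)
  show "vcarrier (completion V) = range represents"
  proof -
    have "vcarrier (completion V) = (\<Union>\<sigma>\<in>cauchy_seqs V. {cauchy_rel V `` {\<sigma>}})"
      by (simp add: completion_def quotient_def)
    also have "\<dots> = range represents"
    proof (intro equalityI subsetI)
      fix C assume "C \<in> (\<Union>\<sigma>\<in>cauchy_seqs V. {cauchy_rel V `` {\<sigma>}})"
      then obtain \<sigma> w where "\<sigma> \<in> represents w" "C = cauchy_rel V `` {\<sigma>}"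
        by (auto simp: cauchy_seqs_eq)
      then show "C \<in> range represents" by (simp add: cauchy_class)
    next
      fix C assume "C \<in> range represents"
      then obtain w where w: "C = represents w" by auto
      obtain \<sigma> where "\<sigma> \<in> represents w" using represents_nonempty by blast
      then show "C \<in> (\<Union>\<sigma>\<in>cauchy_seqs V. {cauchy_rel V `` {\<sigma>}})"
        using cauchy_class w by (auto simp: cauchy_seqs_eq)
    qed
    finally show ?thesis .
  qed
  have "(\<lambda>n. vzero V) \<in> represents 0"
    by (rule representsI) (simp_all add: N.zero_closed \<iota>_zero)
  then show "vzero (completion V) = represents 0"
    by (simp add: completion_def cauchy_class)
  have add: "cauchy_rel V `` {\<lambda>n. vadd V (\<sigma> n) (\<tau> n)} = represents (v + w)"
    if \<sigma>: "\<sigma> \<in> represents v" and \<tau>: "\<tau> \<in> represents w" for \<sigma> \<tau>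
  proof (rule cauchy_class, rule representsI)
    show "vadd V (\<sigma> n) (\<tau> n) \<in> vcarrier V" for n
      by (intro N.add_closed representsD(1)[OF \<sigma>] representsD(1)[OF \<tau>])
    show "(\<lambda>n. \<iota> (vadd V (\<sigma> n) (\<tau> n))) \<longlonglongrightarrow> v + w"
      using tendsto_add[OF representsD(2)[OF \<sigma>] representsD(2)[OF \<tau>]]
      by (simp add: \<iota>_add representsD(1)[OF \<sigma>] representsD(1)[OF \<tau>])
  qed
  have "vadd (completion V) (represents v) (represents w)
      = (\<Union>\<sigma>\<in>represents v. \<Union>\<tau>\<in>represents w. represents (v + w))"
    unfolding completion_def by (simp add: add)
  then show "vadd (completion V) (represents v) (represents w) = represents (v + w)"
    by (simp add: represents_nonempty)
  have scale: "cauchy_rel V `` {\<lambda>n. vscale V a (\<sigma> n)} = represents (a *\<^sub>R w)"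
    if \<sigma>: "\<sigma> \<in> represents w" for \<sigma>
  proof (rule cauchy_class, rule representsI)
    show "vscale V a (\<sigma> n) \<in> vcarrier V" for n
      by (intro N.scale_closed representsD(1)[OF \<sigma>])
    show "(\<lambda>n. \<iota> (vscale V a (\<sigma> n))) \<longlonglongrightarrow> a *\<^sub>R w"
      using tendsto_scaleR[OF tendsto_const representsD(2)[OF \<sigma>]]
      by (simp add: \<iota>_scale representsD(1)[OF \<sigma>])
  qed
  have "vscale (completion V) a (represents w) = (\<Union>\<sigma>\<in>represents w. represents (a *\<^sub>R w))"
    unfolding completion_def by (simp add: scale)
  then show "vscale (completion V) a (represents w) = represents (a *\<^sub>R w)"
    by (simp add: represents_nonempty)
  have lim: "(\<lambda>n. vnorm V (\<sigma> n)) \<longlonglongrightarrow> r w" if \<sigma>: "\<sigma> \<in> represents w" for \<sigma>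
    using tendsto[OF representsD(2)[OF \<sigma>]] by (simp add: \<iota>_norm representsD(1)[OF \<sigma>])
  obtain \<sigma> where \<sigma>: "\<sigma> \<in> represents w" using represents_nonempty by blast
  have "(THE l. \<forall>\<sigma>\<in>represents w. (\<lambda>n. vnorm V (\<sigma> n)) \<longlonglongrightarrow> l) = r w"
  proof (rule the_equality)
    show "\<forall>\<sigma>\<in>represents w. (\<lambda>n. vnorm V (\<sigma> n)) \<longlonglongrightarrow> r w" using lim by blast
    fix l assume "\<forall>\<sigma>\<in>represents w. (\<lambda>n. vnorm V (\<sigma> n)) \<longlonglongrightarrow> l"
    then have "(\<lambda>n. vnorm V (\<sigma> n)) \<longlonglongrightarrow> l" using \<sigma> by blast
    then show "l = r w" using LIMSEQ_unique lim[OF \<sigma>] by blast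
  qed
  then show "vnorm (completion V) (represents w) = r w"
    by (simp add: completion_def)
qed

theorem isometric_iso_completion: "isometric_iso (renormed r) (completion V) represents"
proof -
  have "inj represents"
    using represents_unique represents_nonempty by (intro injI) blast
  then show ?thesis
    by (simp add: isometric_iso_def completion_simps bij_betw_def)
qed

end

section \<open>The norms on the plane and their iteration\<close>

lemma power_tangent_le:
  fixes x y :: real
  assumes "0 \<le> x" "0 \<le> y"
  shows "x ^ Suc k + real (Suc k) * x ^ k * (y - x) \<le> y ^ Suc k"
proof (induction k)
  case (Suc k)
  let ?n = "real (Suc k)"
  have "x ^ Suc (Suc k) + real (Suc (Suc k)) * x ^ Suc k * (y - x)
      \<le> y * (x ^ Suc k + ?n * x ^ k * (y - x))"
  proof -
    have "y * (x ^ Suc k + ?n * x ^ k * (y - x))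
        - (x ^ Suc (Suc k) + real (Suc (Suc k)) * x ^ Suc k * (y - x))
        = ?n * x ^ k * (y - x)\<^sup>2"
      by (simp add: algebra_simps power2_eq_square)
    moreover have "0 \<le> ?n * x ^ k * (y - x)\<^sup>2"
      using assms by simp
    ultimately show ?thesis by linarith
  qed
  also have "\<dots> \<le> y * y ^ Suc k"
    using Suc assms by (intro mult_left_mono)
  finally show ?case by simp
qed simp

lemma power_increment_mono:
  fixes w r d :: real
  assumes "0 \<le> w" "w \<le> r" "0 \<le> d"
  shows "(w + d) ^ n - w ^ n \<le> (r + d) ^ n - r ^ n"
proof (induction n)
  case (Suc n)
  have "(w + d) ^ Suc n - w ^ Suc n = (w + d) * ((w + d) ^ n - w ^ n) + d * w ^ n"
    by (simp add: algebra_simps)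
  also have "\<dots> \<le> (r + d) * ((r + d) ^ n - r ^ n) + d * r ^ n"
  proof (rule add_mono)
    have "0 \<le> (w + d) ^ n - w ^ n"
      using assms power_mono[of w "w + d" n] by simp
    then show "(w + d) * ((w + d) ^ n - w ^ n) \<le> (r + d) * ((r + d) ^ n - r ^ n)"
      using Suc assms by (intro mult_mono) auto
    show "d * w ^ n \<le> d * r ^ n"
      using assms by (intro mult_left_mono power_mono)
  qed
  also have "\<dots> = (r + d) ^ Suc n - r ^ Suc n"
    by (simp add: algebra_simps)
  finally show ?case .
qed simp

locale norm_parameter =
  fixes c :: real
  assumes c_pos: "0 < c" and c_less_1: "c < 1"
begin

text \<open>
  The radicand of \<^const>\<open>Nc\<close>, a convex function that is homogeneous of degree \<open>2 * n\<close>.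
\<close>
definition Nc_pow :: "nat \<Rightarrow> real \<Rightarrow> real \<Rightarrow> real" where
  "Nc_pow n s t = (1 - c ^ (2 * n)) * \<bar>t\<bar> ^ (2 * n) + (s\<^sup>2 + c\<^sup>2 * t\<^sup>2) ^ n"

lemma c_power_le_1: "c ^ m \<le> 1"
  using c_pos c_less_1 by (simp add: power_le_one)

lemma Nc_pow_nonneg: "0 \<le> Nc_pow n s t"
  unfolding Nc_pow_def using c_power_le_1 by (intro add_nonneg_nonneg mult_nonneg_nonneg) auto

lemma Nc_power: "n \<ge> 1 \<Longrightarrow> Nc c n s t ^ (2 * n) = Nc_pow n s t"
  using Nc_pow_nonneg[of n s t] unfolding Nc_def Nc_pow_def by (intro real_root_pow_pos2) auto

lemmas Nc_nonneg = Nc_nonneg[OF c_pos c_less_1]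

lemma Nc_le_iff:
  assumes "n \<ge> 1" "0 \<le> b"
  shows "Nc c n s t \<le> b \<longleftrightarrow> Nc_pow n s t \<le> b ^ (2 * n)"
  using assms Nc_nonneg[of n s t] Nc_power[of n s t] power_mono_iff[of "Nc c n s t" b "2 * n"]
  by simp

lemma Nc_mono:
  assumes "n \<ge> 1" "0 \<le> s" "s \<le> s'" "\<bar>t\<bar> \<le> \<bar>t'\<bar>"
  shows "Nc c n s t \<le> Nc c n s' t'"
proof -
  have sq: "s\<^sup>2 \<le> s'\<^sup>2" "t\<^sup>2 \<le> t'\<^sup>2"
    using assms by (simp_all add: abs_le_square_iff power_mono)
  have "(s\<^sup>2 + c\<^sup>2 * t\<^sup>2) ^ n \<le> (s'\<^sup>2 + c\<^sup>2 * t'\<^sup>2) ^ n"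
    by (rule power_mono) (simp_all add: add_mono mult_left_mono sq)
  moreover have "(1 - c ^ (2 * n)) * \<bar>t\<bar> ^ (2 * n) \<le> (1 - c ^ (2 * n)) * \<bar>t'\<bar> ^ (2 * n)"
    by (intro mult_left_mono power_mono) (use assms c_power_le_1 in auto)
  ultimately have "Nc_pow n s t \<le> Nc_pow n s' t'"
    unfolding Nc_pow_def by linarith
  then show ?thesis
    using assms(1) by (simp add: Nc_le_iff Nc_nonneg Nc_power)
qed

lemma Nc_scale:
  assumes "n \<ge> 1" "0 \<le> a"
  shows "Nc c n (a * s) (a * t) = a * Nc c n s t"
proof -
  have eq: "(a * s)\<^sup>2 + c\<^sup>2 * (a * t)\<^sup>2 = a\<^sup>2 * (s\<^sup>2 + c\<^sup>2 * t\<^sup>2)"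
    by (simp add: power_mult_distrib algebra_simps)
  have "\<bar>a * t\<bar> ^ (2 * n) = a ^ (2 * n) * \<bar>t\<bar> ^ (2 * n)"
    using assms(2) by (simp add: abs_mult power_mult_distrib)
  moreover have "(a\<^sup>2 * (s\<^sup>2 + c\<^sup>2 * t\<^sup>2)) ^ n = a ^ (2 * n) * (s\<^sup>2 + c\<^sup>2 * t\<^sup>2) ^ n"
    by (simp only: power_mult_distrib power_mult)
  ultimately have "Nc_pow n (a * s) (a * t) = a ^ (2 * n) * Nc_pow n s t"
    unfolding Nc_pow_def eq by (simp only: distrib_left mult.left_commute)
  then have "Nc c n (a * s) (a * t) ^ (2 * n) = (a * Nc c n s t) ^ (2 * n)"
    using assms(1) by (simp add: Nc_power power_mult_distrib)
  then show ?thesis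
    by (rule power_eq_imp_eq_base) (use assms Nc_nonneg in auto)
qed

lemma Nc_zero_left: "n \<ge> 1 \<Longrightarrow> Nc c n 0 t = \<bar>t\<bar>"
proof -
  assume n: "n \<ge> 1"
  have "(c\<^sup>2 * t\<^sup>2) ^ n = c ^ (2 * n) * \<bar>t\<bar> ^ (2 * n)"
    by (simp add: power_mult_distrib power_mult)
  then have "Nc_pow n 0 t = \<bar>t\<bar> ^ (2 * n)"
    by (simp add: Nc_pow_def algebra_simps)
  then show ?thesis
    unfolding Nc_power[OF n, symmetric]
    by (rule power_eq_imp_eq_base) (use n Nc_nonneg in auto)
qed

lemma Nc_ge_left: "n \<ge> 1 \<Longrightarrow> 0 \<le> s \<Longrightarrow> s \<le> Nc c n s t"
  using Nc_mono[of n s s 0 t] by (simp add: Nc_zero_right)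

lemma Nc_eq_0D:
  assumes "n \<ge> 1" "0 \<le> s" "Nc c n s t = 0"
  shows "s = 0" "t = 0"
  using Nc_ge_left[OF assms(1,2), of t] Nc_mono[of n 0 s t t] assms by (auto simp: Nc_zero_left)

text \<open>
  A supporting functional at \<open>(s0, t0)\<close> is a multiple of the gradient of the radicand.  By convexity the
  radicand lies above its tangent plane, and by Euler's identity the gradient at \<open>(s0, t0)\<close> pairs with
  \<open>(s0, t0)\<close> to \<open>2 * n\<close> times the radicand; so on the sphere through \<open>(s0, t0)\<close> the pairing is largest
  there.  The triangle inequality and the norming functionals of the iterated norms both come from here.
\<close>
lemma Nc_norming:
  assumes n: "n \<ge> 1" and s0: "0 \<le> s0" and t0: "0 \<le> t0"
  obtains \<alpha> \<beta> where "0 \<le> \<alpha>" "0 \<le> \<beta>" "\<alpha> * s0 + \<beta> * t0 = Nc c n s0 t0"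
    and "\<And>s t. 0 \<le> s \<Longrightarrow> 0 \<le> t \<Longrightarrow> \<alpha> * s + \<beta> * t \<le> Nc c n s t"
proof (cases "Nc c n s0 t0 = 0")
  case True
  then show ?thesis
    using that[of 0 0] Nc_nonneg by simp
next
  case False
  then have N0: "0 < Nc c n s0 t0"
    using Nc_nonneg[of n s0 t0] by linarith
  obtain k where k: "n = Suc k" using n by (cases n) auto
  define R where "R = s0\<^sup>2 + c\<^sup>2 * t0\<^sup>2"
  define d where "d = 1 - c ^ (2 * n)"
  have R: "0 \<le> R" and d: "0 \<le> d"
    using c_power_le_1 by (auto simp: R_def d_def)
  \<comment> \<open>\<open>(a, b)\<close> is the gradient of the radicand at \<open>(s0, t0)\<close>, divided by \<open>2 * n\<close>.\<close>
  define a where "a = s0 * R ^ k"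
  define b where "b = d * t0 ^ (2 * k + 1) + c\<^sup>2 * t0 * R ^ k"
  let ?F0 = "Nc_pow n s0 t0"
  have F: "Nc_pow n s t = d * t ^ (2 * k + 2) + (s\<^sup>2 + c\<^sup>2 * t\<^sup>2) ^ Suc k" if "0 \<le> t" for s t
    using that by (simp add: Nc_pow_def d_def k)
  have ab0: "a * s0 + b * t0 = ?F0"
  proof -
    have "a * s0 + b * t0 = d * t0 ^ (2 * k + 2) + (s0\<^sup>2 + c\<^sup>2 * t0\<^sup>2) * R ^ k"
      by (simp add: a_def b_def algebra_simps power2_eq_square)
    then show ?thesis by (simp add: F[OF t0] R_def)
  qed
  have tangent: "2 * real n * (a * s + b * t) \<le> Nc_pow n s t + (2 * real n - 1) * ?F0"
    if "0 \<le> s" and t: "0 \<le> t" for s t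
  proof -
    let ?r = "s\<^sup>2 + c\<^sup>2 * t\<^sup>2"
    have 1: "t0 ^ (2 * k + 2) + 2 * real n * t0 ^ (2 * k + 1) * (t - t0) \<le> t ^ (2 * k + 2)"
      using power_tangent_le[OF t0 t, of "2 * k + 1"] by (simp add: k algebra_simps)
    have 2: "R ^ Suc k + real n * R ^ k * (?r - R) \<le> ?r ^ Suc k"
      using power_tangent_le[OF R, of ?r k] by (simp add: k)
    have "0 \<le> (s - s0)\<^sup>2 + c\<^sup>2 * (t - t0)\<^sup>2" by simp
    then have "2 * (s0 * s + c\<^sup>2 * t0 * t - R) \<le> ?r - R"
      by (simp add: R_def power2_eq_square algebra_simps)
    then have 3: "real n * R ^ k * (2 * (s0 * s + c\<^sup>2 * t0 * t - R)) \<le> real n * R ^ k * (?r - R)"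
      using R by (intro mult_left_mono) auto
    have "d * (t0 ^ (2 * k + 2) + 2 * real n * t0 ^ (2 * k + 1) * (t - t0)) \<le> d * t ^ (2 * k + 2)"
      using 1 d by (rule mult_left_mono)
    then have "d * (t0 ^ (2 * k + 2) + 2 * real n * t0 ^ (2 * k + 1) * (t - t0))
        + (R ^ Suc k + real n * R ^ k * (2 * (s0 * s + c\<^sup>2 * t0 * t - R))) \<le> Nc_pow n s t"
      using 2 3 unfolding F[OF t] by linarith
    moreover have "d * (t0 ^ (2 * k + 2) + 2 * real n * t0 ^ (2 * k + 1) * (t - t0))
        + (R ^ Suc k + real n * R ^ k * (2 * (s0 * s + c\<^sup>2 * t0 * t - R)))
        = 2 * real n * (a * s + b * t) - (2 * real n - 1) * (d * t0 ^ (2 * k + 2) + R ^ Suc k)"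
      unfolding a_def b_def by (simp add: algebra_simps)
    ultimately show ?thesis by (simp add: F[OF t0] R_def)
  qed
  have F0: "?F0 = Nc c n s0 t0 ^ (2 * n)" using n by (simp add: Nc_power)
  then have F0_pos: "0 < ?F0" using N0 by simp
  define q where "q = Nc c n s0 t0 / ?F0"
  have q: "0 < q" using N0 F0_pos by (simp add: q_def)
  have a0: "0 \<le> a" and b0: "0 \<le> b"
    using s0 t0 R d by (auto simp: a_def b_def)
  show ?thesis
  proof (rule that[of "q * a" "q * b"])
    show "0 \<le> q * a" "0 \<le> q * b" using q a0 b0 by auto
    have "q * a * s0 + q * b * t0 = q * (a * s0 + b * t0)" by (simp add: algebra_simps)
    then show "q * a * s0 + q * b * t0 = Nc c n s0 t0"
      using F0_pos by (simp add: ab0 q_def)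
    fix s t :: real assume s: "0 \<le> s" and t: "0 \<le> t"
    show "q * a * s + q * b * t \<le> Nc c n s t"
    proof (cases "Nc c n s t = 0")
      case True
      then have "s = 0" "t = 0" using Nc_eq_0D[OF n s] by blast+
      then show ?thesis using Nc_nonneg[of n 0 0] by simp
    next
      case False
      then have N: "0 < Nc c n s t" using Nc_nonneg[of n s t] by linarith
      \<comment> \<open>\<open>l\<close> rescales \<open>(s, t)\<close> to the sphere through \<open>(s0, t0)\<close>.\<close>
      define l where "l = Nc c n s0 t0 / Nc c n s t"
      have l: "0 < l" using N N0 by (simp add: l_def)
      have "Nc c n (l * s) (l * t) = Nc c n s0 t0"
        using Nc_scale[OF n, of l s t] l N by (simp add: l_def)
      then have "Nc_pow n (l * s) (l * t) = ?F0"
        by (simp only: Nc_power[OF n, symmetric])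
      then have "2 * real n * (a * (l * s) + b * (l * t)) \<le> 2 * real n * ?F0"
        using tangent[of "l * s" "l * t"] l s t by (simp add: algebra_simps)
      then have "a * (l * s) + b * (l * t) \<le> ?F0"
        using n by simp
      then have "l * (a * s + b * t) \<le> ?F0" by (simp add: algebra_simps)
      then have "a * s + b * t \<le> ?F0 / l"
        using l by (simp add: field_simps)
      then have "q * (a * s + b * t) \<le> q * (?F0 / l)"
        using q by (intro mult_left_mono) auto
      also have "\<dots> = Nc c n s t"
        using N0 N F0_pos by (simp add: q_def l_def)
      finally show ?thesis by (simp add: algebra_simps)
    qed
  qed
qed

text \<open>
  Write \<open>R\<close> for the squared norm at \<open>s\<close> and \<open>w = s\<^sup>2 + c\<^sup>2 t\<^sup>2\<close>.  Then \<open>R\<^sup>n - w\<^sup>n\<close> does not depend on \<open>s\<close>, and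
  \<open>w \<le> R\<close>; as powers grow faster at larger arguments, raising \<open>s\<^sup>2\<close>, hence \<open>w\<close>, by \<open>d\<close> raises \<open>R\<close> by at most
  \<open>d\<close>.  This is the source of the upper 2-estimate for \<open>X\<^sub>c\<close>.
\<close>
lemma Nc_square_increment:
  assumes n: "n \<ge> 1" and s: "0 \<le> s" "s \<le> s'"
  shows "(Nc c n s' t)\<^sup>2 - s'\<^sup>2 \<le> (Nc c n s t)\<^sup>2 - s\<^sup>2"
proof -
  let ?w = "s\<^sup>2 + c\<^sup>2 * t\<^sup>2" and ?R = "(Nc c n s t)\<^sup>2" and ?d = "s'\<^sup>2 - s\<^sup>2"
  let ?A = "(1 - c ^ (2 * n)) * \<bar>t\<bar> ^ (2 * n)"
  have A: "0 \<le> ?A" using c_power_le_1 by simp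
  have d: "0 \<le> ?d" using s by (simp add: power_mono)
  have R: "?R ^ n = ?A + ?w ^ n"
    using Nc_power[OF n, of s t] by (simp add: Nc_pow_def power_mult)
  then have "?w ^ n \<le> ?R ^ n" using A by linarith
  then have "?w \<le> ?R"
    using n by (subst (asm) power_mono_iff) auto
  then have "(?w + ?d) ^ n - ?w ^ n \<le> (?R + ?d) ^ n - ?R ^ n"
    using d by (intro power_increment_mono) auto
  then have "?A + (?w + ?d) ^ n \<le> (?R + ?d) ^ n"
    using R by linarith
  moreover have "((Nc c n s' t)\<^sup>2) ^ n = ?A + (?w + ?d) ^ n"
  proof -
    have "?w + ?d = s'\<^sup>2 + c\<^sup>2 * t\<^sup>2" by simp
    then show ?thesis
      using Nc_power[OF n, of s' t] unfolding Nc_pow_def power_mult by (simp only:)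
  qed
  ultimately have "((Nc c n s' t)\<^sup>2) ^ n \<le> (?R + ?d) ^ n" by simp
  then have "(Nc c n s' t)\<^sup>2 \<le> ?R + ?d"
    using n d by (subst (asm) power_mono_iff) auto
  then show ?thesis by linarith
qed

lemma Nc_square_le: "n \<ge> 1 \<Longrightarrow> 0 \<le> s \<Longrightarrow> (Nc c n s t)\<^sup>2 \<le> s\<^sup>2 + t\<^sup>2"
  using Nc_square_increment[of n 0 s t] by (simp add: Nc_zero_left)

lemma Nc_square_ge:
  assumes n: "n \<ge> 1"
  shows "s\<^sup>2 + c\<^sup>2 * t\<^sup>2 \<le> (Nc c n s t)\<^sup>2"
proof -
  have "(s\<^sup>2 + c\<^sup>2 * t\<^sup>2) ^ n \<le> Nc_pow n s t"
    unfolding Nc_pow_def using c_power_le_1 by simp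
  also have "\<dots> = ((Nc c n s t)\<^sup>2) ^ n"
    using Nc_power[OF n, of s t] by (simp add: power_mult)
  finally show ?thesis
    using n by (subst (asm) power_mono_iff) auto
qed

abbreviation M :: "nat \<Rightarrow> (nat \<Rightarrow> real) \<Rightarrow> real" where
  "M \<equiv> iterated_norm (Nc c)"

lemma M_nonneg: "0 \<le> M n x"
  by (cases n) (simp_all add: Nc_nonneg)

lemma M_mono:
  assumes "\<And>j. j \<le> n \<Longrightarrow> \<bar>x j\<bar> \<le> \<bar>y j\<bar>"
  shows "M n x \<le> M n y"
  using assms
proof (induction n)
  case (Suc n)
  then show ?case
    unfolding iterated_norm.simps by (intro Nc_mono) (auto simp: M_nonneg)
qed simp

lemma M_cong: "(\<And>j. j \<le> n \<Longrightarrow> x j = y j) \<Longrightarrow> M n x = M n y"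
  by (intro order_antisym M_mono) auto

lemma M_le_Suc: "M n x \<le> M (Suc n) x"
  by (simp add: Nc_ge_left M_nonneg)

lemma M_incseq: "m \<le> n \<Longrightarrow> M m x \<le> M n x"
  using lift_Suc_mono_le[of "\<lambda>n. M n x"] M_le_Suc by blast

lemma M_scale: "M n (\<lambda>j. a * x j) = \<bar>a\<bar> * M n x"
  by (induction n) (simp_all add: abs_mult Nc_scale)

lemma M_stable:
  assumes "\<And>j. j > m \<Longrightarrow> x j = 0" "m \<le> n"
  shows "M n x = M m x"
  using iterated_norm_eq[of "Nc c" m x "n - m"] assms by (simp add: Nc_zero_right Nc_nonneg)

text \<open>
  Norming functionals compose along the iteration: combine one for the first coordinates with a
  supporting functional \<open>(\<alpha>, \<beta>)\<close> of the plane norm.  Nonnegativity of \<open>\<alpha>\<close> keeps the combination below the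
  norm.
\<close>
lemma M_norming:
  "\<exists>y. (\<Sum>j\<le>n. x j * y j) = M n x \<and> (\<forall>z. (\<Sum>j\<le>n. z j * y j) \<le> M n z)"
proof (induction n)
  case 0
  have "z * sgn (x 0) \<le> \<bar>z\<bar>" for z :: real
    by (auto simp: sgn_if)
  then show ?case
    by (intro exI[of _ "\<lambda>_. sgn (x 0)"]) (simp add: abs_sgn)
next
  case (Suc n)
  then obtain y where y: "(\<Sum>j\<le>n. x j * y j) = M n x" "\<And>z. (\<Sum>j\<le>n. z j * y j) \<le> M n z"
    by blast
  obtain \<alpha> \<beta> where ab: "0 \<le> \<alpha>" "0 \<le> \<beta>"
    "\<alpha> * M n x + \<beta> * \<bar>x (Suc n)\<bar> = Nc c (Suc n) (M n x) \<bar>x (Suc n)\<bar>"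
    "\<And>s t. 0 \<le> s \<Longrightarrow> 0 \<le> t \<Longrightarrow> \<alpha> * s + \<beta> * t \<le> Nc c (Suc n) s t"
    using Nc_norming[of "Suc n" "M n x" "\<bar>x (Suc n)\<bar>"] M_nonneg by auto
  let ?y = "\<lambda>j. if j \<le> n then \<alpha> * y j else \<beta> * sgn (x (Suc n))"
  have sum: "(\<Sum>j\<le>Suc n. z j * ?y j) = \<alpha> * (\<Sum>j\<le>n. z j * y j) + \<beta> * (z (Suc n) * sgn (x (Suc n)))" for z
    by (simp add: sum_distrib_left algebra_simps)
  have "(\<Sum>j\<le>Suc n. z j * ?y j) \<le> M (Suc n) z" for z
  proof -
    have "z (Suc n) * sgn (x (Suc n)) \<le> \<bar>z (Suc n)\<bar>"
      by (auto simp: sgn_if)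
    then have "(\<Sum>j\<le>Suc n. z j * ?y j) \<le> \<alpha> * M n z + \<beta> * \<bar>z (Suc n)\<bar>"
      unfolding sum by (intro add_mono mult_left_mono y ab)
    also have "\<dots> \<le> M (Suc n) z"
      using ab(4)[OF M_nonneg] by simp
    finally show ?thesis .
  qed
  moreover have "(\<Sum>j\<le>Suc n. x j * ?y j) = M (Suc n) x"
    unfolding sum y(1) using ab(3) by (simp add: abs_sgn)
  ultimately show ?case
    by (intro exI[of _ ?y] conjI allI)
qed

lemma M_triangle: "M n (\<lambda>j. x j + z j) \<le> M n x + M n z"
proof -
  obtain y where y: "(\<Sum>j\<le>n. (x j + z j) * y j) = M n (\<lambda>j. x j + z j)"
    "\<And>z. (\<Sum>j\<le>n. z j * y j) \<le> M n z"
    using M_norming[of "\<lambda>j. x j + z j" n] by blast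
  have "(\<Sum>j\<le>n. (x j + z j) * y j) = (\<Sum>j\<le>n. x j * y j) + (\<Sum>j\<le>n. z j * y j)"
    by (simp add: algebra_simps sum.distrib)
  then show ?thesis using y(1) y(2)[of x] y(2)[of z] by linarith
qed

lemma M_square_le: "(M n x)\<^sup>2 \<le> (\<Sum>j\<le>n. (x j)\<^sup>2)"
proof (induction n)
  case (Suc n)
  then show ?case
    using Nc_square_le[of "Suc n" "M n x" "\<bar>x (Suc n)\<bar>"] by (simp add: M_nonneg)
qed simp

lemma M_square_ge: "c\<^sup>2 * (\<Sum>j\<le>n. (x j)\<^sup>2) \<le> (M n x)\<^sup>2"
proof (induction n)
  case 0
  have "c\<^sup>2 * (x 0)\<^sup>2 \<le> 1 * (x 0)\<^sup>2"
    using c_power_le_1[of 2] by (intro mult_right_mono) auto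
  then show ?case by simp
next
  case (Suc n)
  then show ?case
    using Nc_square_ge[of "Suc n" "M n x" "\<bar>x (Suc n)\<bar>"] by (simp add: algebra_simps)
qed

text \<open>The iteration enters the first coordinates only through the value of \<open>M m\<close>.\<close>
lemma M_replace_head:
  assumes "M m x \<le> M m y" "\<And>j. j > m \<Longrightarrow> x j = y j" "m \<le> n"
  shows "M n x \<le> M n y"
  using \<open>m \<le> n\<close>
proof (induction n rule: dec_induct)
  case (step n)
  then show ?case
    unfolding iterated_norm.simps using assms(2) by (intro Nc_mono) (auto simp: M_nonneg)
qed (rule assms)

text \<open>
  By \<open>Nc_square_increment\<close> the difference \<open>(M n x)\<^sup>2 - (M n v)\<^sup>2\<close> decreases in \<open>n\<close>; at \<open>n = m\<close> it is
  \<open>(M m x)\<^sup>2\<close>, since \<open>v\<close> vanishes so far.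
\<close>
lemma M_square_split:
  assumes "\<And>j. j > m \<Longrightarrow> v j = x j" "\<And>j. j \<le> m \<Longrightarrow> v j = 0" "m \<le> n"
  shows "(M n x)\<^sup>2 \<le> (M m x)\<^sup>2 + (M n v)\<^sup>2"
  using \<open>m \<le> n\<close>
proof (induction n rule: dec_induct)
  case (step n)
  have "M n v \<le> M n x"
  proof (rule M_mono)
    show "\<bar>v j\<bar> \<le> \<bar>x j\<bar>" for j
      by (cases "j \<le> m") (simp_all add: assms)
  qed
  then show ?case
    using Nc_square_increment[of "Suc n" "M n v" "M n x" "\<bar>x (Suc n)\<bar>"] step assms(1)[of "Suc n"]
    by (simp add: M_nonneg)
qed simp

end

section \<open>Failure of the weak maximizing property for the space itself\<close>

text \<open>
  A diagonal operator whose entries increase to 1 without reaching it, and which kills the zeroth unit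
  vector.
\<close>
lift_definition shrink :: "ltwo \<Rightarrow> ltwo" is "\<lambda>x j. real j / real (Suc j) * x j"
proof -
  fix x :: "nat \<Rightarrow> real"
  assume x: "summable (\<lambda>j. (x j)\<^sup>2)"
  have "(real j / real (Suc j) * x j)\<^sup>2 \<le> 1 * (x j)\<^sup>2" for j
    unfolding power_mult_distrib by (intro mult_right_mono power_le_one) auto
  then show "summable (\<lambda>j. (real j / real (Suc j) * x j)\<^sup>2)"
    using x by (intro summable_comparison_test'[OF x, of 0]) auto
qed

lemma coord_shrink [simp]: "coord (shrink x) j = real j / real (Suc j) * coord x j"
  by (simp add: shrink.rep_eq)

lemma abs_coord_shrink_le: "\<bar>coord (shrink x) j\<bar> \<le> \<bar>coord x j\<bar>"
proof -
  have "real j / real (Suc j) * \<bar>coord x j\<bar> \<le> 1 * \<bar>coord x j\<bar>"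
    by (intro mult_right_mono) auto
  then show ?thesis by (simp add: abs_mult)
qed

lemma bounded_linear_shrink: "bounded_linear shrink"
proof (rule bounded_linear_intro)
  show "shrink (x + y) = shrink x + shrink y" "shrink (a *\<^sub>R x) = a *\<^sub>R shrink x" for x y a
    by (rule ltwo_eqI; simp add: algebra_simps add_divide_distrib)+
  show "norm (shrink x) \<le> norm x * 1" for x
    using norm_mono_coord[OF abs_coord_shrink_le] by simp
qed

context norm_parameter
begin

text \<open>
  The norm of \<open>X\<^sub>c\<close> on square summable sequences.  The supremum is a limit, as \<open>M n\<close> increases with \<open>n\<close>.
\<close>
definition X_norm :: "ltwo \<Rightarrow> real" where "X_norm x = (SUP n. M n (coord x))"

lemma M_le_norm: "M n (coord x) \<le> norm x"
proof -
  have "(M n (coord x))\<^sup>2 \<le> (norm x)\<^sup>2"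
    using M_square_le[of n "coord x"] sum_coord_square_le[of x n] by linarith
  then show ?thesis by (rule power2_le_imp_le) simp
qed

lemma M_tendsto_X_norm: "(\<lambda>n. M n (coord x)) \<longlonglongrightarrow> X_norm x"
  unfolding X_norm_def using M_le_norm M_incseq
  by (intro LIMSEQ_incseq_SUP bdd_aboveI2[where M="norm x"]) (auto simp: incseq_def)

lemma M_le_X_norm: "M n (coord x) \<le> X_norm x"
  by (rule incseq_le[OF _ M_tendsto_X_norm]) (simp add: incseq_def M_incseq)

lemma X_norm_le: "(\<And>n. n \<ge> m \<Longrightarrow> M n (coord x) \<le> K) \<Longrightarrow> X_norm x \<le> K"
  by (rule LIMSEQ_le_const2[OF M_tendsto_X_norm]) blast

lemma X_norm_finite:
  assumes "\<And>j. j > m \<Longrightarrow> coord x j = 0"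
  shows "X_norm x = M m (coord x)"
proof (rule antisym)
  show "X_norm x \<le> M m (coord x)"
    by (rule X_norm_le[of m], rule eq_refl, rule M_stable) (use assms in auto)
qed (rule M_le_X_norm)

lemma X_norm_mono: "(\<And>j. \<bar>coord x j\<bar> \<le> \<bar>coord y j\<bar>) \<Longrightarrow> X_norm x \<le> X_norm y"
  by (intro X_norm_le[of 0] order_trans[OF M_mono M_le_X_norm])

lemma X_norm_equivalent_norm: "equivalent_norm X_norm c 1"
proof
  fix x y :: ltwo and a :: real
  show "0 < c" "0 < (1::real)" by (simp_all add: c_pos)
  show "X_norm x \<le> 1 * norm x" using X_norm_le[of 0 x "norm x"] M_le_norm by simp
  have p0: "0 \<le> X_norm x" using M_le_X_norm[of 0 x] M_nonneg[of 0 "coord x"] by linarith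
  have "norm x \<le> X_norm x / c"
  proof (rule norm_ltwo_le)
    fix n
    have "c\<^sup>2 * (\<Sum>j\<le>n. (coord x j)\<^sup>2) \<le> (M n (coord x))\<^sup>2" by (rule M_square_ge)
    also have "\<dots> \<le> (X_norm x)\<^sup>2" by (intro power_mono M_le_X_norm M_nonneg)
    finally show "(\<Sum>j\<le>n. (coord x j)\<^sup>2) \<le> (X_norm x / c)\<^sup>2"
      using c_pos by (simp add: power_divide field_simps)
  qed (use p0 c_pos in simp)
  then show "c * norm x \<le> X_norm x" using c_pos by (simp add: field_simps)
  have "M n (coord (x + y)) \<le> M n (coord x) + M n (coord y)" for n
    using M_triangle[of n "coord x" "coord y"] by (simp add: plus_ltwo.rep_eq)
  then show "X_norm (x + y) \<le> X_norm x + X_norm y"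
    by (intro X_norm_le[of 0] order_trans[OF _ add_mono[OF M_le_X_norm M_le_X_norm]])
  have "(\<lambda>n. M n (coord (a *\<^sub>R x))) \<longlonglongrightarrow> \<bar>a\<bar> * X_norm x"
    unfolding scaleR_ltwo.rep_eq M_scale by (intro tendsto_intros M_tendsto_X_norm)
  then show "X_norm (a *\<^sub>R x) = \<bar>a\<bar> * X_norm x"
    using LIMSEQ_unique M_tendsto_X_norm by blast
qed

sublocale X: equivalent_norm X_norm c 1 by (rule X_norm_equivalent_norm)

sublocale X: successive_upper_estimate X_norm c 1
proof
  fix m u u' v x
  have M_head: "M m (coord (head m u + tail m v)) = X_norm (head m u)" for u v
    by (subst X_norm_finite[of m]) (auto intro: M_cong)
  show "X_norm (head m x) \<le> X_norm x" "X_norm (tail m x) \<le> X_norm x"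
    by (rule X_norm_mono; simp)+
  show "X_norm (head m u + tail m v) \<le> X_norm (head m u' + tail m v)" if "X_norm (head m u) \<le> X_norm (head m u')"
    using that
    by (intro X_norm_le[of m] order_trans[OF M_replace_head[of m] M_le_X_norm]) (auto simp: M_head)
  have "(M n (coord (head m u + tail m v)))\<^sup>2 \<le> (X_norm (head m u))\<^sup>2 + (X_norm (tail m v))\<^sup>2" if "n \<ge> m" for n
  proof -
    have "(M n (coord (head m u + tail m v)))\<^sup>2
        \<le> (M m (coord (head m u + tail m v)))\<^sup>2 + (M n (coord (tail m v)))\<^sup>2"
      using that by (intro M_square_split) auto
    also have "\<dots> \<le> (X_norm (head m u))\<^sup>2 + (X_norm (tail m v))\<^sup>2"
      unfolding M_head by (intro add_left_mono power_mono M_le_X_norm M_nonneg)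
    finally show ?thesis .
  qed
  then have "X_norm (head m u + tail m v) \<le> sqrt ((X_norm (head m u))\<^sup>2 + (X_norm (tail m v))\<^sup>2)"
    by (intro X_norm_le[of m] real_le_rsqrt)
  then have "(X_norm (head m u + tail m v))\<^sup>2 \<le> (sqrt ((X_norm (head m u))\<^sup>2 + (X_norm (tail m v))\<^sup>2))\<^sup>2"
    by (rule power_mono) (rule X.nonneg)
  then show "(X_norm (head m u + tail m v))\<^sup>2 \<le> (X_norm (head m u))\<^sup>2 + (X_norm (tail m v))\<^sup>2" by simp
qed

sublocale X_dual: successive_lower_estimate "dual_norm X_norm" 1 "1 / c"
  using X.successive_lower_estimate_dual by simp

text \<open>
  The norming functionals of the finite sections \<open>M n\<close> are finitely supported vectors in the dual unit
  ball, and the norm is the supremum of the sections.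
\<close>
theorem X_norm_bidual: "dual_norm (dual_norm X_norm) = X_norm"
proof (rule ext, rule antisym)
  fix x
  show "dual_norm (dual_norm X_norm) x \<le> X_norm x"
  proof (rule X_dual.dual_norm_le)
    fix y assume y: "dual_norm X_norm y \<le> 1"
    have "inner y x \<le> X_norm x * dual_norm X_norm y"
      using X.inner_le[of x y] by (simp add: inner_commute)
    also have "\<dots> \<le> X_norm x" using y X.nonneg[of x] by (simp add: mult_left_le)
    finally show "inner y x \<le> X_norm x" .
  qed
  show "X_norm x \<le> dual_norm (dual_norm X_norm) x"
  proof (rule X_norm_le[of 0])
    fix n
    obtain y where y: "(\<Sum>j\<le>n. coord x j * y j) = M n (coord x)"
      "\<And>z. (\<Sum>j\<le>n. z j * y j) \<le> M n z"
      using M_norming[of "coord x" n] by blast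
    define Y where "Y = (\<Sum>j\<le>n. y j *\<^sub>R unit_vector j)"
    have Y: "inner z Y = (\<Sum>j\<le>n. coord z j * y j)" for z
      by (simp add: Y_def inner_sum_right mult.commute)
    have "dual_norm X_norm Y \<le> 1"
    proof (rule X.dual_norm_le)
      fix z assume "X_norm z \<le> 1"
      then show "inner z Y \<le> 1"
        using y(2)[of "coord z"] M_le_X_norm[of n z] unfolding Y by linarith
    qed
    then have "inner Y x \<le> dual_norm (dual_norm X_norm) x"
      by (rule X_dual.inner_le_dual_norm)
    then show "M n (coord x) \<le> dual_norm (dual_norm X_norm) x"
      by (simp add: inner_commute[of Y] Y y(1))
  qed
qed

text \<open>
  The coefficient is the largest one for which \<open>max 1 (sqrt (a\<^sup>2 + c\<^sup>2))\<close>, the limit of the plane norms at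
  \<open>(a, 1)\<close>, is still 1.
\<close>
definition bump :: "nat \<Rightarrow> ltwo" where
  "bump k = sqrt (1 - c\<^sup>2) *\<^sub>R unit_vector 0 + unit_vector (Suc k)"

lemma X_norm_two_coordinates:
  "X_norm (a *\<^sub>R unit_vector 0 + b *\<^sub>R unit_vector (Suc k)) = Nc c (Suc k) \<bar>a\<bar> \<bar>b\<bar>"
proof -
  let ?x = "a *\<^sub>R unit_vector 0 + b *\<^sub>R unit_vector (Suc k)"
  have "M k (coord ?x) = M k (\<lambda>j. if j = 0 then a else 0)"
    by (rule M_cong) auto
  also have "\<dots> = \<bar>a\<bar>"
    using M_stable[of 0 "\<lambda>j. if j = 0 then a else 0" k] by simp
  finally have "M (Suc k) (coord ?x) = Nc c (Suc k) \<bar>a\<bar> \<bar>b\<bar>" by simp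
  then show ?thesis by (subst X_norm_finite[of "Suc k"]) auto
qed

lemma X_norm_unit_vector_Suc: "X_norm (unit_vector (Suc k)) = 1"
  using X_norm_two_coordinates[of 0 1 k] by (simp add: Nc_zero_left)

lemma X_norm_bump_ge: "1 \<le> X_norm (bump k)"
  and X_norm_bump_tendsto: "(\<lambda>k. X_norm (bump k)) \<longlonglongrightarrow> 1"
proof -
  have c2: "c\<^sup>2 \<le> 1" by (rule c_power_le_1)
  have eq: "X_norm (bump k) = root (2 * Suc k) (2 - c ^ (2 * Suc k))" for k
    using X_norm_two_coordinates[of "sqrt (1 - c\<^sup>2)" 1 k] c2 unfolding bump_def Nc_def by simp
  have "root (2 * Suc k) 1 \<le> root (2 * Suc k) (2 - c ^ (2 * Suc k))" for k
    using c_power_le_1[of "2 * Suc k"] by (intro real_root_le_mono) auto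
  then show ge: "1 \<le> X_norm (bump k)" for k
    using eq[of k] real_root_one[of "2 * Suc k"] by simp
  have le: "X_norm (bump k) \<le> root (2 * Suc k) 2" for k
    unfolding eq using c_pos by (intro real_root_le_mono) auto
  have "(\<lambda>k. root (2 * Suc k) 2) \<longlonglongrightarrow> 1"
  proof (rule filterlim_compose[OF LIMSEQ_root_const])
    show "filterlim (\<lambda>k. 2 * Suc k) sequentially sequentially"
      by (rule filterlim_at_top_mono[OF filterlim_ident]) (simp add: always_eventually)
  qed simp
  then show "(\<lambda>k. X_norm (bump k)) \<longlonglongrightarrow> 1"
    by (rule tendsto_sandwich[OF always_eventually[OF allI[OF ge]]
          always_eventually[OF allI[OF le]] tendsto_const])
qed

text \<open>
  On the coordinates up to \<open>m\<close> the operator contracts by \<open>d = m / (m + 1)\<close> at least, so the image is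
  dominated coordinatewise by \<open>d\<close> times \<open>x\<close> plus \<open>1 - d\<close> times the tail of \<open>x\<close>; and for large \<open>m\<close> the
  tail is shorter than \<open>x\<close>.
\<close>
theorem X_norm_shrink_less:
  assumes "X_norm x = 1"
  shows "X_norm (shrink x) < 1"
proof -
  have "(\<lambda>m. X_norm (tail m x)) \<longlonglongrightarrow> X_norm 0"
    by (intro X.tendsto tail_tendsto_zero)
  then have "\<forall>\<^sub>F m in sequentially. X_norm (tail m x) < 1"
    by (rule order_tendstoD(2)) simp
  then obtain m where m: "X_norm (tail m x) < 1"
    by (auto simp: eventually_sequentially)
  define d where "d = real m / real (Suc m)"
  have d: "0 \<le> d" "d < 1" by (auto simp: d_def)
  have dj: "real j / real (Suc j) \<le> d" if "j \<le> m" for j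
    using that unfolding d_def by (simp add: field_simps)
  have "X_norm (shrink x) \<le> X_norm (d *\<^sub>R x + (1 - d) *\<^sub>R tail m x)"
  proof (rule X_norm_mono)
    fix j
    show "\<bar>coord (shrink x) j\<bar> \<le> \<bar>coord (d *\<^sub>R x + (1 - d) *\<^sub>R tail m x) j\<bar>"
    proof (cases "j \<le> m")
      case True
      then have "real j / real (Suc j) * \<bar>coord x j\<bar> \<le> d * \<bar>coord x j\<bar>"
        using dj by (intro mult_right_mono) auto
      then show ?thesis using True d by (simp add: abs_mult)
    next
      case False
      have "d * coord x j + (1 - d) * coord x j = coord x j" by (simp add: algebra_simps)
      then show ?thesis using False abs_coord_shrink_le[of x j] by simp
    qed
  qed
  also have "\<dots> \<le> d * X_norm x + (1 - d) * X_norm (tail m x)"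
    using X.triangle[of "d *\<^sub>R x" "(1 - d) *\<^sub>R tail m x"] d by (simp add: X.scale)
  also have "\<dots> < d * 1 + (1 - d) * 1"
    unfolding assms using mult_strict_left_mono[OF m, of "1 - d"] d by linarith
  finally show ?thesis by simp
qed

theorem not_weak_maximizing_property_X_norm:
  "\<not> weak_maximizing_property (renormed X_norm) (renormed X_norm)"
proof
  assume wmp: "weak_maximizing_property (renormed X_norm) (renormed X_norm)"
  let ?P = "renormed X_norm"
  interpret S: bounded_linear shrink by (rule bounded_linear_shrink)
  have S: "bounded_operator ?P ?P shrink"
    by (simp add: X.bounded_operator_iff bounded_linear_shrink)
  define z where "z k = (1 / X_norm (bump k)) *\<^sub>R bump k" for k
  have unit: "X_norm (z k) = 1" for k
  proof -
    have "X_norm (z k) = (1 / X_norm (bump k)) * X_norm (bump k)"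
      using X_norm_bump_ge[of k] by (simp only: z_def X.scale) simp
    then show ?thesis using X_norm_bump_ge[of k] by (simp del: X.eq_zero_iff)
  qed
  have "shrink (bump k) = (real (Suc k) / real (Suc (Suc k))) *\<^sub>R unit_vector (Suc k)" for k
    by (rule ltwo_eqI) (simp add: bump_def)
  then have Sz: "X_norm (shrink (z k)) = (1 / X_norm (bump k)) * (real (Suc k) / real (Suc (Suc k)))" for k
    using X_norm_bump_ge[of k] by (simp add: z_def S.scaleR X.scale X_norm_unit_vector_Suc)
  have "(\<lambda>k. (1 / X_norm (bump k)) * (real (Suc k) / real (Suc (Suc k)))) \<longlonglongrightarrow> (1 / 1) * 1"
    by (intro tendsto_intros X_norm_bump_tendsto LIMSEQ_Suc[OF LIMSEQ_n_over_Suc_n]) simp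
  then have lim: "(\<lambda>k. X_norm (shrink (z k))) \<longlonglongrightarrow> 1" by (simp add: Sz)
  have op: "op_norm ?P ?P shrink = 1"
  proof (rule antisym)
    show "op_norm ?P ?P shrink \<le> 1"
    proof (rule op_norm_le[OF X.normed_space])
      show "vnorm ?P (shrink x) \<le> 1 * vnorm ?P x" for x
        using X_norm_mono[OF abs_coord_shrink_le] by simp
    qed simp
    have "X_norm (shrink (z k)) \<le> op_norm ?P ?P shrink" for k
      using le_op_norm[OF S X.normed_space X.normed_space, of "z k"] unit by simp
    then show "1 \<le> op_norm ?P ?P shrink"
      using LIMSEQ_le_const2[OF lim] by blast
  qed
  have "maximizing_sequence ?P ?P shrink z"
    using lim unit by (auto simp: maximizing_sequence_def unit_sphere_def op)
  moreover have "\<not> weakly_null ?P z"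
  proof
    assume "weakly_null ?P z"
    moreover have "(\<lambda>x. inner x (unit_vector 0)) \<in> vcarrier (dual ?P)"
      by (simp add: dual_simps X.bounded_functional_iff bounded_linear_inner_left del: inner_unit_vector)
    ultimately have "(\<lambda>k. inner (z k) (unit_vector 0)) \<longlonglongrightarrow> 0"
      unfolding weakly_null_def by (rule bspec)
    then have 0: "(\<lambda>k. (1 / X_norm (bump k)) * sqrt (1 - c\<^sup>2)) \<longlonglongrightarrow> 0"
      by (simp add: z_def bump_def)
    have "(\<lambda>k. (1 / X_norm (bump k)) * sqrt (1 - c\<^sup>2)) \<longlonglongrightarrow> (1 / 1) * sqrt (1 - c\<^sup>2)"
      by (intro tendsto_intros X_norm_bump_tendsto) simp
    from LIMSEQ_unique[OF this 0] have "sqrt (1 - c\<^sup>2) = 0" by simp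
    then show False using c_pos c_less_1 by (simp add: power2_eq_1_iff)
  qed
  ultimately have "attains_norm ?P ?P shrink"
    using wmp S unfolding weak_maximizing_property_def by blast
  then obtain x where "X_norm x = 1" "X_norm (shrink x) = 1"
    by (auto simp: attains_norm_def unit_sphere_def op)
  then show False using X_norm_shrink_less[of x] by simp
qed

end

section \<open>The space and its dual\<close>
lemma c00_space_simps:
  "vcarrier (c00_space N) = {x. finite {j. x j \<noteq> 0}}"
  "vzero (c00_space N) = (\<lambda>j. 0)"
  "vadd (c00_space N) x y = (\<lambda>j. x j + y j)"
  "vscale (c00_space N) a x = (\<lambda>j. a * x j)"
  by (simp_all add: c00_space_def)

lemma coord_Abs_finite: "finite {j. x j \<noteq> 0} \<Longrightarrow> coord (Abs_ltwo x) = x"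
proof -
  assume "finite {j. x j \<noteq> 0}"
  then have "summable (\<lambda>j. (x j)\<^sup>2)"
    by (rule summable_finite) auto
  then show ?thesis by (simp add: Abs_ltwo_inverse)
qed

context norm_parameter
begin

lemma c00_dense_embedding: "dense_embedding X_norm c 1 (c00_space (Nc c)) Abs_ltwo"
proof -
  let ?V = "c00_space (Nc c)"
  note simps = c00_space_simps coord_Abs_finite
  have add: "finite {j. x j + y j \<noteq> 0}"
    if "finite {j. x j \<noteq> 0}" "finite {j. y j \<noteq> 0}" for x y :: "nat \<Rightarrow> real"
    using that by (intro finite_subset[OF _ finite_UnI[OF that]]) auto
  have scale: "finite {j. a * x j \<noteq> 0}" if "finite {j. x j \<noteq> 0}" for x :: "nat \<Rightarrow> real" and a
    using that by (rule rev_finite_subset) auto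
  have Abs_add: "Abs_ltwo (\<lambda>j. x j + y j) = Abs_ltwo x + Abs_ltwo y"
    if "finite {j. x j \<noteq> 0}" "finite {j. y j \<noteq> 0}" for x y
    by (rule ltwo_eqI) (simp add: coord_Abs_finite that add)
  have Abs_scale: "Abs_ltwo (\<lambda>j. a * x j) = a *\<^sub>R Abs_ltwo x" if "finite {j. x j \<noteq> 0}" for x a
    by (rule ltwo_eqI) (simp add: coord_Abs_finite that scale)
  have Abs_0: "Abs_ltwo (\<lambda>j. 0) = 0"
    by (rule ltwo_eqI) (simp add: coord_Abs_finite)
  have norm: "X_norm (Abs_ltwo x) = vnorm ?V x" if x: "finite {j. x j \<noteq> 0}" for x
  proof -
    obtain m where "\<forall>j\<in>{j. x j \<noteq> 0}. j \<le> m"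
      using x finite_nat_set_iff_bounded_le by blast
    then have m: "\<forall>j>m. x j = 0" by force
    have "vnorm ?V x = M m x"
      by (rule c00_space_norm_eq[where N="Nc c", OF Nc_zero_right Nc_nonneg m])
    then show ?thesis
      using X_norm_finite[of m "Abs_ltwo x"] m by (simp add: coord_Abs_finite x)
  qed
  have inj: "inj_on Abs_ltwo (vcarrier ?V)"
    by (rule inj_onI) (metis c00_space_simps(1) coord_Abs_finite mem_Collect_eq)
  have V: "normed_space ?V"
    by (rule normed_space_via_embedding[OF X.normed_space inj])
      (simp_all add: c00_space_simps add scale Abs_add Abs_scale Abs_0 norm)
  have dense: "\<exists>\<sigma>. range \<sigma> \<subseteq> vcarrier ?V \<and> (\<lambda>n. Abs_ltwo (\<sigma> n)) \<longlonglongrightarrow> w" for w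
  proof (intro exI conjI)
    have "finite {j. coord (head n w) j \<noteq> 0}" for n
      by (rule finite_subset[of _ "{..n}"]) (auto split: if_splits)
    then show "range (\<lambda>n. coord (head n w)) \<subseteq> vcarrier ?V"
      by (auto simp: c00_space_simps)
    show "(\<lambda>n. Abs_ltwo (coord (head n w))) \<longlonglongrightarrow> w"
      by (simp add: coord_inverse head_tendsto)
  qed
  show ?thesis
    by (intro dense_embedding.intro dense_embedding_axioms.intro X.equivalent_norm_axioms V dense)
      (simp_all add: c00_space_simps Abs_add Abs_scale Abs_0 norm)
qed

theorem isometric_iso_X_space: "\<exists>I. isometric_iso (renormed X_norm) (X_space c) I"
  unfolding X_space_def A_space_def
  using dense_embedding.isometric_iso_completion[OF c00_dense_embedding] by blast

text \<open>
  All properties are read off from the two sequence models: \<open>E\<close> is isometric to the square summable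
  sequences under \<open>dual_norm X_norm\<close>, and the dual of \<open>E\<close> to those under \<open>dual_norm (dual_norm X_norm)\<close>, which
  is \<open>X_norm\<close>.
\<close>
theorem dual_X_space_properties:
  defines "E \<equiv> dual (X_space c)"
  shows "banach_space E" "reflexive_space E" "weak_maximizing_property E E"
    "\<not> weak_maximizing_property (dual E) (dual E)"
    "banach_mazur_distance E ell2 \<le> ereal (inverse c)"
proof -
  let ?P = "renormed X_norm" and ?Q = "renormed (dual_norm X_norm)"
  obtain I where I: "isometric_iso ?P (X_space c) I" using isometric_iso_X_space by blast
  have nX: "normed_space (X_space c)" by (rule isometric_iso_normed_space[OF X.normed_space I])
  have J: "isometric_iso (dual ?P) E (\<lambda>g. \<lambda>x\<in>vcarrier (X_space c). g (inv_into (vcarrier ?P) I x))"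
    unfolding E_def by (rule isometric_iso_dual[OF nX isometric_iso_inv[OF X.normed_space I]])
  obtain L where L: "isometric_iso ?Q E L"
    using isometric_iso_trans[OF X.isometric_iso_dual_norm J] by blast
  have nE: "normed_space E" by (rule isometric_iso_normed_space[OF X_dual.normed_space L])
  show "banach_space E" by (rule isometric_iso_banach[OF X_dual.banach_space L])
  show "weak_maximizing_property E E"
    by (rule isometric_iso_wmp[OF X_dual.normed_space L X_dual.weak_maximizing_property_renormed])
  show "banach_mazur_distance E ell2 \<le> ereal (inverse c)"
    using X_dual.banach_mazur_distance_ell2_le[OF L] by (simp add: inverse_eq_divide)
  have D: "isometric_iso (dual E) (dual ?Q) (\<lambda>g. \<lambda>y\<in>vcarrier ?Q. g (L y))"
    by (rule isometric_iso_dual[OF X_dual.normed_space L])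
  have D': "isometric_iso (dual ?Q) (dual E) (\<lambda>g. \<lambda>f\<in>vcarrier E. g (inv_into (vcarrier ?Q) L f))"
    by (rule isometric_iso_dual[OF nE isometric_iso_inv[OF X_dual.normed_space L]])
  have nD: "normed_space (dual E)"
    by (rule isometric_iso_normed_space[OF X_dual.normed_space_dual D'])
  show "reflexive_space E"
    by (rule isometric_iso_reflexive[OF X_dual.normed_space L nD X_dual.reflexive])
  have P: "isometric_iso ?P (dual ?Q) (\<lambda>y x. inner x y)"
    using X_dual.isometric_iso_dual_norm by (simp add: X_norm_bidual)
  have K: "isometric_iso (dual E) ?P (inv_into (vcarrier ?P) (\<lambda>y x. inner x y) \<circ>
      (\<lambda>g. \<lambda>y\<in>vcarrier ?Q. g (L y)))"
    by (rule isometric_iso_trans[OF D isometric_iso_inv[OF X.normed_space P]])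
  show "\<not> weak_maximizing_property (dual E) (dual E)"
    using isometric_iso_wmp[OF nD K] not_weak_maximizing_property_X_norm by blast
qed

end

theorem corollary5p5:
  "(\<forall>c::real. 0 < c \<and> c < 1 \<longrightarrow>
      (let E = dual (X_space c) in
         banach_space E \<and> reflexive_space E \<and>
         weak_maximizing_property E E \<and>
         \<not> weak_maximizing_property (dual E) (dual E) \<and>
         banach_mazur_distance E ell2 \<le> ereal (inverse c)))
   \<and> (\<forall>\<epsilon>::real. \<epsilon> > 0 \<longrightarrow>
      (\<exists>E :: ((nat \<Rightarrow> nat \<Rightarrow> real) set \<Rightarrow> real) nspace.
         banach_space E \<and> reflexive_space E \<and>
         banach_mazur_distance E ell2 \<le> ereal (1 + \<epsilon>) \<and>
         weak_maximizing_property E E \<and>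
         \<not> weak_maximizing_property (dual E) (dual E)))"
proof (intro conjI allI impI)
  fix c :: real assume "0 < c \<and> c < 1"
  then interpret norm_parameter c by unfold_locales auto
  show "let E = dual (X_space c) in
         banach_space E \<and> reflexive_space E \<and>
         weak_maximizing_property E E \<and>
         \<not> weak_maximizing_property (dual E) (dual E) \<and>
         banach_mazur_distance E ell2 \<le> ereal (inverse c)"
    unfolding Let_def using dual_X_space_properties by blast
next
  fix \<epsilon> :: real assume "\<epsilon> > 0"
  then interpret norm_parameter "inverse (1 + \<epsilon>)"
    by unfold_locales (auto simp: field_simps)
  show "\<exists>E :: ((nat \<Rightarrow> nat \<Rightarrow> real) set \<Rightarrow> real) nspace.
         banach_space E \<and> reflexive_space E \<and>
         banach_mazur_distance E ell2 \<le> ereal (1 + \<epsilon>) \<and>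
         weak_maximizing_property E E \<and>
         \<not> weak_maximizing_property (dual E) (dual E)"
    using dual_X_space_properties unfolding inverse_inverse_eq by blast
qed

end
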